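(* Let $n\in\mathbb N$, and let $R_t^{\mathrm{wl}}(y_0)$ and $R_t^{\mathrm{ms}}(y_0)$ denote the remainders generated by truncating the separated stochastic Taylor expansion $y_t=\sum_{w\in\mathbb A^*}I_w(t)\tilde V_w(y_0)$ using respectively the word length grading and the mean-square grading, both truncated at the same grade $n$, i.e. $$R_t^{\mathrm{wl}}(y_0)=\sum_{|w|\ge n+1}I_w(t)\tilde V_w(y_0),\qquad R_t^{\mathrm{ms}}(y_0)=\sum_{\mathrm g^{\mathrm{ms}}(w)\ge n+1}I_w(t)\tilde V_w(y_0).$$ Then at leading order (i.e. comparing the coefficients of $t^{n+1}$, the lowest power of $t$ that occurs in the expansions of the two sides in powers of $t$), for all $n$, $$\bigl\|R_t^{\mathrm{wl}}(y_0)\bigr\|_{L^2}^2\leqslant\bigl\|R_t^{\mathrm{ms}}(y_0)\bigr\|_{L^2}^2 .$$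
   Context: Setting: an It\^o equation on $\mathbb R^N$, $y_t=y_0+\sum_{i=0}^d\int_0^tV_i(y_s)\,\mathrm dW^i_s+\sum_{i=d+1}^\ell\int_0^tV_i(y_{s_-})\,\mathrm dJ^i_s$, where $W^0_t\equiv t$, $W^1,\dots,W^d$ are Wiener processes, and $J^i_t=\int_0^t\int_{\mathbb R}v\,\overline Q^i(\mathrm dv,\mathrm ds)$ for $d<i\le\ell$ are purely discontinuous martingales, $\overline Q^i$ being the compensation of a Poisson measure with intensity $\rho^i(\mathrm dv)\mathrm ds$, $\rho^i(\{0\})=0$, $\int(1\wedge v^2)\rho^i(\mathrm dv)<\infty$. All these processes are independent and the $J^i$ have moments of all orders. The initial data satisfies $y_0\in L^2(\Omega,\mathcal F_0,P)$. Extended alphabet: for $d<i\le\ell$, $p\ge2$, put $J^{i^{(p)}}_t=\int_0^t\int_{\mathbb R}v^p\,\overline Q^i(\mathrm dv,\mathrm ds)$. The alphabet $\mathbb A$ consists of $0,1,\dots,\ell$ (associated with $W^0,\dots,W^d,J^{d+1},\dots,J^\ell$) together with the letters $i^{(p)}$ (associated with $J^{i^{(p)}}$) for which $J^{i^{(p)}}$ is not in the linear span of $\{t,J^i,J^{i^{(2)}},\dots,J^{i^{(p-1)}}\}$. $\mathbb A^*$ is the set of words over $\mathbb A$. With $Z^a$ the process associated with letter $a$, $I_w(t)=\int_{0<\tau_1<\cdots<\tau_m<t}\mathrm dZ^{a_1}_{\tau_1}\cdots\mathrm dZ^{a_m}_{\tau_m}$ for $w=a_1\ldots a_m$ (and $I_w=1$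 for the empty word). Standing assumption: the flowmap $y_0\mapsto y_t$ possesses a separated stochastic Taylor expansion $\sum_{w\in\mathbb A^*}I_w(t)\tilde V_w$, where $\tilde V_w=\tilde V_{a_1}\circ\cdots\circ\tilde V_{a_m}$ are compositions of operators $\tilde V_a$, $a\in\mathbb A$, not depending on $t$ or on the randomness; $\tilde V_w(y_0)\in\mathbb R^N$ denotes $\tilde V_w$ applied to the identity map, evaluated at $y_0$. The vector fields are assumed regular enough for the expansion and its remainders to converge in $L^2$. Gradings: for a word $w$ let $\zeta(w)$ be the number of letters of $w$ equal to $0$ and $\xi(w)$ the number of its other letters. The mean-square grade is $\mathrm g^{\mathrm{ms}}(w)=2\zeta(w)+\xi(w)$ and the word length grade is $|w|=\zeta(w)+\xi(w)$. Truncating at grade $n$ means keeping exactly the words of grade $\le n$. *)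

theory Defs
  imports "HOL-Probability.Probability"
begin

section \<open>Processes and square-integrable limits\<close>

text \<open>A stochastic process is a map of type \<open>real \<Rightarrow> 'a \<Rightarrow> 'b\<close> of which only the times
  \<open>t \<ge> 0\<close> are meaningful. Squared \<open>L\<^sup>2\<close> distances are extended nonnegative integrals, so that
  "distance tends to 0" cannot hold by a junk value of the Bochner integral.\<close>

definition L2_dist2 :: "'a measure \<Rightarrow> ('a \<Rightarrow> 'b::euclidean_space) \<Rightarrow> ('a \<Rightarrow> 'b) \<Rightarrow> ennreal" where
  "L2_dist2 M X Y = (\<integral>\<^sup>+\<omega>. ennreal ((norm (X \<omega> - Y \<omega>))\<^sup>2) \<partial>M)"

definition L2_norm :: "'a measure \<Rightarrow> ('a \<Rightarrow> 'b::euclidean_space) \<Rightarrow> real" where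
  "L2_norm M X = sqrt (\<integral>\<omega>. (norm (X \<omega>))\<^sup>2 \<partial>M)"

definition square_integrable :: "'a measure \<Rightarrow> ('a \<Rightarrow> 'b::euclidean_space) \<Rightarrow> bool" where
  "square_integrable M X \<longleftrightarrow>
     X \<in> borel_measurable M \<and> integrable M (\<lambda>\<omega>. (norm (X \<omega>))\<^sup>2)"

text \<open>Unordered summation in \<open>L\<^sup>2\<close>: the finite partial sums converge to \<open>X\<close> along the directed
  set of finite subsets of \<open>A\<close>.\<close>

definition L2_has_sum ::
  "'a measure \<Rightarrow> ('w \<Rightarrow> 'a \<Rightarrow> 'b::euclidean_space) \<Rightarrow> 'w set \<Rightarrow> ('a \<Rightarrow> 'b) \<Rightarrow> bool" where
  "L2_has_sum M f A X \<longleftrightarrow>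
     (\<forall>w\<in>A. square_integrable M (f w)) \<and> X \<in> borel_measurable M \<and>
     ((\<lambda>S. L2_dist2 M X (\<lambda>\<omega>. \<Sum>w\<in>S. f w \<omega>)) \<longlongrightarrow> 0) (finite_subsets_at_top A)"

definition left_limit :: "(real \<Rightarrow> 'a \<Rightarrow> 'b::t2_space) \<Rightarrow> real \<Rightarrow> 'a \<Rightarrow> 'b" where
  "left_limit X s \<omega> = Lim (at_left s) (\<lambda>r. X r \<omega>)"

definition cadlag_process :: "'a measure \<Rightarrow> (real \<Rightarrow> 'a \<Rightarrow> 'b::euclidean_space) \<Rightarrow> bool" where
  "cadlag_process M X \<longleftrightarrow>
     (\<forall>t\<ge>0. X t \<in> borel_measurable M) \<and>
     (\<forall>\<omega>\<in>space M. (\<forall>t\<ge>0. continuous (at_right t) (\<lambda>s. X s \<omega>)) \<and>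
                  (\<forall>t>0. \<exists>x. ((\<lambda>s. X s \<omega>) \<longlongrightarrow> x) (at_left t)))"

section \<open>Stochastic integrals\<close>

text \<open>\<open>(K, \<tau>, h)\<close> encodes the integrand \<open>\<Sum>k<K. h k\<close> on \<open>(\<tau> k, \<tau> (k + 1)]\<close>.\<close>

type_synonym ('a, 'b) step_process = "nat \<times> (nat \<Rightarrow> real) \<times> (nat \<Rightarrow> 'a \<Rightarrow> 'b)"

definition simple_predictable ::
  "(real \<Rightarrow> 'a measure) \<Rightarrow> ('a, 'b::euclidean_space) step_process \<Rightarrow> bool" where
  "simple_predictable F = (\<lambda>(K, \<tau>, h).
     0 \<le> \<tau> 0 \<and> (\<forall>k<K. \<tau> k \<le> \<tau> (Suc k)) \<and>
     (\<forall>k<K. h k \<in> borel_measurable (F (\<tau> k)) \<and> (\<exists>C. \<forall>\<omega>\<in>space (F (\<tau> k)). norm (h k \<omega>) \<le> C)))"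

definition step_value ::
  "('a, 'b::euclidean_space) step_process \<Rightarrow> real \<Rightarrow> 'a \<Rightarrow> 'b" where
  "step_value = (\<lambda>(K, \<tau>, h) s \<omega>. \<Sum>k<K. indicat_real {\<tau> k<..\<tau> (Suc k)} s *\<^sub>R h k \<omega>)"

definition step_integral ::
  "(real \<Rightarrow> 'a \<Rightarrow> real) \<Rightarrow> ('a, 'b::euclidean_space) step_process \<Rightarrow> real \<Rightarrow> 'a \<Rightarrow> 'b" where
  "step_integral Z = (\<lambda>(K, \<tau>, h) t \<omega>.
     \<Sum>k<K. (Z (min t (\<tau> (Suc k))) \<omega> - Z (min t (\<tau> k)) \<omega>) *\<^sub>R h k \<omega>)"

text \<open>\<open>X t = \<integral>\<^sub>0\<^sup>t H s dZ s\<close> as an \<open>L\<^sup>2\<close> limit of integrals of simple predictable processes. All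
  integrators \<open>Z\<close> used below are square-integrable martingales with predictable quadratic
  variation \<open>c t\<close>, whence the integrands are approximated in \<open>L\<^sup>2(ds \<otimes> P)\<close>.\<close>

definition ito_integral ::
  "'a measure \<Rightarrow> (real \<Rightarrow> 'a measure) \<Rightarrow> (real \<Rightarrow> 'a \<Rightarrow> real) \<Rightarrow>
   (real \<Rightarrow> 'a \<Rightarrow> 'b::euclidean_space) \<Rightarrow> (real \<Rightarrow> 'a \<Rightarrow> 'b) \<Rightarrow> bool" where
  "ito_integral M F Z H X \<longleftrightarrow>
     (\<lambda>(s, \<omega>). indicat_real {0<..} s *\<^sub>R H s \<omega>) \<in> borel_measurable (lborel \<Otimes>\<^sub>M M) \<and>
     (\<forall>t\<ge>0. X t \<in> borel_measurable M \<and>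
        (\<exists>S. (\<forall>m. simple_predictable F (S m)) \<and>
             (\<lambda>m. \<integral>\<^sup>+\<omega>. (\<integral>\<^sup>+s\<in>{0<..t}. ennreal ((norm (H s \<omega> - step_value (S m) s \<omega>))\<^sup>2) \<partial>lborel) \<partial>M)
               \<longlonglongrightarrow> 0 \<and>
             (\<lambda>m. L2_dist2 M (X t) (step_integral Z (S m) t)) \<longlonglongrightarrow> 0))"

definition time_integral ::
  "'a measure \<Rightarrow> (real \<Rightarrow> 'a \<Rightarrow> 'b::euclidean_space) \<Rightarrow> (real \<Rightarrow> 'a \<Rightarrow> 'b) \<Rightarrow> bool" where
  "time_integral M H X \<longleftrightarrow>
     (\<forall>t\<ge>0. X t \<in> borel_measurable M \<and>
        (AE \<omega> in M. set_integrable lborel {0<..t} (\<lambda>s. H s \<omega>) \<and>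
                    X t \<omega> = (LINT s:{0<..t}|lborel. H s \<omega>)))"

section \<open>Driving processes\<close>

definition wiener_process :: "'a measure \<Rightarrow> (real \<Rightarrow> 'a \<Rightarrow> real) \<Rightarrow> bool" where
  "wiener_process M W \<longleftrightarrow>
     (\<forall>t\<ge>0. W t \<in> borel_measurable M) \<and>
     (AE \<omega> in M. W 0 \<omega> = 0 \<and> continuous_on {0..} (\<lambda>t. W t \<omega>)) \<and>
     (\<forall>s\<ge>0. \<forall>t>s. distributed M lborel (\<lambda>\<omega>. W t \<omega> - W s \<omega>) (normal_density 0 (sqrt (t - s)))) \<and>
     (\<forall>u::nat \<Rightarrow> real. 0 \<le> u 0 \<and> mono u \<longrightarrow>
        prob_space.indep_vars M (\<lambda>_. borel) (\<lambda>k \<omega>. W (u (Suc k)) \<omega> - W (u k) \<omega>) UNIV)"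

definition levy_measure :: "real measure \<Rightarrow> bool" where
  "levy_measure \<rho> \<longleftrightarrow>
     sets \<rho> = sets borel \<and> emeasure \<rho> {0} = 0 \<and> (\<integral>\<^sup>+v. ennreal (min 1 (v\<^sup>2)) \<partial>\<rho>) < \<infinity>"

text \<open>Points of the plane are pairs (jump size, time).\<close>

definition intensity :: "real measure \<Rightarrow> (real \<times> real) measure" where
  "intensity \<rho> = \<rho> \<Otimes>\<^sub>M density lborel (indicator {0<..})"

definition poisson_measure ::
  "'a measure \<Rightarrow> real measure \<Rightarrow> ('a \<Rightarrow> (real \<times> real) measure) \<Rightarrow> bool" where
  "poisson_measure M \<rho> Q \<longleftrightarrow>
     (\<forall>\<omega>\<in>space M. sets (Q \<omega>) = sets borel) \<and>
     (\<forall>B\<in>sets borel. (\<lambda>\<omega>. emeasure (Q \<omega>) B) \<in> borel_measurable M) \<and>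
     (\<forall>B\<in>sets borel. emeasure (intensity \<rho>) B < \<infinity> \<longrightarrow>
        (\<forall>k. measure M {\<omega> \<in> space M. emeasure (Q \<omega>) B = of_nat k} =
             measure (intensity \<rho>) B ^ k / fact k * exp (- measure (intensity \<rho>) B))) \<and>
     (\<forall>B::nat \<Rightarrow> _. range B \<subseteq> sets borel \<and> disjoint_family B \<longrightarrow>
        prob_space.indep_vars M (\<lambda>_. borel) (\<lambda>k \<omega>. emeasure (Q \<omega>) (B k)) UNIV)"

text \<open>\<open>X t = \<integral>\<^sub>0\<^sup>t \<integral> f v (Q(dv, ds) - \<rho>(dv) ds)\<close>: the compensated sum over the jumps larger than
  \<open>\<epsilon>\<close>, in the \<open>L\<^sup>2\<close> limit \<open>\<epsilon> \<rightarrow> 0\<close>.\<close>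

definition compensated_integral ::
  "'a measure \<Rightarrow> real measure \<Rightarrow> ('a \<Rightarrow> (real \<times> real) measure) \<Rightarrow> (real \<Rightarrow> real) \<Rightarrow>
   (real \<Rightarrow> 'a \<Rightarrow> real) \<Rightarrow> bool" where
  "compensated_integral M \<rho> Q f X \<longleftrightarrow>
     (\<forall>\<epsilon>>0. set_integrable \<rho> {v. \<epsilon> < \<bar>v\<bar>} f) \<and>
     (\<forall>t\<ge>0. X t \<in> borel_measurable M \<and>
        ((\<lambda>\<epsilon>. L2_dist2 M (X t)
                (\<lambda>\<omega>. (LINT x:{v. \<epsilon> < \<bar>v\<bar>} \<times> {0<..t}|Q \<omega>. f (fst x))
                     - t * (LINT v:{v. \<epsilon> < \<bar>v\<bar>}|\<rho>. f v))) \<longlongrightarrow> 0) (at_right 0))"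

definition wiener_future :: "'a measure \<Rightarrow> (real \<Rightarrow> 'a \<Rightarrow> real) \<Rightarrow> real \<Rightarrow> 'a set set" where
  "wiener_future M W s = sigma_sets (space M)
     {(\<lambda>\<omega>. W t \<omega> - W s \<omega>) -` B \<inter> space M | t B. s \<le> t \<and> B \<in> sets borel}"

definition poisson_future ::
  "'a measure \<Rightarrow> ('a \<Rightarrow> (real \<times> real) measure) \<Rightarrow> real \<Rightarrow> 'a set set" where
  "poisson_future M Q s = sigma_sets (space M)
     {(\<lambda>\<omega>. emeasure (Q \<omega>) A) -` B \<inter> space M | A B.
        A \<in> sets borel \<and> A \<subseteq> UNIV \<times> {s<..} \<and> B \<in> sets borel}"

text \<open>\<open>W i\<close> for \<open>1 \<le> i \<le> d\<close> are the Wiener processes; for \<open>d < i \<le> l\<close>, \<open>Q i\<close> is the Poisson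
  measure, \<open>J i 1\<close> the purely discontinuous martingale and \<open>J i p\<close> its \<open>p\<close>-th power process.
  In \<open>independence\<close>, index 0 carries the past; at \<open>s = 0\<close> the condition says that all driving
  processes are mutually independent and jointly independent of the initial \<open>\<sigma>\<close>-algebra, for
  general \<open>s\<close> that they are Wiener processes and Poisson measures relative to the filtration.\<close>

locale levy_drivers = prob_space M + filtration "space M" F
  for M :: "'a measure" and F :: "real \<Rightarrow> 'a measure" +
  fixes d l :: nat
    and W :: "nat \<Rightarrow> real \<Rightarrow> 'a \<Rightarrow> real"
    and \<rho> :: "nat \<Rightarrow> real measure"
    and Q :: "nat \<Rightarrow> 'a \<Rightarrow> (real \<times> real) measure"
    and J :: "nat \<Rightarrow> nat \<Rightarrow> real \<Rightarrow> 'a \<Rightarrow> real"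
  assumes d_le_l: "d \<le> l"
    and subalgebra_F: "\<And>t. subalgebra M (F t)"
    and wiener: "\<And>i. i \<in> {1..d} \<Longrightarrow> wiener_process M (W i)"
    and wiener_adapted: "\<And>i t. i \<in> {1..d} \<Longrightarrow> 0 \<le> t \<Longrightarrow> W i t \<in> borel_measurable (F t)"
    and levy: "\<And>i. i \<in> {d<..l} \<Longrightarrow> levy_measure (\<rho> i)"
    and poisson: "\<And>i. i \<in> {d<..l} \<Longrightarrow> poisson_measure M (\<rho> i) (Q i)"
    and poisson_adapted: "\<And>i t A. i \<in> {d<..l} \<Longrightarrow> 0 \<le> t \<Longrightarrow> A \<in> sets borel \<Longrightarrow>
          A \<subseteq> UNIV \<times> {0<..t} \<Longrightarrow> (\<lambda>\<omega>. emeasure (Q i \<omega>) A) \<in> borel_measurable (F t)"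
    and independence: "\<And>s. 0 \<le> s \<Longrightarrow>
          indep_sets (\<lambda>i. if i = 0 then sets (F s)
                          else if i \<le> d then wiener_future M (W i) s
                          else poisson_future M (Q i) s) {0..l}"
    and jumps: "\<And>i p. i \<in> {d<..l} \<Longrightarrow> 1 \<le> p \<Longrightarrow>
          compensated_integral M (\<rho> i) (Q i) (\<lambda>v. v ^ p) (J i p)"
    and moments: "\<And>i t k. i \<in> {d<..l} \<Longrightarrow> 0 \<le> t \<Longrightarrow>
          integrable M (\<lambda>\<omega>. \<bar>J i 1 t \<omega>\<bar> ^ (k::nat))"

section \<open>The equation\<close>

definition solves_sde ::
  "'a measure \<Rightarrow> (real \<Rightarrow> 'a measure) \<Rightarrow> nat \<Rightarrow> nat \<Rightarrow> (nat \<Rightarrow> real \<Rightarrow> 'a \<Rightarrow> real) \<Rightarrow>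
   (nat \<Rightarrow> nat \<Rightarrow> real \<Rightarrow> 'a \<Rightarrow> real) \<Rightarrow> (nat \<Rightarrow> real ^ 'n \<Rightarrow> real ^ 'n) \<Rightarrow>
   ('a \<Rightarrow> real ^ 'n) \<Rightarrow> (real \<Rightarrow> 'a \<Rightarrow> real ^ 'n) \<Rightarrow> bool" where
  "solves_sde M F d l W J V y0 y \<longleftrightarrow>
     cadlag_process M y \<and> (\<forall>t\<ge>0. y t \<in> borel_measurable (F t)) \<and>
     (\<exists>X. time_integral M (\<lambda>s \<omega>. V 0 (y s \<omega>)) (X 0) \<and>
          (\<forall>i\<in>{1..d}. ito_integral M F (W i) (\<lambda>s \<omega>. V i (y s \<omega>)) (X i)) \<and>
          (\<forall>i\<in>{d<..l}. ito_integral M F (J i 1) (\<lambda>s \<omega>. V i (left_limit y s \<omega>)) (X i)) \<and>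
          (\<forall>t\<ge>0. AE \<omega> in M. y t \<omega> = y0 \<omega> + (\<Sum>i\<in>{0..l}. X i t \<omega>)))"

section \<open>Words, iterated integrals and gradings\<close>

text \<open>\<open>Base i\<close> is the letter \<open>i\<close>, and \<open>Power i p\<close> is the letter \<open>i\<^bsup>(p)\<^esup>\<close>, \<open>p \<ge> 2\<close>.\<close>

datatype letter = Base nat | Power nat nat

fun driver ::
  "nat \<Rightarrow> (nat \<Rightarrow> real \<Rightarrow> 'a \<Rightarrow> real) \<Rightarrow> (nat \<Rightarrow> nat \<Rightarrow> real \<Rightarrow> 'a \<Rightarrow> real) \<Rightarrow>
   letter \<Rightarrow> real \<Rightarrow> 'a \<Rightarrow> real" where
  "driver d W J (Base i) = (if i = 0 then (\<lambda>t _. t) else if i \<le> d then W i else J i 1)"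
| "driver d W J (Power i p) = J i p"

definition power_in_span ::
  "'a measure \<Rightarrow> (nat \<Rightarrow> real \<Rightarrow> 'a \<Rightarrow> real) \<Rightarrow> nat \<Rightarrow> bool" where
  "power_in_span M K p \<longleftrightarrow>
     (\<exists>(c0::real) (c::nat \<Rightarrow> real). \<forall>t\<ge>0. AE \<omega> in M. K p t \<omega> = c0 * t + (\<Sum>q=1..<p. c q * K q t \<omega>))"

definition alphabet ::
  "'a measure \<Rightarrow> nat \<Rightarrow> nat \<Rightarrow> (nat \<Rightarrow> nat \<Rightarrow> real \<Rightarrow> 'a \<Rightarrow> real) \<Rightarrow> letter set" where
  "alphabet M d l J =
     Base ` {0..l} \<union> {Power i p | i p. i \<in> {d<..l} \<and> 2 \<le> p \<and> \<not> power_in_span M (J i) p}"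

text \<open>\<open>I (a\<^sub>1 \<dots> a\<^sub>m)\<close> is the integral over \<open>0 < \<tau>\<^sub>1 < \<dots> < \<tau>\<^sub>m < t\<close>, the last letter being the
  outermost integrator; the strict inequalities correspond to the left limits.\<close>

definition iterated_integrals ::
  "'a measure \<Rightarrow> (real \<Rightarrow> 'a measure) \<Rightarrow> letter set \<Rightarrow> (letter \<Rightarrow> real \<Rightarrow> 'a \<Rightarrow> real) \<Rightarrow>
   (letter list \<Rightarrow> real \<Rightarrow> 'a \<Rightarrow> real) \<Rightarrow> bool" where
  "iterated_integrals M F A Z I \<longleftrightarrow>
     (\<forall>t \<omega>. I [] t \<omega> = 1) \<and>
     (\<forall>w\<in>lists A. \<forall>a\<in>A. cadlag_process M (I (w @ [a])) \<and>
        (if a = Base 0 then time_integral M (left_limit (I w)) (I (w @ [a]))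
         else ito_integral M F (Z a) (left_limit (I w)) (I (w @ [a]))))"

text \<open>The composition \<open>V a\<^sub>1 \<circ> \<dots> \<circ> V a\<^sub>m\<close> of operators on functions.\<close>

definition word_operator ::
  "(letter \<Rightarrow> ('f \<Rightarrow> 'f)) \<Rightarrow> letter list \<Rightarrow> 'f \<Rightarrow> 'f" where
  "word_operator V w = foldr (\<circ>) (map V w) id"

definition zero_count :: "letter list \<Rightarrow> nat" where
  "zero_count w = length (filter (\<lambda>a. a = Base 0) w)"

definition nonzero_count :: "letter list \<Rightarrow> nat" where
  "nonzero_count w = length (filter (\<lambda>a. a \<noteq> Base 0) w)"

definition ms_grade :: "letter list \<Rightarrow> nat" where
  "ms_grade w = 2 * zero_count w + nonzero_count w"

definition wl_grade :: "letter list \<Rightarrow> nat" where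
  "wl_grade w = zero_count w + nonzero_count w"

end

theory Submission
  imports Defs "HOL-Complex_Analysis.Great_Picard"
begin

text \<open>Writing \<open>\<zeta>\<close> and \<open>\<xi>\<close> for the numbers of zero and nonzero letters, the Ito isometry and the
  martingale property show that \<open>E [h I\<^sub>u(t) I\<^sub>v(t)] = C\<^sub>u\<^sub>v t\<^bsup>\<zeta>(u)+\<zeta>(v)+\<xi>(u)\<^esup> E h\<close> for bounded
  \<open>F\<^sub>0\<close>-measurable \<open>h\<close>, with \<open>C\<^sub>u\<^sub>v = 0\<close> unless \<open>\<xi>(u) = \<xi>(v)\<close>. Hence the squared norm of a finite
  partial sum of the expansion is a polynomial in \<open>t\<close>. Its \<open>k\<close>-th coefficient is a sum of at most
  \<open>(k + 1)\<^sup>2\<close> inner products of partial sums over classes of words with equal \<open>\<zeta>\<close> and \<open>\<xi>\<close>;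
  unconditional convergence at a time \<open>u < T\<close> bounds it by \<open>C\<^sup>2 (k + 1)\<^sup>2 u\<^bsup>-k\<^esup>\<close>, uniformly in the partial
  sum, so that the polynomials converge to a power series on \<open>[0, T)\<close>. The only class contributing
  to the coefficient of \<open>t\<^bsup>n+1\<^esup>\<close> for the word length remainder is \<open>\<zeta> = 0, \<xi> = n + 1\<close>, whereas for the
  mean-square remainder all classes with \<open>2 \<zeta> + \<xi> = n + 1\<close> contribute, each of them a squared
  norm.\<close>

section \<open>Square-integrable functions\<close>

text \<open>Three obstacles shape the development. For each time separately,
  \<open>ito_integral\<close> offers some approximating step processes and nothing else, so
  adaptedness, the martingale property and the isometry have to be recovered from limits of step
  integrals. Conditional expectations are replaced by orthogonality relations, which survive L2
  limits. The initial value is random, and the vectors multiplying the iterated integrals are only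
  measurable at time 0; hence every moment formula carries a bounded weight, and unbounded weights
  are reached by truncation. Finally, the expansion converges unconditionally in L2, which gives no
  absolute convergence of the double series of covariances; coefficients are therefore controlled
  through norms of whole classes of words. They converge along a subsequence of one exhaustion of
  the set of words, common to both remainders, which lets the inequality between the coefficients of
  finite sums pass to the limit. The covariance constants are never evaluated: only their existence
  and the vanishing of some of them matter.\<close>

lemma square_integrable_measurable [measurable_dest]:
  "square_integrable M X \<Longrightarrow> X \<in> borel_measurable M"
  by (simp add: square_integrable_def)

lemma square_integrable_norm_sq:
  "square_integrable M X \<Longrightarrow> integrable M (\<lambda>\<omega>. (norm (X \<omega>))\<^sup>2)"
  by (simp add: square_integrable_def)

lemma square_integrable_inner:
  assumes "square_integrable M X" "square_integrable M Y"
  shows "integrable M (\<lambda>\<omega>. X \<omega> \<bullet> Y \<omega>)"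
proof (rule Bochner_Integration.integrable_bound)
  show "integrable M (\<lambda>\<omega>. (norm (X \<omega>))\<^sup>2 + (norm (Y \<omega>))\<^sup>2)"
    using assms by (auto intro: square_integrable_norm_sq)
  show "(\<lambda>\<omega>. X \<omega> \<bullet> Y \<omega>) \<in> borel_measurable M"
    using assms by (auto dest: square_integrable_measurable)
  have "\<bar>x \<bullet> y\<bar> \<le> (norm x)\<^sup>2 + (norm y)\<^sup>2" for x y :: 'b
  proof -
    have "0 \<le> (norm x - norm y)\<^sup>2" by simp
    then have "norm x * norm y * 2 \<le> (norm x)\<^sup>2 + (norm y)\<^sup>2"
      by (simp add: power2_diff)
    moreover have "\<bar>x \<bullet> y\<bar> \<le> norm x * norm y" by (rule Cauchy_Schwarz_ineq2)
    moreover have "0 \<le> norm x * norm y" by simp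
    ultimately show ?thesis by linarith
  qed
  then show "AE \<omega> in M. norm (X \<omega> \<bullet> Y \<omega>) \<le> norm ((norm (X \<omega>))\<^sup>2 + (norm (Y \<omega>))\<^sup>2)"
    by simp
qed

lemma square_integrable_mult:
  fixes X Y :: "'a \<Rightarrow> real"
  assumes "square_integrable M X" "square_integrable M Y"
  shows "integrable M (\<lambda>\<omega>. X \<omega> * Y \<omega>)"
  using square_integrable_inner[OF assms] by simp

lemma square_integrable_zero [simp]: "square_integrable M (\<lambda>\<omega>. 0)"
  by (simp add: square_integrable_def)

lemma square_integrable_add:
  assumes "square_integrable M X" "square_integrable M Y"
  shows "square_integrable M (\<lambda>\<omega>. X \<omega> + Y \<omega>)"
  unfolding square_integrable_def
proof
  show "(\<lambda>\<omega>. X \<omega> + Y \<omega>) \<in> borel_measurable M"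
    using assms by (auto dest: square_integrable_measurable)
  have "integrable M (\<lambda>\<omega>. (norm (X \<omega>))\<^sup>2 + 2 * (X \<omega> \<bullet> Y \<omega>) + (norm (Y \<omega>))\<^sup>2)"
    using assms by (intro Bochner_Integration.integrable_add integrable_mult_right
        square_integrable_norm_sq square_integrable_inner)
  then show "integrable M (\<lambda>\<omega>. (norm (X \<omega> + Y \<omega>))\<^sup>2)"
    by (simp add: power2_norm_eq_inner inner_add_left inner_add_right inner_commute algebra_simps)
qed

lemma square_integrable_bounded_scaleR:
  assumes X: "square_integrable M X" and g: "g \<in> borel_measurable M"
    and C: "\<And>\<omega>. \<omega> \<in> space M \<Longrightarrow> \<bar>g \<omega>\<bar> \<le> C"
  shows "square_integrable M (\<lambda>\<omega>. g \<omega> *\<^sub>R X \<omega>)"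
  unfolding square_integrable_def
proof
  show m: "(\<lambda>\<omega>. g \<omega> *\<^sub>R X \<omega>) \<in> borel_measurable M"
    using X g by (auto dest: square_integrable_measurable)
  show "integrable M (\<lambda>\<omega>. (norm (g \<omega> *\<^sub>R X \<omega>))\<^sup>2)"
  proof (rule Bochner_Integration.integrable_bound)
    show "integrable M (\<lambda>\<omega>. C\<^sup>2 * (norm (X \<omega>))\<^sup>2)"
      using X by (auto intro: square_integrable_norm_sq)
    show "(\<lambda>\<omega>. (norm (g \<omega> *\<^sub>R X \<omega>))\<^sup>2) \<in> borel_measurable M"
      using m by measurable
    have "(g \<omega>)\<^sup>2 \<le> C\<^sup>2" if "\<omega> \<in> space M" for \<omega>
      using C[OF that] by (metis abs_ge_zero abs_le_square_iff abs_of_nonneg order_trans)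
    then show "AE \<omega> in M. norm ((norm (g \<omega> *\<^sub>R X \<omega>))\<^sup>2) \<le> norm (C\<^sup>2 * (norm (X \<omega>))\<^sup>2)"
      by (auto simp: power_mult_distrib intro!: AE_I2 mult_right_mono)
  qed
qed

lemma square_integrable_bounded_mult:
  fixes X :: "'a \<Rightarrow> real"
  assumes "square_integrable M X" "g \<in> borel_measurable M"
    and "\<And>\<omega>. \<omega> \<in> space M \<Longrightarrow> \<bar>g \<omega>\<bar> \<le> C"
  shows "square_integrable M (\<lambda>\<omega>. g \<omega> * X \<omega>)"
  using square_integrable_bounded_scaleR[OF assms] by simp

lemma square_integrable_scaleR:
  assumes "square_integrable M X"
  shows "square_integrable M (\<lambda>\<omega>. c *\<^sub>R X \<omega>)"
  using square_integrable_bounded_scaleR[OF assms, of "\<lambda>_. c" "\<bar>c\<bar>"] by simp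

lemma square_integrable_diff:
  assumes "square_integrable M X" "square_integrable M Y"
  shows "square_integrable M (\<lambda>\<omega>. X \<omega> - Y \<omega>)"
  using square_integrable_add[OF assms(1) square_integrable_scaleR[OF assms(2), of "-1"]] by simp

lemma square_integrable_sum:
  assumes "\<And>i. i \<in> S \<Longrightarrow> square_integrable M (f i)"
  shows "square_integrable M (\<lambda>\<omega>. \<Sum>i\<in>S. f i \<omega>)"
  using assms by (induction S rule: infinite_finite_induct) (auto intro: square_integrable_add)

section \<open>The L2 seminorm\<close>

lemma L2_norm_sq: "(L2_norm M X)\<^sup>2 = (\<integral>\<omega>. (norm (X \<omega>))\<^sup>2 \<partial>M)"
  by (simp add: L2_norm_def)

lemma L2_norm_nonneg [simp]: "0 \<le> L2_norm M X"
  by (simp add: L2_norm_def)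

lemma L2_norm_Cauchy_Schwarz:
  assumes X: "square_integrable M X" and Y: "square_integrable M Y"
  shows "\<bar>\<integral>\<omega>. X \<omega> \<bullet> Y \<omega> \<partial>M\<bar> \<le> L2_norm M X * L2_norm M Y"
proof -
  define a b c where "a = (L2_norm M X)\<^sup>2" and "b = (\<integral>\<omega>. X \<omega> \<bullet> Y \<omega> \<partial>M)" and "c = (L2_norm M Y)\<^sup>2"
  \<comment> \<open>Nonnegativity of the squared norm of \<open>X + r Y\<close>, a quadratic
    polynomial in \<open>r\<close>; the inequality is read off from suitable values of
    \<open>r\<close>.\<close>
  have q: "0 \<le> a + 2 * r * b + r\<^sup>2 * c" for r
  proof -
    have "0 \<le> (\<integral>\<omega>. (norm (X \<omega> + r *\<^sub>R Y \<omega>))\<^sup>2 \<partial>M)" by simp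
    also have "\<dots> = (\<integral>\<omega>. (norm (X \<omega>))\<^sup>2 + (2 * r) * (X \<omega> \<bullet> Y \<omega>) + r\<^sup>2 * (norm (Y \<omega>))\<^sup>2 \<partial>M)"
      unfolding power2_norm_eq_inner
      by (intro Bochner_Integration.integral_cong)
         (auto simp: inner_add_left inner_add_right inner_commute algebra_simps power2_eq_square)
    also have "\<dots> = a + 2 * r * b + r\<^sup>2 * c"
      using square_integrable_norm_sq[OF X] square_integrable_norm_sq[OF Y]
        square_integrable_inner[OF X Y]
      by (simp add: a_def b_def c_def L2_norm_sq)
    finally show ?thesis .
  qed
  have "b\<^sup>2 \<le> a * c"
  proof (cases "c = 0")
    case True
    have "b = 0"
    proof (rule ccontr)
      assume "b \<noteq> 0"
      \<comment> \<open>With \<open>c = 0\<close> the polynomial is affine in \<open>r\<close>, and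
        at this point it takes the value -1.\<close>
      then show False using q[of "- (a + 1) / (2 * b)"] True by (simp add: field_simps)
    qed
    then show ?thesis using True by simp
  next
    case False
    then have "c > 0" by (simp add: c_def)
    \<comment> \<open>The minimiser of the polynomial.\<close>
    then show ?thesis using q[of "- b / c"]
      by (simp add: field_simps power2_eq_square)
  qed
  then have "sqrt (b\<^sup>2) \<le> sqrt (a * c)" by (rule real_sqrt_le_mono)
  then show ?thesis by (simp add: a_def c_def b_def real_sqrt_mult)
qed

lemma L2_norm_triangle:
  assumes X: "square_integrable M X" and Y: "square_integrable M Y"
  shows "L2_norm M (\<lambda>\<omega>. X \<omega> + Y \<omega>) \<le> L2_norm M X + L2_norm M Y"
proof (rule power2_le_imp_le)
  have "(L2_norm M (\<lambda>\<omega>. X \<omega> + Y \<omega>))\<^sup>2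
      = (\<integral>\<omega>. (norm (X \<omega>))\<^sup>2 + 2 * (X \<omega> \<bullet> Y \<omega>) + (norm (Y \<omega>))\<^sup>2 \<partial>M)"
    unfolding power2_norm_eq_inner L2_norm_sq
    by (intro Bochner_Integration.integral_cong)
       (auto simp: inner_add_left inner_add_right inner_commute algebra_simps)
  also have "\<dots> = (L2_norm M X)\<^sup>2 + 2 * (\<integral>\<omega>. X \<omega> \<bullet> Y \<omega> \<partial>M) + (L2_norm M Y)\<^sup>2"
    using square_integrable_norm_sq[OF X] square_integrable_norm_sq[OF Y]
      square_integrable_inner[OF X Y]
    by (simp add: L2_norm_sq)
  also have "\<dots> \<le> (L2_norm M X)\<^sup>2 + 2 * (L2_norm M X * L2_norm M Y) + (L2_norm M Y)\<^sup>2"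
    using L2_norm_Cauchy_Schwarz[OF X Y] by simp
  finally show "(L2_norm M (\<lambda>\<omega>. X \<omega> + Y \<omega>))\<^sup>2 \<le> (L2_norm M X + L2_norm M Y)\<^sup>2"
    by (simp add: power2_sum algebra_simps)
qed simp

lemma L2_norm_minus: "L2_norm M (\<lambda>\<omega>. X \<omega> - Y \<omega>) = L2_norm M (\<lambda>\<omega>. Y \<omega> - X \<omega>)"
  by (simp add: L2_norm_def norm_minus_commute)

lemma L2_norm_triangle_diff:
  assumes "square_integrable M X" "square_integrable M Y" "square_integrable M Z"
  shows "L2_norm M (\<lambda>\<omega>. X \<omega> - Z \<omega>)
    \<le> L2_norm M (\<lambda>\<omega>. X \<omega> - Y \<omega>) + L2_norm M (\<lambda>\<omega>. Y \<omega> - Z \<omega>)"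
  using L2_norm_triangle[OF square_integrable_diff[OF assms(1,2)] square_integrable_diff[OF assms(2,3)]]
  by simp

lemma L2_norm_le_sum:
  assumes "\<And>i. i \<in> S \<Longrightarrow> square_integrable M (f i)"
  shows "L2_norm M (\<lambda>\<omega>. \<Sum>i\<in>S. f i \<omega>) \<le> (\<Sum>i\<in>S. L2_norm M (f i))"
  using assms
proof (induction S rule: infinite_finite_induct)
  case (insert x S)
  then show ?case
    using L2_norm_triangle[of M "f x" "\<lambda>\<omega>. \<Sum>i\<in>S. f i \<omega>"] square_integrable_sum[of S M f] by force
qed (simp_all add: L2_norm_def)

lemma L2_dist2_eq_L2_norm:
  assumes "square_integrable M X" "square_integrable M Y"
  shows "L2_dist2 M X Y = ennreal ((L2_norm M (\<lambda>\<omega>. X \<omega> - Y \<omega>))\<^sup>2)"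
  unfolding L2_dist2_def L2_norm_sq
  using square_integrable_norm_sq[OF square_integrable_diff[OF assms]]
  by (intro nn_integral_eq_integral) auto

lemma square_integrable_finite_dist:
  assumes X: "X \<in> borel_measurable M" and Y: "square_integrable M Y" and d: "L2_dist2 M X Y < \<infinity>"
  shows "square_integrable M X"
proof -
  have "square_integrable M (\<lambda>\<omega>. X \<omega> - Y \<omega>)"
    unfolding square_integrable_def
  proof
    show m: "(\<lambda>\<omega>. X \<omega> - Y \<omega>) \<in> borel_measurable M"
      using X Y by (auto dest: square_integrable_measurable)
    show "integrable M (\<lambda>\<omega>. (norm (X \<omega> - Y \<omega>))\<^sup>2)"
    proof (rule integrableI_bounded)
      show "(\<lambda>\<omega>. (norm (X \<omega> - Y \<omega>))\<^sup>2) \<in> borel_measurable M" using m by measurable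
      show "(\<integral>\<^sup>+ \<omega>. ennreal (norm ((norm (X \<omega> - Y \<omega>))\<^sup>2)) \<partial>M) < \<infinity>"
        using d by (simp add: L2_dist2_def)
    qed
  qed
  from square_integrable_add[OF this Y] show ?thesis by simp
qed

section \<open>Sequential limits in L2\<close>

definition L2_lim :: "'a measure \<Rightarrow> (nat \<Rightarrow> 'a \<Rightarrow> 'b::euclidean_space) \<Rightarrow> ('a \<Rightarrow> 'b) \<Rightarrow> bool" where
  "L2_lim M f X \<longleftrightarrow> (\<forall>n. square_integrable M (f n)) \<and> square_integrable M X \<and>
     (\<lambda>n. L2_norm M (\<lambda>\<omega>. f n \<omega> - X \<omega>)) \<longlonglongrightarrow> 0"

lemma L2_limD:
  assumes "L2_lim M f X"
  shows "square_integrable M (f n)" "square_integrable M X"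
    "(\<lambda>n. L2_norm M (\<lambda>\<omega>. f n \<omega> - X \<omega>)) \<longlonglongrightarrow> 0"
  using assms by (auto simp: L2_lim_def)

text \<open>The real-valued norm takes the default value 0 where the square is not integrable, so
  \<open>L2_lim\<close> includes square integrability. For the limit it follows from a finite
  extended distance at a single index.\<close>

lemma L2_limI_dist2:
  assumes f: "\<And>n. square_integrable M (f n)" and X: "X \<in> borel_measurable M"
    and lim: "(\<lambda>n. L2_dist2 M X (f n)) \<longlonglongrightarrow> 0"
  shows "L2_lim M f X"
proof -
  have "eventually (\<lambda>n. L2_dist2 M X (f n) < 1) sequentially"
    using lim by (rule order_tendstoD) simp
  then obtain n where "L2_dist2 M X (f n) < 1" by (auto simp: eventually_sequentially)
  then have "L2_dist2 M X (f n) < \<infinity>" using less_trans by fastforce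
  then have X': "square_integrable M X" using square_integrable_finite_dist[OF X f] by blast
  have "(\<lambda>n. ennreal ((L2_norm M (\<lambda>\<omega>. X \<omega> - f n \<omega>))\<^sup>2)) \<longlonglongrightarrow> ennreal 0"
    using lim by (simp add: L2_dist2_eq_L2_norm[OF X' f])
  then have "(\<lambda>n. (L2_norm M (\<lambda>\<omega>. X \<omega> - f n \<omega>))\<^sup>2) \<longlonglongrightarrow> 0"
    by (subst (asm) tendsto_ennreal_iff) auto
  then have "(\<lambda>n. sqrt ((L2_norm M (\<lambda>\<omega>. X \<omega> - f n \<omega>))\<^sup>2)) \<longlonglongrightarrow> sqrt 0"
    by (rule tendsto_real_sqrt)
  then have "(\<lambda>n. L2_norm M (\<lambda>\<omega>. X \<omega> - f n \<omega>)) \<longlonglongrightarrow> 0" by simp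
  then show ?thesis using f X' by (simp add: L2_lim_def L2_norm_minus[of M X])
qed

lemma L2_lim_const: "square_integrable M X \<Longrightarrow> L2_lim M (\<lambda>_. X) X"
  by (simp add: L2_lim_def L2_norm_def)

lemma L2_lim_add:
  assumes f: "L2_lim M f X" and g: "L2_lim M g Y"
  shows "L2_lim M (\<lambda>n \<omega>. f n \<omega> + g n \<omega>) (\<lambda>\<omega>. X \<omega> + Y \<omega>)"
  unfolding L2_lim_def
proof (intro conjI allI)
  show "(\<lambda>n. L2_norm M (\<lambda>\<omega>. f n \<omega> + g n \<omega> - (X \<omega> + Y \<omega>))) \<longlonglongrightarrow> 0"
  proof (rule tendsto_sandwich[OF _ _ tendsto_const])
    show "(\<lambda>n. L2_norm M (\<lambda>\<omega>. f n \<omega> - X \<omega>) + L2_norm M (\<lambda>\<omega>. g n \<omega> - Y \<omega>)) \<longlonglongrightarrow> 0"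
      using tendsto_add[OF L2_limD(3)[OF f] L2_limD(3)[OF g]] by simp
    have "L2_norm M (\<lambda>\<omega>. f n \<omega> + g n \<omega> - (X \<omega> + Y \<omega>))
        \<le> L2_norm M (\<lambda>\<omega>. f n \<omega> - X \<omega>) + L2_norm M (\<lambda>\<omega>. g n \<omega> - Y \<omega>)" for n
      using L2_norm_triangle[OF square_integrable_diff[OF L2_limD(1,2)[OF f]]
        square_integrable_diff[OF L2_limD(1,2)[OF g]], of n n] by (simp add: algebra_simps)
    then show "\<forall>\<^sub>F n in sequentially. L2_norm M (\<lambda>\<omega>. f n \<omega> + g n \<omega> - (X \<omega> + Y \<omega>))
        \<le> L2_norm M (\<lambda>\<omega>. f n \<omega> - X \<omega>) + L2_norm M (\<lambda>\<omega>. g n \<omega> - Y \<omega>)" by simp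
  qed simp
qed (use f g in \<open>auto intro!: square_integrable_add dest: L2_limD\<close>)

lemma L2_lim_bounded_scaleR:
  assumes f: "L2_lim M f X" and g: "g \<in> borel_measurable M"
    and C: "\<And>\<omega>. \<omega> \<in> space M \<Longrightarrow> \<bar>g \<omega>\<bar> \<le> C"
  shows "L2_lim M (\<lambda>n \<omega>. g \<omega> *\<^sub>R f n \<omega>) (\<lambda>\<omega>. g \<omega> *\<^sub>R X \<omega>)"
  unfolding L2_lim_def
proof (intro conjI allI)
  show "(\<lambda>n. L2_norm M (\<lambda>\<omega>. g \<omega> *\<^sub>R f n \<omega> - g \<omega> *\<^sub>R X \<omega>)) \<longlonglongrightarrow> 0"
  proof (rule tendsto_sandwich[OF _ _ tendsto_const])
    show "(\<lambda>n. \<bar>C\<bar> * L2_norm M (\<lambda>\<omega>. f n \<omega> - X \<omega>)) \<longlonglongrightarrow> 0"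
      using tendsto_mult[OF tendsto_const L2_limD(3)[OF f], of "\<bar>C\<bar>"] by simp
    have "L2_norm M (\<lambda>\<omega>. g \<omega> *\<^sub>R f n \<omega> - g \<omega> *\<^sub>R X \<omega>) \<le> \<bar>C\<bar> * L2_norm M (\<lambda>\<omega>. f n \<omega> - X \<omega>)" for n
    proof (rule power2_le_imp_le)
      have s: "square_integrable M (\<lambda>\<omega>. f n \<omega> - X \<omega>)"
        using square_integrable_diff[OF L2_limD(1,2)[OF f]] .
      have "(L2_norm M (\<lambda>\<omega>. g \<omega> *\<^sub>R f n \<omega> - g \<omega> *\<^sub>R X \<omega>))\<^sup>2
         = (\<integral>\<omega>. (norm (g \<omega> *\<^sub>R (f n \<omega> - X \<omega>)))\<^sup>2 \<partial>M)"
        by (simp add: L2_norm_sq scaleR_diff_right del: norm_scaleR)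
      also have "\<dots> \<le> (\<integral>\<omega>. C\<^sup>2 * (norm (f n \<omega> - X \<omega>))\<^sup>2 \<partial>M)"
      proof (rule integral_mono)
        show "integrable M (\<lambda>\<omega>. (norm (g \<omega> *\<^sub>R (f n \<omega> - X \<omega>)))\<^sup>2)"
          using square_integrable_bounded_scaleR[OF s g C] by (rule square_integrable_norm_sq)
        show "integrable M (\<lambda>\<omega>. C\<^sup>2 * (norm (f n \<omega> - X \<omega>))\<^sup>2)"
          using square_integrable_norm_sq[OF s] by simp
        fix \<omega> assume "\<omega> \<in> space M"
        then have "(g \<omega>)\<^sup>2 \<le> C\<^sup>2"
          using C by (metis abs_ge_zero abs_le_square_iff abs_of_nonneg order_trans)
        then show "(norm (g \<omega> *\<^sub>R (f n \<omega> - X \<omega>)))\<^sup>2 \<le> C\<^sup>2 * (norm (f n \<omega> - X \<omega>))\<^sup>2"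
          by (simp add: power_mult_distrib mult_right_mono)
      qed
      finally show "(L2_norm M (\<lambda>\<omega>. g \<omega> *\<^sub>R f n \<omega> - g \<omega> *\<^sub>R X \<omega>))\<^sup>2
          \<le> (\<bar>C\<bar> * L2_norm M (\<lambda>\<omega>. f n \<omega> - X \<omega>))\<^sup>2"
        by (simp add: power_mult_distrib L2_norm_sq)
    qed simp
    then show "\<forall>\<^sub>F n in sequentially. L2_norm M (\<lambda>\<omega>. g \<omega> *\<^sub>R f n \<omega> - g \<omega> *\<^sub>R X \<omega>)
        \<le> \<bar>C\<bar> * L2_norm M (\<lambda>\<omega>. f n \<omega> - X \<omega>)" by simp
  qed simp
qed (use square_integrable_bounded_scaleR[OF L2_limD(1)[OF f] g C]
      square_integrable_bounded_scaleR[OF L2_limD(2)[OF f] g C] in auto)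

lemma L2_lim_diff:
  assumes f: "L2_lim M f X" and g: "L2_lim M g Y"
  shows "L2_lim M (\<lambda>n \<omega>. f n \<omega> - g n \<omega>) (\<lambda>\<omega>. X \<omega> - Y \<omega>)"
  using L2_lim_add[OF f L2_lim_bounded_scaleR[OF g, of "\<lambda>_. -1" 1]] by simp

text \<open>Moment identities pass from step processes to their limits through this continuity. The
  difference is expanded about \<open>(X, Y)\<close>, so that only the norms of the convergent
  differences and the fixed norms of the limits occur.\<close>

lemma L2_lim_inner:
  assumes f: "L2_lim M f X" and g: "L2_lim M g Y"
  shows "(\<lambda>n. \<integral>\<omega>. f n \<omega> \<bullet> g n \<omega> \<partial>M) \<longlonglongrightarrow> (\<integral>\<omega>. X \<omega> \<bullet> Y \<omega> \<partial>M)"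
proof -
  note s = L2_limD(1,2)[OF f] L2_limD(1,2)[OF g]
  define u v where "u n = L2_norm M (\<lambda>\<omega>. f n \<omega> - X \<omega>)" and "v n = L2_norm M (\<lambda>\<omega>. g n \<omega> - Y \<omega>)" for n
  have "(\<lambda>n. (\<integral>\<omega>. f n \<omega> \<bullet> g n \<omega> \<partial>M) - (\<integral>\<omega>. X \<omega> \<bullet> Y \<omega> \<partial>M)) \<longlonglongrightarrow> 0"
  proof (rule Lim_null_comparison)
    show "(\<lambda>n. u n * v n + u n * L2_norm M Y + L2_norm M X * v n) \<longlonglongrightarrow> 0"
      using L2_limD(3)[OF f] L2_limD(3)[OF g] unfolding u_def[symmetric] v_def[symmetric]
      by (auto intro!: tendsto_eq_intros)
    have "\<bar>(\<integral>\<omega>. f n \<omega> \<bullet> g n \<omega> \<partial>M) - (\<integral>\<omega>. X \<omega> \<bullet> Y \<omega> \<partial>M)\<bar>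
        \<le> u n * v n + u n * L2_norm M Y + L2_norm M X * v n" for n
    proof -
      note fd = square_integrable_diff[OF s(1,2), of n] and gd = square_integrable_diff[OF s(3,4), of n]
      have "(\<integral>\<omega>. f n \<omega> \<bullet> g n \<omega> \<partial>M) - (\<integral>\<omega>. X \<omega> \<bullet> Y \<omega> \<partial>M)
        = (\<integral>\<omega>. (f n \<omega> - X \<omega>) \<bullet> (g n \<omega> - Y \<omega>) + (f n \<omega> - X \<omega>) \<bullet> Y \<omega> + X \<omega> \<bullet> (g n \<omega> - Y \<omega>) \<partial>M)"
        by (subst Bochner_Integration.integral_diff[symmetric])
           (auto intro!: square_integrable_inner s Bochner_Integration.integral_cong simp: inner_diff_left inner_diff_right)
      also have "\<dots> = (\<integral>\<omega>. (f n \<omega> - X \<omega>) \<bullet> (g n \<omega> - Y \<omega>) \<partial>M) + (\<integral>\<omega>. (f n \<omega> - X \<omega>) \<bullet> Y \<omega> \<partial>M)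
          + (\<integral>\<omega>. X \<omega> \<bullet> (g n \<omega> - Y \<omega>) \<partial>M)"
        using square_integrable_inner[OF fd gd] square_integrable_inner[OF fd s(4)]
          square_integrable_inner[OF s(2) gd] by simp
      finally show ?thesis
        using L2_norm_Cauchy_Schwarz[OF fd gd] L2_norm_Cauchy_Schwarz[OF fd s(4)]
          L2_norm_Cauchy_Schwarz[OF s(2) gd] unfolding u_def v_def by linarith
    qed
    then show "\<forall>\<^sub>F n in sequentially. norm ((\<integral>\<omega>. f n \<omega> \<bullet> g n \<omega> \<partial>M) - (\<integral>\<omega>. X \<omega> \<bullet> Y \<omega> \<partial>M))
        \<le> u n * v n + u n * L2_norm M Y + L2_norm M X * v n" by simp
  qed
  then show ?thesis by (rule LIM_zero_cancel)
qed

lemma L2_lim_mult: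
  fixes X Y :: "'a \<Rightarrow> real"
  assumes "L2_lim M f X" "L2_lim M g Y"
  shows "(\<lambda>n. \<integral>\<omega>. f n \<omega> * g n \<omega> \<partial>M) \<longlonglongrightarrow> (\<integral>\<omega>. X \<omega> * Y \<omega> \<partial>M)"
  using L2_lim_inner[OF assms] by simp

lemma L2_lim_norm_diff:
  assumes "L2_lim M f X" "L2_lim M g Y"
  shows "(\<lambda>n. (L2_norm M (\<lambda>\<omega>. f n \<omega> - g n \<omega>))\<^sup>2) \<longlonglongrightarrow> (L2_norm M (\<lambda>\<omega>. X \<omega> - Y \<omega>))\<^sup>2"
  using L2_lim_inner[OF L2_lim_diff[OF assms] L2_lim_diff[OF assms]]
  by (simp add: L2_norm_sq power2_norm_eq_inner)

section \<open>Time integration of cadlag processes\<close>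

text \<open>Lebesgue measure on the interval from 0 to \<open>t\<close>, kept on all Borel sets of
  the line: measurability then does not depend on \<open>t\<close>, and finiteness makes Fubini
  available.\<close>

definition time_measure :: "real \<Rightarrow> real measure" where
  "time_measure t = density lborel (\<lambda>s. ennreal (indicat_real {0<..t} s))"

lemma sets_time_measure [simp, measurable_cong]: "sets (time_measure t) = sets borel"
  by (simp add: time_measure_def)

lemma space_time_measure [simp]: "space (time_measure t) = UNIV"
  by (simp add: time_measure_def)

lemma emeasure_time_measure: "0 \<le> t \<Longrightarrow> emeasure (time_measure t) UNIV = ennreal t"
  by (simp add: time_measure_def emeasure_density ennreal_indicator)

lemma finite_measure_time_measure: "finite_measure (time_measure t)"
proof
  show "emeasure (time_measure t) (space (time_measure t)) \<noteq> \<infinity>"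
    by (cases "0 \<le> t") (simp_all add: time_measure_def emeasure_density ennreal_indicator)
qed

lemma AE_time_measure: "AE s in time_measure t. 0 < s \<and> s \<le> t"
  unfolding time_measure_def by (subst AE_density) (auto simp: indicator_def split: if_splits)

lemma integral_time_measure:
  fixes f :: "real \<Rightarrow> real"
  assumes "f \<in> borel_measurable borel"
  shows "(\<integral>s. f s \<partial>time_measure t) = (\<integral>s. indicat_real {0<..t} s * f s \<partial>lborel)"
  unfolding time_measure_def using assms by (subst integral_density) auto

lemma integral_time_measure_power:
  assumes "0 \<le> t"
  shows "(\<integral>s. s ^ k \<partial>time_measure t) = t ^ Suc k / Suc k"
proof -
  have "(\<integral>s. s ^ k \<partial>time_measure t) = (\<integral>s. indicat_real {0<..t} s * s ^ k \<partial>lborel)"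
    by (rule integral_time_measure) simp
  also have "\<dots> = (\<integral>s. s ^ k * indicat_real {0..t} s \<partial>lborel)"
  proof (rule integral_cong_AE)
    show "AE s in lborel. indicat_real {0<..t} s * s ^ k = s ^ k * indicat_real {0..t} s"
      using AE_lborel_singleton[of 0] by eventually_elim (auto simp: indicator_def)
  qed auto
  also have "\<dots> = (t ^ Suc k - 0 ^ Suc k) / Suc k"
    using assms by (rule integral_power)
  finally show ?thesis by simp
qed

text \<open>The truncation of all end points at \<open>t\<close> is the one that occurs in
  \<open>step_integral\<close>; \<open>max 0\<close> covers disjoint intervals.\<close>

lemma integral_time_measure_overlap:
  assumes "0 \<le> p" "p \<le> q" "0 \<le> r" "r \<le> u"
  shows "(\<integral>s. indicat_real {p<..q} s * indicat_real {r<..u} s \<partial>time_measure t)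
    = max 0 (min (min t q) (min t u) - max (min t p) (min t r))"
proof -
  have "(\<integral>s. indicat_real {p<..q} s * indicat_real {r<..u} s \<partial>time_measure t)
     = (\<integral>s. indicat_real {0<..t} s * (indicat_real {p<..q} s * indicat_real {r<..u} s) \<partial>lborel)"
    by (rule integral_time_measure) measurable
  also have "\<dots> = (\<integral>s. indicat_real {max (min t p) (min t r)<..min (min t q) (min t u)} s \<partial>lborel)"
    using assms by (intro Bochner_Integration.integral_cong) (auto simp: indicator_def)
  also have "\<dots> = max 0 (min (min t q) (min t u) - max (min t p) (min t r))"
    by (cases "max (min t p) (min t r) \<le> min (min t q) (min t u)") (auto simp: max_absorb2)
  finally show ?thesis .
qed

section \<open>Left limits and measurability of cadlag processes\<close>

lemma countable_left_jumps_up: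
  fixes f :: "real \<Rightarrow> real"
  shows "countable {s. q < f s \<and> eventually (\<lambda>r. f r < q) (at_left s)}" (is "countable ?B")
proof -
  have "\<exists>r. r < s \<and> r \<in> \<rat> \<and> (\<forall>y. r < y \<and> y < s \<longrightarrow> f y < q)" if s: "s \<in> ?B" for s
  proof -
    from s obtain b where b: "b < s" "\<And>y. b < y \<Longrightarrow> y < s \<Longrightarrow> f y < q"
      by (auto simp: eventually_at_left[of "s - 1" s])
    obtain r where "r \<in> \<rat>" "b < r" "r < s" using Rats_dense_in_real[OF b(1)] by blast
    then show ?thesis using b by (intro exI[of _ r]) auto
  qed
  then obtain r where r: "\<And>s. s \<in> ?B \<Longrightarrow> r s < s \<and> r s \<in> \<rat> \<and> (\<forall>y. r s < y \<and> y < s \<longrightarrow> f y < q)"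
    by metis
  \<comment> \<open>Since \<open>q < f s\<close>, the point \<open>s\<close> lies outside the
    interval from \<open>r s'\<close> to \<open>s'\<close>, on which \<open>f\<close> is below
    \<open>q\<close>. Hence \<open>r s < s \<le> r s'\<close>, and \<open>r\<close> is injective
    with rational values.\<close>
  have lt: "r s < r s'" if "s \<in> ?B" "s' \<in> ?B" "s < s'" for s s'
  proof -
    have "s \<le> r s'" using r[OF that(2)] that by (force simp: not_le)
    then show ?thesis using r[OF that(1)] by linarith
  qed
  have "inj_on r ?B"
  proof (rule inj_onI)
    fix x y assume xy: "x \<in> ?B" "y \<in> ?B" and e: "r x = r y"
    show "x = y"
    proof (rule ccontr)
      assume "x \<noteq> y"
      then consider "x < y" | "y < x" by linarith
      then show False using lt[OF xy(1,2)] lt[OF xy(2,1)] e by cases auto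
    qed
  qed
  moreover have "countable (r ` ?B)"
    by (rule countable_subset[OF _ countable_rat]) (use r in auto)
  ultimately show ?thesis using countable_image_inj_on by blast
qed

text \<open>A value different from the left limit is separated from it by a rational, as an upward
  jump of \<open>f\<close> or of \<open>- f\<close>.\<close>

lemma countable_left_discontinuities:
  fixes f :: "real \<Rightarrow> real"
  assumes lim: "\<And>s. 0 < s \<Longrightarrow> \<exists>x. (f \<longlongrightarrow> x) (at_left s)"
  shows "countable {s. 0 < s \<and> Lim (at_left s) f \<noteq> f s}"
proof -
  define B where "B g q = {s. q < g s \<and> eventually (\<lambda>r. g r < q) (at_left s)}" for g :: "real \<Rightarrow> real" and q
  have "{s. 0 < s \<and> Lim (at_left s) f \<noteq> f s} \<subseteq> (\<Union>q\<in>\<rat>. B f q \<union> B (\<lambda>s. - f s) q)"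
  proof
    fix s assume s: "s \<in> {s. 0 < s \<and> Lim (at_left s) f \<noteq> f s}"
    then obtain x where x: "(f \<longlongrightarrow> x) (at_left s)" using lim by blast
    then have "Lim (at_left s) f = x" by (intro tendsto_Lim) auto
    with s consider "x < f s" | "- x < - f s" by force
    then show "s \<in> (\<Union>q\<in>\<rat>. B f q \<union> B (\<lambda>s. - f s) q)"
    proof cases
      case 1
      then obtain q where q: "q \<in> \<rat>" "x < q" "q < f s" using Rats_dense_in_real by blast
      then show ?thesis using order_tendstoD(2)[OF x, of q] by (auto simp: B_def)
    next
      case 2
      then obtain q where q: "q \<in> \<rat>" "- x < q" "q < - f s" using Rats_dense_in_real by blast
      then show ?thesis using order_tendstoD(2)[OF tendsto_minus[OF x], of q] by (auto simp: B_def)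
    qed
  qed
  moreover have "countable (\<Union>q\<in>\<rat>. B f q \<union> B (\<lambda>s. - f s) q)"
    unfolding B_def using countable_left_jumps_up countable_rat by auto
  ultimately show ?thesis by (rule countable_subset)
qed

text \<open>Time integrals may thus use the process, whose joint measurability is proved next, in
  place of its left limits. The \<open>max 0\<close> is there because only nonnegative times are
  meaningful.\<close>

lemma cadlag_left_limit_AE:
  fixes Y :: "real \<Rightarrow> 'a \<Rightarrow> real"
  assumes Y: "cadlag_process M Y" and \<omega>: "\<omega> \<in> space M"
  shows "AE s in lborel. 0 < s \<longrightarrow> left_limit Y s \<omega> = Y (max 0 s) \<omega>"
proof -
  have "countable {s. 0 < s \<and> Lim (at_left s) (\<lambda>r. Y r \<omega>) \<noteq> Y s \<omega>}"
    using Y \<omega> by (intro countable_left_discontinuities) (auto simp: cadlag_process_def)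
  from countable_imp_null_set_lborel[OF this] show ?thesis
    by (rule AE_I') (auto simp: left_limit_def max_def)
qed

lemma cadlag_joint_measurable:
  fixes Y :: "real \<Rightarrow> 'a \<Rightarrow> real"
  assumes Y: "cadlag_process M Y"
  shows "(\<lambda>(\<omega>, s). Y (max 0 s) \<omega>) \<in> borel_measurable (M \<Otimes>\<^sub>M borel)"
proof (rule borel_measurable_LIMSEQ_metric)
  \<comment> \<open>The next point strictly to the right of \<open>max 0 s\<close> on the grid of
    mesh \<open>1 / (m + 1)\<close>; it tends to \<open>max 0 s\<close> from the right, where paths
    are continuous.\<close>
  define g where "g m s = (of_int \<lfloor>max 0 s * real (Suc m)\<rfloor> + 1) / real (Suc m)" for m and s :: real
  have pos: "0 < g m s" for m s by (auto simp: g_def add_nonneg_pos divide_pos_pos)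
  show "(\<lambda>(\<omega>, s). Y (g m s) \<omega>) \<in> borel_measurable (M \<Otimes>\<^sub>M borel)" for m
  proof -
    \<comment> \<open>Evaluation at the grid point of index \<open>k\<close>. The floor takes
      countably many values, so measurability can be checked for each \<open>k\<close>.\<close>
    define f :: "int \<Rightarrow> 'a \<times> real \<Rightarrow> real"
      where "f = (\<lambda>k x. Y (max 0 ((of_int k + 1) / real (Suc m))) (fst x))"
    have "(\<lambda>x. f \<lfloor>max 0 (snd x) * real (Suc m)\<rfloor> x) \<in> borel_measurable (M \<Otimes>\<^sub>M borel)"
    proof (rule measurable_compose_countable)
      fix k :: int
      have "Y (max 0 ((of_int k + 1) / real (Suc m))) \<in> borel_measurable M"
        using Y by (auto simp: cadlag_process_def)
      then show "f k \<in> borel_measurable (M \<Otimes>\<^sub>M borel)"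
        unfolding f_def by measurable
    next
      show "(\<lambda>x. \<lfloor>max 0 (snd x) * real (Suc m)\<rfloor>) \<in> M \<Otimes>\<^sub>M borel \<rightarrow>\<^sub>M count_space UNIV"
        by measurable
    qed
    then show ?thesis using pos by (simp add: f_def g_def less_imp_le max_absorb2 split_beta')
  qed
  fix x assume x: "x \<in> space (M \<Otimes>\<^sub>M (borel :: real measure))"
  obtain \<omega> s where xe: "x = (\<omega>, s)" by fastforce
  have \<omega>: "\<omega> \<in> space M" using x xe by (auto simp: space_pair_measure)
  define p where "p = max 0 s"
  have gt: "max 0 s < g m s" for m
  proof -
    have "p * real (Suc m) < of_int \<lfloor>p * real (Suc m)\<rfloor> + 1" by linarith
    then show ?thesis unfolding g_def p_def[symmetric] by (simp add: pos_less_divide_eq del: of_nat_Suc)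
  qed
  have le: "g m s \<le> max 0 s + 1 / real (Suc m)" for m
  proof -
    have "of_int \<lfloor>p * real (Suc m)\<rfloor> + 1 \<le> p * real (Suc m) + 1" by linarith
    then show ?thesis unfolding g_def p_def[symmetric] by (simp add: field_simps del: of_nat_Suc)
  qed
  have "(\<lambda>m. g m s) \<longlonglongrightarrow> max 0 s"
  proof (rule tendsto_sandwich[OF _ _ tendsto_const])
    show "(\<lambda>m. max 0 s + 1 / real (Suc m)) \<longlonglongrightarrow> max 0 s"
      using tendsto_add[OF tendsto_const LIMSEQ_inverse_real_of_nat, of "max 0 s"]
      by (simp add: inverse_eq_divide)
  qed (use le less_imp_le[OF gt] in \<open>simp_all del: of_nat_Suc max.bounded_iff max_less_iff_conj\<close>)
  then have "filterlim (\<lambda>m. g m s) (at_right (max 0 s)) sequentially"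
    using gt less_imp_neq[OF gt, THEN not_sym] unfolding filterlim_at greaterThan_iff by simp
  moreover have "((\<lambda>r. Y r \<omega>) \<longlongrightarrow> Y (max 0 s) \<omega>) (at_right (max 0 s))"
    using Y \<omega> by (auto simp: cadlag_process_def continuous_within)
  ultimately have "(\<lambda>m. Y (g m s) \<omega>) \<longlonglongrightarrow> Y (max 0 s) \<omega>"
    by (rule filterlim_compose[rotated])
  then show "(\<lambda>m. case x of (\<omega>, s) \<Rightarrow> Y (g m s) \<omega>) \<longlonglongrightarrow> (case x of (\<omega>, s) \<Rightarrow> Y (max 0 s) \<omega>)"
    by (simp add: xe)
qed

lemma cadlag_path_measurable:
  fixes Y :: "real \<Rightarrow> 'a \<Rightarrow> real"
  assumes "cadlag_process M Y" "\<omega> \<in> space M"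
  shows "(\<lambda>s. Y (max 0 s) \<omega>) \<in> borel_measurable borel"
proof -
  have "(\<lambda>s. (\<omega>, s)) \<in> borel \<rightarrow>\<^sub>M M \<Otimes>\<^sub>M borel" using assms(2) by measurable
  from measurable_compose[OF this cadlag_joint_measurable[OF assms(1)]] show ?thesis by simp
qed

lemma time_integral_cadlag:
  fixes Y X :: "real \<Rightarrow> 'a \<Rightarrow> real"
  assumes Y: "cadlag_process M Y" and I: "time_integral M (left_limit Y) X" and t: "0 \<le> t"
  shows "X t \<in> borel_measurable M"
    and "AE \<omega> in M. X t \<omega> = (\<integral>s. Y (max 0 s) \<omega> \<partial>time_measure t)"
proof -
  show "X t \<in> borel_measurable M" using I t by (auto simp: time_integral_def)
  have "AE \<omega> in M. set_integrable lborel {0<..t} (\<lambda>s. left_limit Y s \<omega>) \<and>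
          X t \<omega> = (LINT s:{0<..t}|lborel. left_limit Y s \<omega>)"
    using I t by (auto simp: time_integral_def)
  then show "AE \<omega> in M. X t \<omega> = (\<integral>s. Y (max 0 s) \<omega> \<partial>time_measure t)"
  proof (rule AE_mp, intro AE_I2 impI)
    fix \<omega> assume \<omega>: "\<omega> \<in> space M"
      and h: "set_integrable lborel {0<..t} (\<lambda>s. left_limit Y s \<omega>) \<and>
          X t \<omega> = (LINT s:{0<..t}|lborel. left_limit Y s \<omega>)"
    note m = cadlag_path_measurable[OF Y \<omega>]
    have "X t \<omega> = (\<integral>s. indicat_real {0<..t} s * left_limit Y s \<omega> \<partial>lborel)"
      using h by (simp add: set_lebesgue_integral_def)
    also have "\<dots> = (\<integral>s. indicat_real {0<..t} s * Y (max 0 s) \<omega> \<partial>lborel)"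
    proof (rule integral_cong_AE)
      show "(\<lambda>s. indicat_real {0<..t} s * left_limit Y s \<omega>) \<in> borel_measurable lborel"
        using h by (auto simp: set_integrable_def dest: borel_measurable_integrable)
      show "(\<lambda>s. indicat_real {0<..t} s * Y (max 0 s) \<omega>) \<in> borel_measurable lborel"
        using m by measurable
      show "AE s in lborel. indicat_real {0<..t} s * left_limit Y s \<omega> = indicat_real {0<..t} s * Y (max 0 s) \<omega>"
        using cadlag_left_limit_AE[OF Y \<omega>] by eventually_elim (auto simp: indicator_def)
    qed
    also have "\<dots> = (\<integral>s. Y (max 0 s) \<omega> \<partial>time_measure t)"
      using integral_time_measure[OF m] by simp
    finally show "X t \<omega> = (\<integral>s. Y (max 0 s) \<omega> \<partial>time_measure t)" .
  qed
qed

lemma step_value_measurable: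
  fixes S :: "('a, real) step_process"
  assumes S: "simple_predictable F S" and sub: "\<And>t. subalgebra M (F t)"
  shows "(\<lambda>(\<omega>, s). step_value S s \<omega>) \<in> borel_measurable (M \<Otimes>\<^sub>M borel)"
proof -
  obtain K \<tau> h where Se: "S = (K, \<tau>, h)" by (cases S) auto
  have h: "h k \<in> borel_measurable M" if "k < K" for k
    using S that by (intro measurable_from_subalg[OF sub, of _ "\<tau> k"]) (auto simp: Se simple_predictable_def)
  have "(\<lambda>x. \<Sum>k<K. indicat_real {\<tau> k<..\<tau> (Suc k)} (snd x) *\<^sub>R h k (fst x)) \<in> borel_measurable (M \<Otimes>\<^sub>M borel)"
  proof (rule borel_measurable_sum)
    fix k assume "k \<in> {..<K}"
    then have [measurable]: "h k \<in> borel_measurable M" using h by simp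
    show "(\<lambda>x. indicat_real {\<tau> k<..\<tau> (Suc k)} (snd x) *\<^sub>R h k (fst x)) \<in> borel_measurable (M \<Otimes>\<^sub>M borel)"
      by measurable
  qed
  then show ?thesis by (simp add: Se step_value_def split_beta')
qed

text \<open>The approximation in \<open>ito_integral\<close> is an iterated integral over left
  limits. Rewritten as convergence in L2 of one product measure, it falls under the general calculus
  of L2 limits.\<close>

lemma ito_integral_cadlag:
  fixes Y X :: "real \<Rightarrow> 'a \<Rightarrow> real"
  assumes Y: "cadlag_process M Y" and I: "ito_integral M F Z (left_limit Y) X" and t: "0 \<le> t"
    and sub: "\<And>t. subalgebra M (F t)"
  shows "X t \<in> borel_measurable M"
    and "\<exists>S. (\<forall>m. simple_predictable F (S m)) \<and>
      (\<lambda>m. L2_dist2 (M \<Otimes>\<^sub>M time_measure t) (\<lambda>(\<omega>, s). Y (max 0 s) \<omega>) (\<lambda>(\<omega>, s). step_value (S m) s \<omega>)) \<longlonglongrightarrow> 0 \<and>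
      (\<lambda>m. L2_dist2 M (X t) (step_integral Z (S m) t)) \<longlonglongrightarrow> 0"
proof -
  show "X t \<in> borel_measurable M" using I t by (auto simp: ito_integral_def)
  from I t obtain S where S: "\<And>m. simple_predictable F (S m)"
    and c1: "(\<lambda>m. \<integral>\<^sup>+\<omega>. (\<integral>\<^sup>+s\<in>{0<..t}. ennreal ((norm (left_limit Y s \<omega> - step_value (S m) s \<omega>))\<^sup>2) \<partial>lborel) \<partial>M)
               \<longlonglongrightarrow> 0"
    and c2: "(\<lambda>m. L2_dist2 M (X t) (step_integral Z (S m) t)) \<longlonglongrightarrow> 0"
    by (auto simp: ito_integral_def)
  interpret U: finite_measure "time_measure t" by (rule finite_measure_time_measure)
  have "(\<integral>\<^sup>+\<omega>. (\<integral>\<^sup>+s\<in>{0<..t}. ennreal ((norm (left_limit Y s \<omega> - step_value (S m) s \<omega>))\<^sup>2) \<partial>lborel) \<partial>M)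
     = L2_dist2 (M \<Otimes>\<^sub>M time_measure t) (\<lambda>(\<omega>, s). Y (max 0 s) \<omega>) (\<lambda>(\<omega>, s). step_value (S m) s \<omega>)" for m
  proof -
    define f where "f = (\<lambda>x. case x of (\<omega>, s) \<Rightarrow> ennreal ((norm (Y (max 0 s) \<omega> - step_value (S m) s \<omega>))\<^sup>2))"
    have m0: "f \<in> borel_measurable (M \<Otimes>\<^sub>M borel)"
      using cadlag_joint_measurable[OF Y] step_value_measurable[OF S sub, of m]
      unfolding f_def split_beta' by measurable
    have m1: "f \<in> borel_measurable (M \<Otimes>\<^sub>M time_measure t)"
      using m0 by (simp cong: measurable_cong_sets sets_pair_measure_cong)
    have "(\<integral>\<^sup>+\<omega>. (\<integral>\<^sup>+s\<in>{0<..t}. ennreal ((norm (left_limit Y s \<omega> - step_value (S m) s \<omega>))\<^sup>2) \<partial>lborel) \<partial>M)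
       = (\<integral>\<^sup>+\<omega>. (\<integral>\<^sup>+s. f (\<omega>, s) \<partial>time_measure t) \<partial>M)"
    proof (rule nn_integral_cong)
      fix \<omega> assume \<omega>: "\<omega> \<in> space M"
      have ms: "(\<lambda>s. f (\<omega>, s)) \<in> borel_measurable borel"
        using measurable_compose[OF _ m0, of "\<lambda>s. (\<omega>, s)" borel] \<omega> by simp
      have "(\<integral>\<^sup>+s\<in>{0<..t}. ennreal ((norm (left_limit Y s \<omega> - step_value (S m) s \<omega>))\<^sup>2) \<partial>lborel)
         = (\<integral>\<^sup>+s. ennreal (indicat_real {0<..t} s) * f (\<omega>, s) \<partial>lborel)"
      proof (rule nn_integral_cong_AE)
        show "AE s in lborel. ennreal ((norm (left_limit Y s \<omega> - step_value (S m) s \<omega>))\<^sup>2) * indicator {0<..t} s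
          = ennreal (indicat_real {0<..t} s) * f (\<omega>, s)"
          using cadlag_left_limit_AE[OF Y \<omega>] by eventually_elim (auto simp: indicator_def f_def)
      qed
      also have "\<dots> = (\<integral>\<^sup>+s. f (\<omega>, s) \<partial>time_measure t)"
        unfolding time_measure_def using ms by (subst nn_integral_density) auto
      finally show "(\<integral>\<^sup>+s\<in>{0<..t}. ennreal ((norm (left_limit Y s \<omega> - step_value (S m) s \<omega>))\<^sup>2) \<partial>lborel)
         = (\<integral>\<^sup>+s. f (\<omega>, s) \<partial>time_measure t)" .
    qed
    also have "\<dots> = (\<integral>\<^sup>+x. f x \<partial>(M \<Otimes>\<^sub>M time_measure t))"
      by (rule U.nn_integral_fst[OF m1])
    finally show ?thesis by (simp add: L2_dist2_def f_def split_beta')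
  qed
  with c1 c2 S show "\<exists>S. (\<forall>m. simple_predictable F (S m)) \<and>
      (\<lambda>m. L2_dist2 (M \<Otimes>\<^sub>M time_measure t) (\<lambda>(\<omega>, s). Y (max 0 s) \<omega>) (\<lambda>(\<omega>, s). step_value (S m) s \<omega>)) \<longlonglongrightarrow> 0 \<and>
      (\<lambda>m. L2_dist2 M (X t) (step_integral Z (S m) t)) \<longlonglongrightarrow> 0"
    by (intro exI[of _ S]) simp
qed

section \<open>Martingale drivers and the Ito isometry\<close>

locale filtered_prob_space = prob_space M + filtration "space M" F
  for M :: "'a measure" and F :: "real \<Rightarrow> 'a measure" +
  assumes subalg: "\<And>t. subalgebra M (F t)"
begin

definition bounded_past :: "real \<Rightarrow> ('a \<Rightarrow> real) \<Rightarrow> bool" where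
  "bounded_past s g \<longleftrightarrow> g \<in> borel_measurable (F s) \<and> (\<exists>C. \<forall>\<omega>\<in>space M. \<bar>g \<omega>\<bar> \<le> C)"

text \<open>For square integrable \<open>Y\<close> this means that the conditional expectation given
  \<open>F s\<close> vanishes, as it does for martingale increments after time
  \<open>s\<close>.\<close>

definition orth_past :: "real \<Rightarrow> ('a \<Rightarrow> real) \<Rightarrow> bool" where
  "orth_past s Y \<longleftrightarrow> square_integrable M Y \<and> (\<forall>g. bounded_past s g \<longrightarrow> (\<integral>\<omega>. g \<omega> * Y \<omega> \<partial>M) = 0)"

text \<open>A substitute for almost sure equality with an \<open>F s\<close>-measurable function, which is visibly
  stable under \<open>L\<^sup>2\<close> limits.\<close>

definition known_at :: "real \<Rightarrow> ('a \<Rightarrow> real) \<Rightarrow> bool" where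
  "known_at s X \<longleftrightarrow> square_integrable M X \<and> (\<forall>Y. orth_past s Y \<longrightarrow> (\<integral>\<omega>. X \<omega> * Y \<omega> \<partial>M) = 0)"

lemma bounded_past_measurable: "bounded_past s g \<Longrightarrow> g \<in> borel_measurable M"
  by (auto simp: bounded_past_def intro: measurable_from_subalg[OF subalg])

lemma bounded_past_const [simp]: "bounded_past s (\<lambda>_. c)"
  by (auto simp: bounded_past_def)

lemma bounded_past_mult:
  assumes "bounded_past s f" "bounded_past s g"
  shows "bounded_past s (\<lambda>\<omega>. f \<omega> * g \<omega>)"
proof -
  obtain C D where "\<forall>\<omega>\<in>space M. \<bar>f \<omega>\<bar> \<le> C" "\<forall>\<omega>\<in>space M. \<bar>g \<omega>\<bar> \<le> D"
    using assms by (auto simp: bounded_past_def)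
  then have "\<forall>\<omega>\<in>space M. \<bar>f \<omega> * g \<omega>\<bar> \<le> C * D"
    by (auto simp: abs_mult intro!: mult_mono intro: order_trans[OF abs_ge_zero])
  then show ?thesis using assms by (auto simp: bounded_past_def)
qed

lemma bounded_past_mono: "bounded_past s g \<Longrightarrow> s \<le> t \<Longrightarrow> bounded_past t g"
  using sets_F_mono[of s t] by (auto simp: bounded_past_def measurable_def space_F)

lemma bounded_past_integrable:
  assumes "bounded_past s g"
  shows "integrable M g"
proof -
  obtain C where "\<forall>\<omega>\<in>space M. \<bar>g \<omega>\<bar> \<le> C" using assms by (auto simp: bounded_past_def)
  then show ?thesis
    using bounded_past_measurable[OF assms] by (intro integrable_const_bound[of _ C]) (auto intro: AE_I2)
qed

lemma square_integrable_bounded_past_mult: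
  assumes "bounded_past s g" "square_integrable M X"
  shows "square_integrable M (\<lambda>\<omega>. g \<omega> * X \<omega>)"
  using assms bounded_past_measurable[OF assms(1)]
  by (auto simp: bounded_past_def intro: square_integrable_bounded_mult)

lemma L2_lim_bounded_past_mult:
  assumes "bounded_past s g" "L2_lim M f X"
  shows "L2_lim M (\<lambda>n \<omega>. g \<omega> * f n \<omega>) (\<lambda>\<omega>. g \<omega> * X \<omega>)"
proof -
  obtain C where "\<And>\<omega>. \<omega> \<in> space M \<Longrightarrow> \<bar>g \<omega>\<bar> \<le> C" using assms by (auto simp: bounded_past_def)
  from L2_lim_bounded_scaleR[OF assms(2) bounded_past_measurable[OF assms(1)] this]
  show ?thesis by simp
qed

lemma square_integrable_bounded_past:
  assumes "bounded_past s g"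
  shows "square_integrable M g"
proof -
  have "square_integrable M (\<lambda>_::'a. 1::real)" by (simp add: square_integrable_def)
  from square_integrable_bounded_past_mult[OF assms this] show ?thesis by simp
qed

lemma orth_past_sq: "orth_past s Y \<Longrightarrow> square_integrable M Y"
  by (simp add: orth_past_def)

lemma known_at_sq: "known_at s X \<Longrightarrow> square_integrable M X"
  by (simp add: known_at_def)

lemma known_orth: "known_at s X \<Longrightarrow> orth_past s Y \<Longrightarrow> (\<integral>\<omega>. X \<omega> * Y \<omega> \<partial>M) = 0"
  by (simp add: known_at_def)

lemma orth_past_antimono: "orth_past t Y \<Longrightarrow> s \<le> t \<Longrightarrow> orth_past s Y"
  using bounded_past_mono by (auto simp: orth_past_def)

lemma known_at_mono: "known_at s X \<Longrightarrow> s \<le> t \<Longrightarrow> known_at t X"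
  using orth_past_antimono by (auto simp: known_at_def)

lemma orth_past_mult:
  assumes g: "bounded_past s g" and Y: "orth_past s Y"
  shows "orth_past s (\<lambda>\<omega>. g \<omega> * Y \<omega>)"
proof -
  have "(\<integral>\<omega>. f \<omega> * (g \<omega> * Y \<omega>) \<partial>M) = 0" if "bounded_past s f" for f
    using bounded_past_mult[OF that g] Y unfolding orth_past_def mult.assoc[symmetric] by blast
  then show ?thesis
    using square_integrable_bounded_past_mult[OF g] Y by (auto simp: orth_past_def)
qed

text \<open>The bounded weight is moved to the other factor, where it preserves orthogonality to the
  past.\<close>

lemma known_at_mult:
  assumes g: "bounded_past s g" and X: "known_at s X"
  shows "known_at s (\<lambda>\<omega>. g \<omega> * X \<omega>)"
proof -
  have "(\<integral>\<omega>. (g \<omega> * X \<omega>) * Y \<omega> \<partial>M) = 0" if "orth_past s Y" for Y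
    using known_orth[OF X orth_past_mult[OF g that]] by (simp add: mult_ac)
  then show ?thesis
    using square_integrable_bounded_past_mult[OF g] X by (auto simp: known_at_def)
qed

lemma orth_past_add:
  assumes "orth_past s X" "orth_past s Y"
  shows "orth_past s (\<lambda>\<omega>. X \<omega> + Y \<omega>)"
proof -
  note sq = assms[THEN orth_past_sq]
  have "(\<integral>\<omega>. g \<omega> * (X \<omega> + Y \<omega>) \<partial>M) = 0" if "bounded_past s g" for g
    using square_integrable_mult[OF square_integrable_bounded_past[OF that] sq(1)]
      square_integrable_mult[OF square_integrable_bounded_past[OF that] sq(2)] assms that
    by (simp add: distrib_left orth_past_def)
  then show ?thesis using square_integrable_add[OF sq] by (simp add: orth_past_def)
qed

lemma orth_past_zero [simp]: "orth_past s (\<lambda>_. 0)"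
  by (simp add: orth_past_def)

lemma orth_past_sum:
  "(\<And>i. i \<in> I \<Longrightarrow> orth_past s (f i)) \<Longrightarrow> orth_past s (\<lambda>\<omega>. \<Sum>i\<in>I. f i \<omega>)"
  by (induction I rule: infinite_finite_induct) (auto intro: orth_past_add)

lemma known_at_add:
  assumes "known_at s X" "known_at s Y"
  shows "known_at s (\<lambda>\<omega>. X \<omega> + Y \<omega>)"
proof -
  note sq = assms[THEN known_at_sq]
  have "(\<integral>\<omega>. (X \<omega> + Y \<omega>) * V \<omega> \<partial>M) = 0" if "orth_past s V" for V
    using square_integrable_mult[OF sq(1) orth_past_sq[OF that]]
      square_integrable_mult[OF sq(2) orth_past_sq[OF that]] assms that
    by (simp add: distrib_right known_at_def)
  then show ?thesis using square_integrable_add[OF sq] by (simp add: known_at_def)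
qed

lemma known_at_zero [simp]: "known_at s (\<lambda>_. 0)"
  by (simp add: known_at_def)

lemma known_at_sum:
  "(\<And>i. i \<in> I \<Longrightarrow> known_at s (f i)) \<Longrightarrow> known_at s (\<lambda>\<omega>. \<Sum>i\<in>I. f i \<omega>)"
  by (induction I rule: infinite_finite_induct) (auto intro: known_at_add)

lemma known_at_diff:
  assumes "known_at s X" "known_at s Y"
  shows "known_at s (\<lambda>\<omega>. X \<omega> - Y \<omega>)"
  using known_at_add[OF assms(1) known_at_mult[OF bounded_past_const[of s "-1"] assms(2)]] by simp

lemma known_at_lim:
  assumes lim: "L2_lim M f X" and f: "\<And>n. known_at s (f n)"
  shows "known_at s X"
proof -
  have "(\<integral>\<omega>. X \<omega> * Y \<omega> \<partial>M) = 0" if Y: "orth_past s Y" for Y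
    using L2_lim_mult[OF lim L2_lim_const[OF orth_past_sq[OF Y]]] known_orth[OF f Y]
    by (simp add: LIMSEQ_const_iff)
  then show ?thesis using L2_limD(2)[OF lim] by (simp add: known_at_def)
qed

lemma orth_past_lim:
  assumes lim: "L2_lim M f Y" and f: "\<And>n. orth_past s (f n)"
  shows "orth_past s Y"
proof -
  have "(\<integral>\<omega>. g \<omega> * Y \<omega> \<partial>M) = 0" if g: "bounded_past s g" for g
    using L2_lim_mult[OF L2_lim_const[OF square_integrable_bounded_past[OF g]] lim] f g
    by (simp add: LIMSEQ_const_iff orth_past_def)
  then show ?thesis using L2_limD(2)[OF lim] by (simp add: orth_past_def)
qed

lemma known_at_measurable:
  assumes X: "X \<in> borel_measurable (F s)" and sq: "square_integrable M X"
  shows "known_at s X"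
proof -
  have XM: "X \<in> borel_measurable M" using sq by (rule square_integrable_measurable)
  have "(\<integral>\<omega>. X \<omega> * Y \<omega> \<partial>M) = 0" if Y: "orth_past s Y" for Y
  proof -
    \<comment> \<open>Orthogonality is tested on bounded functions only, so \<open>X\<close> is cut
      off at level \<open>n\<close>; dominated convergence removes the cut-off.\<close>
    define T where "T n \<omega> = (if \<bar>X \<omega>\<bar> \<le> real n then X \<omega> else 0)" for n \<omega>
    have T: "bounded_past s (T n)" for n
      unfolding bounded_past_def T_def using X by (auto intro!: exI[of _ "real n"])
    have YM: "Y \<in> borel_measurable M" using orth_past_sq[OF Y] by (rule square_integrable_measurable)
    have "(\<lambda>n. \<integral>\<omega>. T n \<omega> * Y \<omega> \<partial>M) \<longlonglongrightarrow> (\<integral>\<omega>. X \<omega> * Y \<omega> \<partial>M)"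
    proof (rule integral_dominated_convergence)
      show "integrable M (\<lambda>\<omega>. \<bar>X \<omega> * Y \<omega>\<bar>)"
        using square_integrable_mult[OF sq orth_past_sq[OF Y]] by simp
      show "(\<lambda>\<omega>. T n \<omega> * Y \<omega>) \<in> borel_measurable M" for n
        using bounded_past_measurable[OF T] YM by measurable
      show "(\<lambda>\<omega>. X \<omega> * Y \<omega>) \<in> borel_measurable M" using XM YM by measurable
      show "AE \<omega> in M. norm (T n \<omega> * Y \<omega>) \<le> \<bar>X \<omega> * Y \<omega>\<bar>" for n
        by (auto simp: T_def)
      show "AE \<omega> in M. (\<lambda>n. T n \<omega> * Y \<omega>) \<longlonglongrightarrow> X \<omega> * Y \<omega>"
      proof (intro AE_I2 tendsto_eventually)
        fix \<omega>
        obtain N where "\<bar>X \<omega>\<bar> \<le> real N" using real_arch_simple by blast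
        then show "\<forall>\<^sub>F n in sequentially. T n \<omega> * Y \<omega> = X \<omega> * Y \<omega>"
          unfolding eventually_sequentially T_def
          by (intro exI[of _ N]) (auto dest: order_trans)
      qed
    qed
    then show ?thesis using T Y by (simp add: orth_past_def LIMSEQ_const_iff)
  qed
  then show ?thesis using sq by (simp add: known_at_def)
qed

end

text \<open>What the moment computations need from the noise. The covariance is a matrix because a
  jump process and its power processes jump together; the weight \<open>g\<close> in
  \<open>cov\<close> says that it is also the conditional covariance given the past.\<close>

locale driven_space = filtered_prob_space M F
  for M :: "'a measure" and F :: "real \<Rightarrow> 'a measure" +
  fixes B :: "'i set" and Z :: "'i \<Rightarrow> real \<Rightarrow> 'a \<Rightarrow> real" and c :: "'i \<Rightarrow> 'i \<Rightarrow> real"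
  assumes known: "\<And>a t. a \<in> B \<Longrightarrow> 0 \<le> t \<Longrightarrow> known_at t (Z a t)"
    and orth: "\<And>a s t. a \<in> B \<Longrightarrow> 0 \<le> s \<Longrightarrow> s \<le> t \<Longrightarrow> orth_past s (\<lambda>\<omega>. Z a t \<omega> - Z a s \<omega>)"
    and cov: "\<And>a b s t g. a \<in> B \<Longrightarrow> b \<in> B \<Longrightarrow> 0 \<le> s \<Longrightarrow> s \<le> t \<Longrightarrow> bounded_past s g \<Longrightarrow>
      (\<integral>\<omega>. g \<omega> * ((Z a t \<omega> - Z a s \<omega>) * (Z b t \<omega> - Z b s \<omega>)) \<partial>M) = c a b * (t - s) * (\<integral>\<omega>. g \<omega> \<partial>M)"
begin

section \<open>Covariances of driver increments\<close>

lemma c_commute: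
  assumes "a \<in> B" "b \<in> B"
  shows "c a b = c b a"
  using cov[OF assms, of 0 1 "\<lambda>_. 1"] cov[OF assms(2,1), of 0 1 "\<lambda>_. 1"]
  by (simp add: mult.commute prob_space)

lemma sq_incr:
  assumes "a \<in> B" "0 \<le> s" "0 \<le> t"
  shows "square_integrable M (\<lambda>\<omega>. Z a t \<omega> - Z a s \<omega>)"
  using known[OF assms(1,2)] known[OF assms(1,3)] by (auto intro: square_integrable_diff known_at_sq)

lemma known_incr:
  assumes "a \<in> B" "0 \<le> s" "0 \<le> t" "s \<le> r" "t \<le> r"
  shows "known_at r (\<lambda>\<omega>. Z a t \<omega> - Z a s \<omega>)"
  using known[OF assms(1,2)] known[OF assms(1,3)] assms by (auto intro: known_at_diff known_at_mono)

text \<open>The part of the longer increment after \<open>q\<close> is orthogonal to everything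
  known at \<open>q\<close>.\<close>

lemma cov_common_start:
  assumes a: "a \<in> B" and b: "b \<in> B" and r: "0 \<le> r" and q: "r \<le> q" "q \<le> u" and g: "bounded_past r g"
  shows "(\<integral>\<omega>. g \<omega> * ((Z a q \<omega> - Z a r \<omega>) * (Z b u \<omega> - Z b r \<omega>)) \<partial>M) = c a b * (q - r) * (\<integral>\<omega>. g \<omega> \<partial>M)"
proof -
  have k: "known_at q (\<lambda>\<omega>. g \<omega> * (Z a q \<omega> - Z a r \<omega>))"
    using bounded_past_mono[OF g q(1)] a r q by (auto intro!: known_at_mult known_incr)
  have o: "orth_past q (\<lambda>\<omega>. Z b u \<omega> - Z b q \<omega>)" using b r q by (intro orth) auto
  have "(\<integral>\<omega>. g \<omega> * ((Z a q \<omega> - Z a r \<omega>) * (Z b u \<omega> - Z b r \<omega>)) \<partial>M)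
     = (\<integral>\<omega>. g \<omega> * ((Z a q \<omega> - Z a r \<omega>) * (Z b q \<omega> - Z b r \<omega>))
          + (g \<omega> * (Z a q \<omega> - Z a r \<omega>)) * (Z b u \<omega> - Z b q \<omega>) \<partial>M)"
    by (intro Bochner_Integration.integral_cong) (auto simp: algebra_simps)
  also have "\<dots> = (\<integral>\<omega>. g \<omega> * ((Z a q \<omega> - Z a r \<omega>) * (Z b q \<omega> - Z b r \<omega>)) \<partial>M)
       + (\<integral>\<omega>. (g \<omega> * (Z a q \<omega> - Z a r \<omega>)) * (Z b u \<omega> - Z b q \<omega>) \<partial>M)"
  proof (rule Bochner_Integration.integral_add)
    show "integrable M (\<lambda>\<omega>. g \<omega> * ((Z a q \<omega> - Z a r \<omega>) * (Z b q \<omega> - Z b r \<omega>)))"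
      using square_integrable_mult[OF known_at_sq[OF k] sq_incr[OF b r, of q]] r q by (simp add: mult.assoc)
    show "integrable M (\<lambda>\<omega>. (g \<omega> * (Z a q \<omega> - Z a r \<omega>)) * (Z b u \<omega> - Z b q \<omega>))"
      by (rule square_integrable_mult[OF known_at_sq[OF k] orth_past_sq[OF o]])
  qed
  finally show ?thesis using known_orth[OF k o] cov[OF a b r q(1) g] by simp
qed

text \<open>The part of the first increment before \<open>r\<close> is known at \<open>r\<close>,
  hence orthogonal to the second increment; the rest starts at \<open>r\<close> as well.\<close>

lemma cov_ordered:
  assumes a: "a \<in> B" and b: "b \<in> B" and p: "0 \<le> p" "p \<le> q" "p \<le> r" and u: "r \<le> u" and g: "bounded_past r g"
  shows "(\<integral>\<omega>. g \<omega> * ((Z a q \<omega> - Z a p \<omega>) * (Z b u \<omega> - Z b r \<omega>)) \<partial>M)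
    = c a b * max 0 (min q u - r) * (\<integral>\<omega>. g \<omega> \<partial>M)"
proof -
  have r: "0 \<le> r" using p by simp
  \<comment> \<open>If \<open>q \<le> r\<close>, the second piece of the split is empty; otherwise
    the cut is made at \<open>r\<close>.\<close>
  define q1 q2 where "q1 = min q r" and "q2 = max q r"
  have q1: "p \<le> q1" "q1 \<le> r" "0 \<le> q1" and q2: "r \<le> q2" using p by (auto simp: q1_def q2_def)
  have split: "Z a q \<omega> - Z a p \<omega> = (Z a q1 \<omega> - Z a p \<omega>) + (Z a q2 \<omega> - Z a r \<omega>)" for \<omega>
    by (auto simp: q1_def q2_def min_def max_def)
  have k: "known_at r (\<lambda>\<omega>. g \<omega> * (Z a q1 \<omega> - Z a p \<omega>))"
    using g a p q1 by (auto intro!: known_at_mult known_incr)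
  have o: "orth_past r (\<lambda>\<omega>. Z b u \<omega> - Z b r \<omega>)" using b r u by (intro orth) auto
  have "(\<integral>\<omega>. g \<omega> * ((Z a q \<omega> - Z a p \<omega>) * (Z b u \<omega> - Z b r \<omega>)) \<partial>M)
     = (\<integral>\<omega>. (g \<omega> * (Z a q1 \<omega> - Z a p \<omega>)) * (Z b u \<omega> - Z b r \<omega>)
         + g \<omega> * ((Z a q2 \<omega> - Z a r \<omega>) * (Z b u \<omega> - Z b r \<omega>)) \<partial>M)"
    unfolding split by (intro Bochner_Integration.integral_cong) (auto simp: algebra_simps)
  also have "\<dots> = (\<integral>\<omega>. (g \<omega> * (Z a q1 \<omega> - Z a p \<omega>)) * (Z b u \<omega> - Z b r \<omega>) \<partial>M)
       + (\<integral>\<omega>. g \<omega> * ((Z a q2 \<omega> - Z a r \<omega>) * (Z b u \<omega> - Z b r \<omega>)) \<partial>M)"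
  proof (rule Bochner_Integration.integral_add)
    show "integrable M (\<lambda>\<omega>. (g \<omega> * (Z a q1 \<omega> - Z a p \<omega>)) * (Z b u \<omega> - Z b r \<omega>))"
      by (rule square_integrable_mult[OF known_at_sq[OF k] orth_past_sq[OF o]])
    show "integrable M (\<lambda>\<omega>. g \<omega> * ((Z a q2 \<omega> - Z a r \<omega>) * (Z b u \<omega> - Z b r \<omega>)))"
      using square_integrable_mult[OF square_integrable_bounded_past_mult[OF g sq_incr[OF a r, of q2]]
          orth_past_sq[OF o]] r q2 by (simp add: mult.assoc)
  qed
  also have "(\<integral>\<omega>. g \<omega> * ((Z a q2 \<omega> - Z a r \<omega>) * (Z b u \<omega> - Z b r \<omega>)) \<partial>M)
      = c a b * (min q2 u - r) * (\<integral>\<omega>. g \<omega> \<partial>M)"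
  proof (cases "q2 \<le> u")
    case True
    then show ?thesis using cov_common_start[OF a b r q2 True g] by simp
  next
    case False
    then have "u \<le> q2" by simp
    then show ?thesis using cov_common_start[OF b a r u _ g, of q2] c_commute[OF a b]
      by (simp add: mult.commute[of "Z a q2 _ - _"])
  qed
  also have "min q2 u - r = max 0 (min q u - r)" using u by (auto simp: q2_def)
  finally show ?thesis using known_orth[OF k o] by simp
qed

text \<open>At the later of the two starting times both weights are past information, which reduces
  the claim to the ordered case.\<close>

lemma cov_intervals:
  assumes a: "a \<in> B" and b: "b \<in> B" and p: "0 \<le> p" "p \<le> q" and u: "0 \<le> r" "r \<le> u"
    and f: "bounded_past p f" and g: "bounded_past r g"
  shows "(\<integral>\<omega>. (f \<omega> * g \<omega>) * ((Z a q \<omega> - Z a p \<omega>) * (Z b u \<omega> - Z b r \<omega>)) \<partial>M)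
    = c a b * max 0 (min q u - max p r) * (\<integral>\<omega>. f \<omega> * g \<omega> \<partial>M)"
proof (cases "p \<le> r")
  case True
  then show ?thesis
    using cov_ordered[OF a b p True u(2) bounded_past_mult[OF bounded_past_mono[OF f True] g]]
    by (simp add: max_absorb2)
next
  case False
  then have le: "r \<le> p" by simp
  then show ?thesis
    using cov_ordered[OF b a u le p(2) bounded_past_mult[OF f bounded_past_mono[OF g le]]] c_commute[OF a b]
    by (simp add: max_absorb1 min.commute mult.commute[of "Z b u _ - _"])
qed

section \<open>Step integrals against the drivers\<close>

lemma simple_predictableD:
  fixes h :: "nat \<Rightarrow> 'a \<Rightarrow> real"
  assumes "simple_predictable F (K, \<tau>, h)" "k < K"
  shows "0 \<le> \<tau> k" "\<tau> k \<le> \<tau> (Suc k)" "bounded_past (\<tau> k) (h k)"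
proof -
  have "k \<le> K \<Longrightarrow> 0 \<le> \<tau> k" for k
    using assms(1) by (induction k) (auto simp: simple_predictable_def intro: order_trans)
  then show "0 \<le> \<tau> k" using assms(2) by simp
  show "\<tau> k \<le> \<tau> (Suc k)" "bounded_past (\<tau> k) (h k)"
    using assms by (auto simp: simple_predictable_def bounded_past_def space_F)
qed

lemma known_step_integral:
  assumes a: "a \<in> B" and S: "simple_predictable F S" and t: "0 \<le> t"
  shows "known_at t (step_integral (Z a) S t)"
proof -
  obtain K \<tau> h where Se: "S = (K, \<tau>, h)" by (cases S) auto
  note S' = simple_predictableD[OF S[unfolded Se]]
  have "known_at t (\<lambda>\<omega>. \<Sum>k<K. h k \<omega> * (Z a (min t (\<tau> (Suc k))) \<omega> - Z a (min t (\<tau> k)) \<omega>))"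
  proof (rule known_at_sum)
    fix k assume "k \<in> {..<K}"
    then have k: "k < K" by simp
    show "known_at t (\<lambda>\<omega>. h k \<omega> * (Z a (min t (\<tau> (Suc k))) \<omega> - Z a (min t (\<tau> k)) \<omega>))"
    proof (cases "\<tau> k \<le> t")
      case True
      then show ?thesis using S'[OF k] t
        by (intro known_at_mult[OF bounded_past_mono] known_incr[OF a]) auto
    next
      \<comment> \<open>The interval starts after \<open>t\<close>, so both truncated end points
        equal \<open>t\<close> and the summand vanishes.\<close>
      case False
      then show ?thesis using S'[OF k] by simp
    qed
  qed
  then show ?thesis by (simp add: Se step_integral_def mult.commute)
qed

lemma orth_step_integral:
  assumes a: "a \<in> B" and S: "simple_predictable F S" and s: "0 \<le> s" "s \<le> t"
  shows "orth_past s (\<lambda>\<omega>. step_integral (Z a) S t \<omega> - step_integral (Z a) S s \<omega>)"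
proof -
  obtain K \<tau> h where Se: "S = (K, \<tau>, h)" by (cases S) auto
  note S' = simple_predictableD[OF S[unfolded Se]]
  have "orth_past s (\<lambda>\<omega>. \<Sum>k<K. h k \<omega> * ((Z a (min t (\<tau> (Suc k))) \<omega> - Z a (min t (\<tau> k)) \<omega>)
      - (Z a (min s (\<tau> (Suc k))) \<omega> - Z a (min s (\<tau> k)) \<omega>)))"
  proof (rule orth_past_sum)
    fix k assume "k \<in> {..<K}"
    then have k: "k < K" by simp
    \<comment> \<open>The \<open>k\<close>-th summand moves between \<open>s\<close> and
      \<open>t\<close> only on the intersection of the two intervals. It begins at \<open>l\<close>,
      where \<open>h k\<close> is already known; the outer maximum in \<open>r\<close> makes an
      empty intersection degenerate.\<close>
    define l where "l = max s (\<tau> k)"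
    define r where "r = max l (min t (\<tau> (Suc k)))"
    have lr: "s \<le> l" "0 \<le> l" "l \<le> r" "\<tau> k \<le> l" using s by (auto simp: l_def r_def)
    have e: "(Z a (min t (\<tau> (Suc k))) \<omega> - Z a (min t (\<tau> k)) \<omega>) - (Z a (min s (\<tau> (Suc k))) \<omega> - Z a (min s (\<tau> k)) \<omega>)
       = Z a r \<omega> - Z a l \<omega>" for \<omega>
      using S'[OF k] s by (auto simp: r_def l_def min_def max_def)
    have "orth_past l (\<lambda>\<omega>. h k \<omega> * (Z a r \<omega> - Z a l \<omega>))"
      by (intro orth_past_mult bounded_past_mono[OF S'(3)[OF k] lr(4)] orth a lr)
    then show "orth_past s (\<lambda>\<omega>. h k \<omega> * ((Z a (min t (\<tau> (Suc k))) \<omega> - Z a (min t (\<tau> k)) \<omega>)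
      - (Z a (min s (\<tau> (Suc k))) \<omega> - Z a (min s (\<tau> k)) \<omega>)))"
      unfolding e using lr(1) by (rule orth_past_antimono)
  qed
  then show ?thesis
    by (simp add: Se step_integral_def mult.commute sum_subtractf[symmetric] right_diff_distrib)
qed

end

lemma integral_double_sum:
  fixes f :: "nat \<Rightarrow> nat \<Rightarrow> 'a \<Rightarrow> real"
  assumes "\<And>j i. j < K \<Longrightarrow> i < L \<Longrightarrow> integrable M (f j i)"
  shows "(\<integral>x. (\<Sum>j<K. \<Sum>i<L. f j i x) \<partial>M) = (\<Sum>j<K. \<Sum>i<L. \<integral>x. f j i x \<partial>M)"
proof -
  have "(\<integral>x. (\<Sum>j<K. \<Sum>i<L. f j i x) \<partial>M) = (\<Sum>j<K. \<integral>x. (\<Sum>i<L. f j i x) \<partial>M)"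
    using assms by (intro Bochner_Integration.integral_sum Bochner_Integration.integrable_sum) auto
  also have "\<dots> = (\<Sum>j<K. \<Sum>i<L. \<integral>x. f j i x \<partial>M)"
    using assms by (intro sum.cong refl Bochner_Integration.integral_sum) auto
  finally show ?thesis .
qed

lemma integral_pair_mult:
  fixes f :: "'a \<Rightarrow> real" and g :: "'b \<Rightarrow> real"
  assumes "sigma_finite_measure M" "sigma_finite_measure N"
    and f: "integrable M f" and g: "integrable N g"
  shows "integrable (M \<Otimes>\<^sub>M N) (\<lambda>(x, y). f x * g y)"
    and "(\<integral>(x, y). f x * g y \<partial>(M \<Otimes>\<^sub>M N)) = (\<integral>x. f x \<partial>M) * (\<integral>y. g y \<partial>N)"
proof -
  interpret M: sigma_finite_measure M by fact
  interpret N: sigma_finite_measure N by fact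
  interpret pair_sigma_finite M N ..
  have [measurable]: "f \<in> borel_measurable M" "g \<in> borel_measurable N" using f g by auto
  show i: "integrable (M \<Otimes>\<^sub>M N) (\<lambda>(x, y). f x * g y)"
  proof (rule Fubini_integrable)
    show "integrable M (\<lambda>x. \<integral>y. norm (case (x, y) of (x, y) \<Rightarrow> f x * g y) \<partial>N)"
      using f by (simp add: abs_mult)
    show "AE x in M. integrable N (\<lambda>y. case (x, y) of (x, y) \<Rightarrow> f x * g y)"
      using g by simp
  qed measurable
  show "(\<integral>(x, y). f x * g y \<partial>(M \<Otimes>\<^sub>M N)) = (\<integral>x. f x \<partial>M) * (\<integral>y. g y \<partial>N)"
    using integral_fst'[OF i] by simp
qed

context driven_space
begin

text \<open>The Ito isometry in polarised and weighted form. No common refinement of the two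
  partitions is formed: the covariance of two increments is proportional to the overlap of their
  intervals, which is also the time integral of the product of the indicators.\<close>

lemma step_integral_cov:
  assumes a: "a \<in> B" and b: "b \<in> B" and S: "simple_predictable F S" and R: "simple_predictable F R"
    and t: "0 \<le> t" and g: "bounded_past 0 g"
  shows "(\<integral>\<omega>. g \<omega> * (step_integral (Z a) S t \<omega> * step_integral (Z b) R t \<omega>) \<partial>M)
    = c a b * (\<integral>(\<omega>, s). g \<omega> * (step_value S s \<omega> * step_value R s \<omega>) \<partial>(M \<Otimes>\<^sub>M time_measure t))"
proof -
  interpret U: finite_measure "time_measure t" by (rule finite_measure_time_measure)
  obtain K \<tau> h where Se: "S = (K, \<tau>, h)" by (cases S) auto
  obtain L \<sigma> k where Re: "R = (L, \<sigma>, k)" by (cases R) auto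
  note S' = simple_predictableD[OF S[unfolded Se]] and R' = simple_predictableD[OF R[unfolded Re]]
  define dS where "dS j \<omega> = Z a (min t (\<tau> (Suc j))) \<omega> - Z a (min t (\<tau> j)) \<omega>" for j \<omega>
  define dR where "dR i \<omega> = Z b (min t (\<sigma> (Suc i))) \<omega> - Z b (min t (\<sigma> i)) \<omega>" for i \<omega>
  define ln where "ln j i = (\<integral>s. indicat_real {\<tau> j<..\<tau> (Suc j)} s * indicat_real {\<sigma> i<..\<sigma> (Suc i)} s \<partial>time_measure t)" for j i
  have gM: "g \<in> borel_measurable M" using g by (rule bounded_past_measurable)
  have int: "integrable M (\<lambda>\<omega>. (g \<omega> * h j \<omega>) * k i \<omega>)" if "j < K" "i < L" for j i
    using bounded_past_integrable[OF bounded_past_mult[OF bounded_past_mult[OF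
       bounded_past_mono[OF g S'(1)[OF that(1)]] S'(3)[OF that(1)], THEN bounded_past_mono, of "max (\<tau> j) (\<sigma> i)"]
       bounded_past_mono[OF R'(3)[OF that(2)], of "max (\<tau> j) (\<sigma> i)"]]] by simp
  have sq: "square_integrable M (\<lambda>\<omega>. (g \<omega> * h j \<omega>) * dS j \<omega>)" "square_integrable M (\<lambda>\<omega>. k i \<omega> * dR i \<omega>)"
    if "j < K" "i < L" for j i
  proof -
    show "square_integrable M (\<lambda>\<omega>. (g \<omega> * h j \<omega>) * dS j \<omega>)"
      unfolding dS_def using S'[OF that(1)] t
      by (intro square_integrable_bounded_past_mult[OF bounded_past_mult[OF bounded_past_mono[OF g]]] sq_incr[OF a]) auto
    show "square_integrable M (\<lambda>\<omega>. k i \<omega> * dR i \<omega>)"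
      unfolding dR_def using R'[OF that(2)] t
      by (intro square_integrable_bounded_past_mult sq_incr[OF b]) auto
  qed
  have smd: "(\<integral>\<omega>. ((g \<omega> * h j \<omega>) * k i \<omega>) * (dS j \<omega> * dR i \<omega>) \<partial>M)
      = c a b * ln j i * (\<integral>\<omega>. (g \<omega> * h j \<omega>) * k i \<omega> \<partial>M)" if "j < K" "i < L" for j i
  proof -
    note s = S'[OF that(1)] and r = R'[OF that(2)]
    have "0 \<le> \<tau> (Suc j)" "0 \<le> \<sigma> (Suc i)" using s r by linarith+
    have ln: "ln j i = max 0 (min (min t (\<tau> (Suc j))) (min t (\<sigma> (Suc i))) - max (min t (\<tau> j)) (min t (\<sigma> i)))"
      unfolding ln_def using s r by (intro integral_time_measure_overlap) auto
    show ?thesis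
    proof (cases "\<tau> j \<le> t \<and> \<sigma> i \<le> t")
      case True
      then have "min t (\<tau> j) = \<tau> j" "min t (\<sigma> i) = \<sigma> i" by auto
      then show ?thesis unfolding ln dS_def dR_def using s r True
        by (intro cov_intervals[OF a b]) (auto intro: bounded_past_mult bounded_past_mono[OF g])
    next
      \<comment> \<open>One of the intervals begins after \<open>t\<close>; its truncated increment
        and the overlap are both zero.\<close>
      case False
      then have "ln j i = 0" unfolding ln by auto
      moreover have "(\<lambda>\<omega>. ((g \<omega> * h j \<omega>) * k i \<omega>) * (dS j \<omega> * dR i \<omega>)) = (\<lambda>_. 0)" using False s r by (auto simp: dS_def dR_def)
      ultimately show ?thesis by simp
    qed
  qed
  have "(\<integral>\<omega>. g \<omega> * (step_integral (Z a) S t \<omega> * step_integral (Z b) R t \<omega>) \<partial>M)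
     = (\<integral>\<omega>. (\<Sum>j<K. \<Sum>i<L. ((g \<omega> * h j \<omega>) * dS j \<omega>) * (k i \<omega> * dR i \<omega>)) \<partial>M)"
  proof (intro Bochner_Integration.integral_cong refl)
    fix \<omega>
    have "g \<omega> * (step_integral (Z a) S t \<omega> * step_integral (Z b) R t \<omega>)
      = (\<Sum>j<K. (g \<omega> * h j \<omega>) * dS j \<omega>) * (\<Sum>i<L. k i \<omega> * dR i \<omega>)"
    proof -
      have "g \<omega> * step_integral (Z a) S t \<omega> = (\<Sum>j<K. (g \<omega> * h j \<omega>) * dS j \<omega>)"
        by (simp add: Se step_integral_def dS_def sum_distrib_left mult_ac)
      moreover have "step_integral (Z b) R t \<omega> = (\<Sum>i<L. k i \<omega> * dR i \<omega>)"
        by (simp add: Re step_integral_def dR_def mult_ac)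
      ultimately show ?thesis by (simp add: mult.assoc[symmetric])
    qed
    then show "g \<omega> * (step_integral (Z a) S t \<omega> * step_integral (Z b) R t \<omega>)
      = (\<Sum>j<K. \<Sum>i<L. ((g \<omega> * h j \<omega>) * dS j \<omega>) * (k i \<omega> * dR i \<omega>))"
      by (simp add: sum_product)
  qed
  also have "\<dots> = (\<Sum>j<K. \<Sum>i<L. \<integral>\<omega>. ((g \<omega> * h j \<omega>) * dS j \<omega>) * (k i \<omega> * dR i \<omega>) \<partial>M)"
    by (intro integral_double_sum square_integrable_mult sq)
  also have "\<dots> = (\<Sum>j<K. \<Sum>i<L. c a b * ln j i * (\<integral>\<omega>. (g \<omega> * h j \<omega>) * k i \<omega> \<partial>M))"
    by (intro sum.cong refl, subst smd[symmetric]) (auto simp: mult_ac)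
  finally have L: "(\<integral>\<omega>. g \<omega> * (step_integral (Z a) S t \<omega> * step_integral (Z b) R t \<omega>) \<partial>M)
     = (\<Sum>j<K. \<Sum>i<L. c a b * ln j i * (\<integral>\<omega>. (g \<omega> * h j \<omega>) * k i \<omega> \<partial>M))" .
  define \<phi> where "\<phi> j i s = indicat_real {\<tau> j<..\<tau> (Suc j)} s * indicat_real {\<sigma> i<..\<sigma> (Suc i)} s" for j i s
  have \<phi>: "integrable (time_measure t) (\<phi> j i)" for j i
    unfolding \<phi>_def by (intro U.integrable_const_bound[of _ 1]) (auto simp: indicator_def)
  note pm = integral_pair_mult[OF sigma_finite_measure_axioms U.sigma_finite_measure_axioms int \<phi>]
  have "(\<integral>(\<omega>, s). g \<omega> * (step_value S s \<omega> * step_value R s \<omega>) \<partial>(M \<Otimes>\<^sub>M time_measure t))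
     = (\<integral>x. (\<Sum>j<K. \<Sum>i<L. (case x of (\<omega>, s) \<Rightarrow> ((g \<omega> * h j \<omega>) * k i \<omega>) * \<phi> j i s)) \<partial>(M \<Otimes>\<^sub>M time_measure t))"
  proof (intro Bochner_Integration.integral_cong refl)
    fix x :: "'a \<times> real"
    obtain \<omega> s where x: "x = (\<omega>, s)" by (cases x)
    have "g \<omega> * step_value S s \<omega> = (\<Sum>j<K. (g \<omega> * h j \<omega>) * indicat_real {\<tau> j<..\<tau> (Suc j)} s)"
      unfolding Se step_value_def prod.case sum_distrib_left by (intro sum.cong) auto
    moreover have "step_value R s \<omega> = (\<Sum>i<L. k i \<omega> * indicat_real {\<sigma> i<..\<sigma> (Suc i)} s)"
      unfolding Re step_value_def prod.case by (intro sum.cong) auto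
    ultimately have "g \<omega> * (step_value S s \<omega> * step_value R s \<omega>)
       = (\<Sum>j<K. (g \<omega> * h j \<omega>) * indicat_real {\<tau> j<..\<tau> (Suc j)} s)
         * (\<Sum>i<L. k i \<omega> * indicat_real {\<sigma> i<..\<sigma> (Suc i)} s)"
      unfolding mult.assoc[symmetric] by (simp only:)
    also have "\<dots> = (\<Sum>j<K. \<Sum>i<L. ((g \<omega> * h j \<omega>) * k i \<omega>) * \<phi> j i s)"
      unfolding sum_product \<phi>_def by (intro sum.cong refl) (simp only: mult_ac)
    finally show "(case x of (\<omega>, s) \<Rightarrow> g \<omega> * (step_value S s \<omega> * step_value R s \<omega>))
      = (\<Sum>j<K. \<Sum>i<L. (case x of (\<omega>, s) \<Rightarrow> ((g \<omega> * h j \<omega>) * k i \<omega>) * \<phi> j i s))"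
      by (simp only: x prod.case)
  qed
  also have "\<dots> = (\<Sum>j<K. \<Sum>i<L. (\<integral>\<omega>. (g \<omega> * h j \<omega>) * k i \<omega> \<partial>M) * (\<integral>s. \<phi> j i s \<partial>time_measure t))"
    by (subst integral_double_sum) (use pm in auto)
  finally show ?thesis unfolding L
    by (simp add: sum_distrib_left \<phi>_def ln_def mult_ac)
qed

end

section \<open>Square integrability over the product of the sample space with time\<close>

lemma square_integrable_bounded:
  fixes f :: "'a \<Rightarrow> real"
  assumes "finite_measure N" "f \<in> borel_measurable N" "\<And>x. x \<in> space N \<Longrightarrow> \<bar>f x\<bar> \<le> C"
  shows "square_integrable N f"
proof -
  interpret finite_measure N by fact
  have "square_integrable N (\<lambda>_::'a. 1::real)" by (simp add: square_integrable_def)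
  from square_integrable_bounded_mult[OF this assms(2,3)] show ?thesis by simp
qed

lemma square_integrable_integrable:
  fixes f :: "'a \<Rightarrow> real"
  assumes "finite_measure N" "square_integrable N f"
  shows "integrable N f"
proof -
  have "square_integrable N (\<lambda>_::'a. 1::real)"
    by (rule square_integrable_bounded[OF assms(1), of _ 1]) auto
  from square_integrable_mult[OF assms(2) this] show ?thesis by simp
qed

context prob_space
begin

lemma finite_measure_time_product: "finite_measure (M \<Otimes>\<^sub>M time_measure t)"
  by (intro finite_measure_pair_measure finite_measure_axioms finite_measure_time_measure)

lemma pair_sigma_finite_time: "pair_sigma_finite M (time_measure t)"
proof -
  interpret U: finite_measure "time_measure t" by (rule finite_measure_time_measure)
  show ?thesis ..
qed

lemma measurable_time_product: "f \<in> borel_measurable (M \<Otimes>\<^sub>M time_measure t) \<longleftrightarrow> f \<in> borel_measurable (M \<Otimes>\<^sub>M borel)"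
  by (simp cong: measurable_cong_sets sets_pair_measure_cong)

lemma square_integrable_fst_time:
  fixes X :: "'a \<Rightarrow> real"
  assumes X: "square_integrable M X"
  shows "square_integrable (M \<Otimes>\<^sub>M time_measure t) (\<lambda>(\<omega>, s). X \<omega>)"
proof -
  interpret U: finite_measure "time_measure t" by (rule finite_measure_time_measure)
  have i: "integrable M (\<lambda>\<omega>. (norm (X \<omega>))\<^sup>2)" using X by (rule square_integrable_norm_sq)
  have "X \<in> borel_measurable M" using X by (rule square_integrable_measurable)
  then show ?thesis
    using integral_pair_mult(1)[OF sigma_finite_measure_axioms U.sigma_finite_measure_axioms i, of "\<lambda>_. 1"]
    by (simp add: square_integrable_def split_beta')
qed

text \<open>By Tonelli, second moments bounded uniformly up to time \<open>t\<close> have a finite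
  time integral.\<close>

lemma square_integrable_time_product:
  fixes f :: "'a \<times> real \<Rightarrow> real"
  assumes f: "f \<in> borel_measurable (M \<Otimes>\<^sub>M borel)"
    and b: "\<And>s. 0 < s \<Longrightarrow> s \<le> t \<Longrightarrow> square_integrable M (\<lambda>\<omega>. f (\<omega>, s)) \<and> (\<integral>\<omega>. (f (\<omega>, s))\<^sup>2 \<partial>M) \<le> K"
  shows "square_integrable (M \<Otimes>\<^sub>M time_measure t) f"
proof -
  interpret U: finite_measure "time_measure t" by (rule finite_measure_time_measure)
  interpret P: pair_sigma_finite M "time_measure t" by (rule pair_sigma_finite_time)
  have f': "f \<in> borel_measurable (M \<Otimes>\<^sub>M time_measure t)" using f by (simp add: measurable_time_product)
  have "(\<integral>\<^sup>+x. ennreal ((f x)\<^sup>2) \<partial>(M \<Otimes>\<^sub>M time_measure t)) = (\<integral>\<^sup>+s. (\<integral>\<^sup>+\<omega>. ennreal ((f (\<omega>, s))\<^sup>2) \<partial>M) \<partial>time_measure t)"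
    using f' by (subst P.nn_integral_snd) auto
  also have "\<dots> \<le> (\<integral>\<^sup>+s. ennreal K \<partial>time_measure t)"
  proof (rule nn_integral_mono_AE, use AE_time_measure in eventually_elim)
    fix s assume s: "0 < s \<and> s \<le> t"
    then have "integrable M (\<lambda>\<omega>. (norm (f (\<omega>, s)))\<^sup>2)" using b square_integrable_norm_sq by blast
    then have "(\<integral>\<^sup>+\<omega>. ennreal ((f (\<omega>, s))\<^sup>2) \<partial>M) = ennreal (\<integral>\<omega>. (f (\<omega>, s))\<^sup>2 \<partial>M)"
      by (intro nn_integral_eq_integral) auto
    then show "(\<integral>\<^sup>+\<omega>. ennreal ((f (\<omega>, s))\<^sup>2) \<partial>M) \<le> ennreal K" using b s by (simp add: ennreal_leI)
  qed
  also have "\<dots> < \<infinity>"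
    by (simp add: ennreal_mult_less_top U.emeasure_finite[unfolded infinity_ennreal_def less_top])
  finally show ?thesis
    unfolding square_integrable_def using f' by (intro conjI integrableI_bounded) auto
qed

lemma nn_integral_time_product_mono:
  assumes f: "f \<in> borel_measurable (M \<Otimes>\<^sub>M borel)" and st: "s \<le> t"
  shows "(\<integral>\<^sup>+x. f x \<partial>(M \<Otimes>\<^sub>M time_measure s)) \<le> (\<integral>\<^sup>+x. f x \<partial>(M \<Otimes>\<^sub>M time_measure t))"
proof -
  have eq: "(\<integral>\<^sup>+x. f x \<partial>(M \<Otimes>\<^sub>M time_measure r)) = (\<integral>\<^sup>+\<omega>. \<integral>\<^sup>+u. ennreal (indicat_real {0<..r} u) * f (\<omega>, u) \<partial>lborel \<partial>M)" for r
  proof -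
    interpret U: finite_measure "time_measure r" by (rule finite_measure_time_measure)
    have "(\<integral>\<^sup>+x. f x \<partial>(M \<Otimes>\<^sub>M time_measure r)) = (\<integral>\<^sup>+\<omega>. \<integral>\<^sup>+u. f (\<omega>, u) \<partial>time_measure r \<partial>M)"
      using f by (subst U.nn_integral_fst) (auto simp: measurable_time_product)
    also have "\<dots> = (\<integral>\<^sup>+\<omega>. \<integral>\<^sup>+u. ennreal (indicat_real {0<..r} u) * f (\<omega>, u) \<partial>lborel \<partial>M)"
    proof (rule nn_integral_cong)
      fix \<omega> assume \<omega>: "\<omega> \<in> space M"
      have "(\<lambda>u. f (\<omega>, u)) \<in> borel_measurable borel"
        using measurable_compose[OF _ f, of "\<lambda>u. (\<omega>, u)" borel] \<omega> by simp
      then show "(\<integral>\<^sup>+u. f (\<omega>, u) \<partial>time_measure r) = (\<integral>\<^sup>+u. ennreal (indicat_real {0<..r} u) * f (\<omega>, u) \<partial>lborel)"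
        unfolding time_measure_def by (subst nn_integral_density) auto
    qed
    finally show ?thesis .
  qed
  show ?thesis unfolding eq using st
    by (intro nn_integral_mono mult_right_mono ennreal_leI) (auto simp: indicator_def)
qed

lemma square_integrable_time_mono:
  fixes f :: "'a \<times> real \<Rightarrow> real"
  assumes f: "square_integrable (M \<Otimes>\<^sub>M time_measure t) f" and st: "s \<le> t"
  shows "square_integrable (M \<Otimes>\<^sub>M time_measure s) f"
    and "(\<integral>x. (f x)\<^sup>2 \<partial>(M \<Otimes>\<^sub>M time_measure s)) \<le> (\<integral>x. (f x)\<^sup>2 \<partial>(M \<Otimes>\<^sub>M time_measure t))"
proof -
  have m: "f \<in> borel_measurable (M \<Otimes>\<^sub>M borel)"
    using square_integrable_measurable[OF f] by (simp add: measurable_time_product)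
  have i: "integrable (M \<Otimes>\<^sub>M time_measure t) (\<lambda>x. (f x)\<^sup>2)"
    using square_integrable_norm_sq[OF f] by simp
  have le: "(\<integral>\<^sup>+x. ennreal ((f x)\<^sup>2) \<partial>(M \<Otimes>\<^sub>M time_measure s)) \<le> (\<integral>\<^sup>+x. ennreal ((f x)\<^sup>2) \<partial>(M \<Otimes>\<^sub>M time_measure t))"
    using m st by (intro nn_integral_time_product_mono) auto
  also have e: "\<dots> = ennreal (\<integral>x. (f x)\<^sup>2 \<partial>(M \<Otimes>\<^sub>M time_measure t))"
    using i by (intro nn_integral_eq_integral) auto
  also have "\<dots> < \<infinity>" by simp
  finally have fin: "(\<integral>\<^sup>+x. ennreal ((f x)\<^sup>2) \<partial>(M \<Otimes>\<^sub>M time_measure s)) < \<infinity>" .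
  show sq: "square_integrable (M \<Otimes>\<^sub>M time_measure s) f"
    unfolding square_integrable_def using m fin
    by (intro conjI integrableI_bounded) (auto simp: measurable_time_product)
  have "ennreal (\<integral>x. (f x)\<^sup>2 \<partial>(M \<Otimes>\<^sub>M time_measure s)) \<le> ennreal (\<integral>x. (f x)\<^sup>2 \<partial>(M \<Otimes>\<^sub>M time_measure t))"
    using le e square_integrable_norm_sq[OF sq] by (subst (asm) nn_integral_eq_integral) auto
  then show "(\<integral>x. (f x)\<^sup>2 \<partial>(M \<Otimes>\<^sub>M time_measure s)) \<le> (\<integral>x. (f x)\<^sup>2 \<partial>(M \<Otimes>\<^sub>M time_measure t))"
    by (subst (asm) ennreal_le_iff) auto
qed

text \<open>The time measure of the shorter interval is dominated by that of the longer one, so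
  approximations chosen for \<open>t\<close> stay approximations up to \<open>s\<close>.\<close>

lemma L2_lim_time_mono:
  fixes f :: "nat \<Rightarrow> 'a \<times> real \<Rightarrow> real"
  assumes lim: "L2_lim (M \<Otimes>\<^sub>M time_measure t) f Y" and st: "s \<le> t"
  shows "L2_lim (M \<Otimes>\<^sub>M time_measure s) f Y"
proof -
  have "L2_norm (M \<Otimes>\<^sub>M time_measure s) (\<lambda>x. f n x - Y x) \<le> L2_norm (M \<Otimes>\<^sub>M time_measure t) (\<lambda>x. f n x - Y x)" for n
    unfolding L2_norm_def
    using square_integrable_time_mono(2)[OF square_integrable_diff[OF L2_limD(1,2)[OF lim]] st] by simp
  then have "(\<lambda>n. L2_norm (M \<Otimes>\<^sub>M time_measure s) (\<lambda>x. f n x - Y x)) \<longlonglongrightarrow> 0"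
    by (intro tendsto_sandwich[OF _ _ tendsto_const L2_limD(3)[OF lim]]) auto
  then show ?thesis
    using square_integrable_time_mono(1)[OF _ st] L2_limD(1,2)[OF lim] by (simp add: L2_lim_def)
qed

text \<open>Each integration turns a monomial in time into the next one; this is the origin of the
  exponents and of the factors \<open>1 / Suc k\<close> in the moment formulas.\<close>

lemma integral_time_product_power:
  fixes f :: "'a \<times> real \<Rightarrow> real"
  assumes f: "integrable (M \<Otimes>\<^sub>M time_measure t) f" and t: "0 \<le> t"
    and m: "\<And>s. 0 < s \<Longrightarrow> s \<le> t \<Longrightarrow> (\<integral>\<omega>. f (\<omega>, s) \<partial>M) = D * s ^ k"
  shows "(\<integral>x. f x \<partial>(M \<Otimes>\<^sub>M time_measure t)) = D * t ^ Suc k / Suc k"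
proof -
  interpret P: pair_sigma_finite M "time_measure t" by (rule pair_sigma_finite_time)
  have f': "integrable (M \<Otimes>\<^sub>M time_measure t) (\<lambda>(\<omega>, s). f (\<omega>, s))" using f by simp
  have "(\<integral>x. f x \<partial>(M \<Otimes>\<^sub>M time_measure t)) = (\<integral>s. (\<integral>\<omega>. f (\<omega>, s) \<partial>M) \<partial>time_measure t)"
    using P.integral_snd[of "\<lambda>\<omega> s. f (\<omega>, s)"] f' by simp
  also have "\<dots> = (\<integral>s. D * s ^ k \<partial>time_measure t)"
  proof (rule integral_cong_AE)
    show "(\<lambda>s. \<integral>\<omega>. f (\<omega>, s) \<partial>M) \<in> borel_measurable (time_measure t)"
      using P.integrable_snd[OF f'] by (rule borel_measurable_integrable)
    show "AE s in time_measure t. (\<integral>\<omega>. f (\<omega>, s) \<partial>M) = D * s ^ k"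
      using AE_time_measure by eventually_elim (auto simp: m)
  qed simp
  also have "\<dots> = D * t ^ Suc k / Suc k"
    using integral_time_measure_power[OF t] by simp
  finally show ?thesis .
qed

end

context driven_space
begin

section \<open>Ito integrals as L2 limits of step integrals\<close>

lemma square_integrable_step_value:
  assumes S: "simple_predictable F S"
  shows "square_integrable (M \<Otimes>\<^sub>M time_measure t) (\<lambda>(\<omega>, s). step_value S s \<omega> :: real)"
proof -
  obtain K \<tau> h where Se: "S = (K, \<tau>, h)" by (cases S) auto
  have "\<exists>C. \<forall>\<omega>\<in>space M. \<bar>h k \<omega>\<bar> \<le> C" if "k < K" for k
    using simple_predictableD(3)[OF S[unfolded Se] that] by (auto simp: bounded_past_def)
  then obtain C where C: "\<And>k \<omega>. k < K \<Longrightarrow> \<omega> \<in> space M \<Longrightarrow> \<bar>h k \<omega>\<bar> \<le> C k" by metis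
  show ?thesis
  proof (rule square_integrable_bounded[OF finite_measure_time_product])
    show "(\<lambda>(\<omega>, s). step_value S s \<omega>) \<in> borel_measurable (M \<Otimes>\<^sub>M time_measure t)"
      unfolding measurable_time_product by (rule step_value_measurable[OF S subalg])
    fix x assume "x \<in> space (M \<Otimes>\<^sub>M time_measure t)"
    then have x: "fst x \<in> space M" by (auto simp: space_pair_measure)
    have "\<bar>\<Sum>k<K. indicat_real {\<tau> k<..\<tau> (Suc k)} (snd x) *\<^sub>R h k (fst x)\<bar>
        \<le> (\<Sum>k<K. \<bar>indicat_real {\<tau> k<..\<tau> (Suc k)} (snd x) *\<^sub>R h k (fst x)\<bar>)" by (rule sum_abs)
    also have "\<dots> \<le> (\<Sum>k<K. C k)"
    proof (rule sum_mono)
      fix k assume "k \<in> {..<K}"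
      then show "\<bar>indicat_real {\<tau> k<..\<tau> (Suc k)} (snd x) *\<^sub>R h k (fst x)\<bar> \<le> C k"
        using C[of k, OF _ x] by (auto simp: indicator_def intro: order_trans[OF abs_ge_zero])
    qed
    finally show "\<bar>case x of (\<omega>, s) \<Rightarrow> step_value S s \<omega>\<bar> \<le> (\<Sum>k<K. C k)"
      by (simp add: Se step_value_def split_beta')
  qed
qed

lemma ito_approx:
  fixes Y :: "real \<Rightarrow> 'a \<Rightarrow> real"
  assumes a: "a \<in> B" and Y: "cadlag_process M Y" and X: "ito_integral M F (Z a) (left_limit Y) X" and t: "0 \<le> t"
  obtains S where "\<And>m. simple_predictable F (S m)"
    "L2_lim (M \<Otimes>\<^sub>M time_measure t) (\<lambda>m (\<omega>, s). step_value (S m) s \<omega>) (\<lambda>(\<omega>, s). Y (max 0 s) \<omega>)"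
    "L2_lim M (\<lambda>m. step_integral (Z a) (S m) t) (X t)"
proof -
  obtain S where S: "\<And>m. simple_predictable F (S m)"
    and 1: "(\<lambda>m. L2_dist2 (M \<Otimes>\<^sub>M time_measure t) (\<lambda>(\<omega>, s). Y (max 0 s) \<omega>) (\<lambda>(\<omega>, s). step_value (S m) s \<omega>)) \<longlonglongrightarrow> 0"
    and 2: "(\<lambda>m. L2_dist2 M (X t) (step_integral (Z a) (S m) t)) \<longlonglongrightarrow> 0"
    using ito_integral_cadlag(2)[OF Y X t subalg] by blast
  have "L2_lim (M \<Otimes>\<^sub>M time_measure t) (\<lambda>m (\<omega>, s). step_value (S m) s \<omega>) (\<lambda>(\<omega>, s). Y (max 0 s) \<omega>)"
    by (rule L2_limI_dist2[OF square_integrable_step_value[OF S] _ 1])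
       (simp add: measurable_time_product cadlag_joint_measurable[OF Y])
  moreover have "L2_lim M (\<lambda>m. step_integral (Z a) (S m) t) (X t)"
    by (rule L2_limI_dist2[OF known_at_sq[OF known_step_integral[OF a S t]] ito_integral_cadlag(1)[OF Y X t subalg] 2])
  ultimately show ?thesis using S that by blast
qed

lemma ito_known:
  fixes Y :: "real \<Rightarrow> 'a \<Rightarrow> real"
  assumes "a \<in> B" "cadlag_process M Y" "ito_integral M F (Z a) (left_limit Y) X" "0 \<le> t"
  shows "known_at t (X t)"
  by (rule ito_approx[OF assms]) (rule known_at_lim[OF _ known_step_integral[OF assms(1) _ assms(4)]])

text \<open>This is not the martingale property at \<open>s = 0\<close>, which concerns
  \<open>X t - X 0\<close>. It is obtained from the step integrals, which vanish at time 0 since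
  their grid points are nonnegative.\<close>

lemma ito_orth_initial:
  fixes Y :: "real \<Rightarrow> 'a \<Rightarrow> real"
  assumes "a \<in> B" "cadlag_process M Y" "ito_integral M F (Z a) (left_limit Y) X" "0 \<le> t"
  shows "orth_past 0 (X t)"
proof (rule ito_approx[OF assms])
  fix S assume S: "\<And>m. simple_predictable F (S m)" and lim: "L2_lim M (\<lambda>m. step_integral (Z a) (S m) t) (X t)"
  have "step_integral (Z a) (S m) 0 \<omega> = 0" for m \<omega>
  proof -
    obtain K \<tau> h where Se: "S m = (K, \<tau>, h)" by (cases "S m") auto
    note S' = simple_predictableD[OF S[of m, unfolded Se]]
    have "min 0 (\<tau> k) = 0" "min 0 (\<tau> (Suc k)) = 0" if "k < K" for k
      using S'(1,2)[OF that] by auto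
    then show ?thesis by (simp add: Se step_integral_def)
  qed
  then have "orth_past 0 (step_integral (Z a) (S m) t)" for m
    using orth_step_integral[OF assms(1) S, of 0 t m] assms(4) by simp
  then show ?thesis by (rule orth_past_lim[OF lim])
qed

text \<open>Expansion of the square, with the polarised isometry of weight 1 applied to each
  term.\<close>

lemma step_integral_isometry:
  assumes a: "a \<in> B" and S: "simple_predictable F S" and R: "simple_predictable F R" and t: "0 \<le> t"
  shows "(L2_norm M (\<lambda>\<omega>. step_integral (Z a) S t \<omega> - step_integral (Z a) R t \<omega>))\<^sup>2
    = c a a * (L2_norm (M \<Otimes>\<^sub>M time_measure t) (\<lambda>x. (case x of (\<omega>, s) \<Rightarrow> step_value S s \<omega>)
        - (case x of (\<omega>, s) \<Rightarrow> (step_value R s \<omega> :: real))))\<^sup>2"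
proof -
  let ?s = "step_integral (Z a) S t" and ?r = "step_integral (Z a) R t"
  let ?N = "M \<Otimes>\<^sub>M time_measure t"
  let ?S = "\<lambda>(\<omega>, s). step_value S s \<omega> :: real" and ?R = "\<lambda>(\<omega>, s). step_value R s \<omega> :: real"
  have i: "integrable M (\<lambda>\<omega>. ?s \<omega> * ?s \<omega>)" "integrable M (\<lambda>\<omega>. ?s \<omega> * ?r \<omega>)" "integrable M (\<lambda>\<omega>. ?r \<omega> * ?r \<omega>)"
    using known_step_integral[OF a S t] known_step_integral[OF a R t]
    by (auto intro!: square_integrable_mult known_at_sq)
  have j: "integrable ?N (\<lambda>x. ?S x * ?S x)" "integrable ?N (\<lambda>x. ?S x * ?R x)" "integrable ?N (\<lambda>x. ?R x * ?R x)"
    by (intro square_integrable_mult square_integrable_step_value S R)+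
  note cv = step_integral_cov[OF a a _ _ t, of _ _ "\<lambda>_. 1", simplified]
  have "(L2_norm M (\<lambda>\<omega>. ?s \<omega> - ?r \<omega>))\<^sup>2 = (\<integral>\<omega>. ?s \<omega> * ?s \<omega> - 2 * (?s \<omega> * ?r \<omega>) + ?r \<omega> * ?r \<omega> \<partial>M)"
    unfolding L2_norm_sq by (intro Bochner_Integration.integral_cong) (auto simp: power2_eq_square algebra_simps)
  also have "\<dots> = (\<integral>\<omega>. ?s \<omega> * ?s \<omega> \<partial>M) - 2 * (\<integral>\<omega>. ?s \<omega> * ?r \<omega> \<partial>M) + (\<integral>\<omega>. ?r \<omega> * ?r \<omega> \<partial>M)"
    using i by simp
  also have "\<dots> = c a a * ((\<integral>x. ?S x * ?S x \<partial>?N) - 2 * (\<integral>x. ?S x * ?R x \<partial>?N) + (\<integral>x. ?R x * ?R x \<partial>?N))"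
    unfolding cv[OF S S] cv[OF S R] cv[OF R R] by (simp add: algebra_simps split_beta')
  also have "(\<integral>x. ?S x * ?S x \<partial>?N) - 2 * (\<integral>x. ?S x * ?R x \<partial>?N) + (\<integral>x. ?R x * ?R x \<partial>?N)
     = (\<integral>x. ?S x * ?S x - 2 * (?S x * ?R x) + ?R x * ?R x \<partial>?N)"
    using j by simp
  also have "\<dots> = (L2_norm ?N (\<lambda>x. ?S x - ?R x))\<^sup>2"
    unfolding L2_norm_sq by (intro Bochner_Integration.integral_cong) (auto simp: power2_eq_square algebra_simps)
  finally show ?thesis .
qed

text \<open>The definition provides separate approximations for each time, whereas an increment
  needs one sequence for both ends. The isometry compares the two sequences on the shorter interval,
  where they have the same integrand as limit.\<close>

lemma ito_orth:
  fixes Y :: "real \<Rightarrow> 'a \<Rightarrow> real"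
  assumes a: "a \<in> B" and Y: "cadlag_process M Y" and X: "ito_integral M F (Z a) (left_limit Y) X"
    and s: "0 \<le> s" "s \<le> t"
  shows "orth_past s (\<lambda>\<omega>. X t \<omega> - X s \<omega>)"
proof -
  let ?Y = "\<lambda>(\<omega>, s). Y (max 0 s) \<omega>"
  have t: "0 \<le> t" using s by simp
  obtain S where S: "\<And>m. simple_predictable F (S m)"
    and S1: "L2_lim (M \<Otimes>\<^sub>M time_measure t) (\<lambda>m (\<omega>, s). step_value (S m) s \<omega>) ?Y"
    and S2: "L2_lim M (\<lambda>m. step_integral (Z a) (S m) t) (X t)"
    by (rule ito_approx[OF a Y X t]) blast
  obtain R where R: "\<And>m. simple_predictable F (R m)"
    and R1: "L2_lim (M \<Otimes>\<^sub>M time_measure s) (\<lambda>m (\<omega>, s). step_value (R m) s \<omega>) ?Y"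
    and R2: "L2_lim M (\<lambda>m. step_integral (Z a) (R m) s) (X s)"
    by (rule ito_approx[OF a Y X s(1)]) blast
  have sqS: "square_integrable M (step_integral (Z a) (S m) s)" for m
    by (rule known_at_sq[OF known_step_integral[OF a S s(1)]])
  \<comment> \<open>the approximations chosen for time \<open>t\<close> also work at the earlier time \<open>s\<close>\<close>
  have "(\<lambda>m. (L2_norm M (\<lambda>\<omega>. step_integral (Z a) (S m) s \<omega> - step_integral (Z a) (R m) s \<omega>))\<^sup>2) \<longlonglongrightarrow> 0"
    unfolding step_integral_isometry[OF a S R s(1)]
    using tendsto_mult[OF tendsto_const L2_lim_norm_diff[OF L2_lim_time_mono[OF S1 s(2)] R1], of "c a a"]
    by (simp add: L2_norm_def)
  from tendsto_real_sqrt[OF this]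
  have d: "(\<lambda>m. L2_norm M (\<lambda>\<omega>. step_integral (Z a) (S m) s \<omega> - step_integral (Z a) (R m) s \<omega>)) \<longlonglongrightarrow> 0"
    by simp
  have "(\<lambda>m. L2_norm M (\<lambda>\<omega>. step_integral (Z a) (S m) s \<omega> - X s \<omega>)) \<longlonglongrightarrow> 0"
  proof (rule tendsto_sandwich[OF _ _ tendsto_const])
    show "(\<lambda>m. L2_norm M (\<lambda>\<omega>. step_integral (Z a) (S m) s \<omega> - step_integral (Z a) (R m) s \<omega>)
       + L2_norm M (\<lambda>\<omega>. step_integral (Z a) (R m) s \<omega> - X s \<omega>)) \<longlonglongrightarrow> 0"
      using tendsto_add[OF d L2_limD(3)[OF R2]] by simp
  qed (auto intro!: always_eventually L2_norm_triangle_diff sqS L2_limD(1,2)[OF R2])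
  then have "L2_lim M (\<lambda>m. step_integral (Z a) (S m) s) (X s)"
    using sqS L2_limD(2)[OF R2] by (simp add: L2_lim_def)
  then show ?thesis
    by (rule orth_past_lim[OF L2_lim_diff[OF S2] orth_step_integral[OF a S s]])
qed

text \<open>Both sides of the step formula are continuous in L2, the left one over the sample space
  and the right one over its product with time.\<close>

lemma ito_cov:
  fixes Y Y' :: "real \<Rightarrow> 'a \<Rightarrow> real"
  assumes a: "a \<in> B" and Y: "cadlag_process M Y" and X: "ito_integral M F (Z a) (left_limit Y) X"
    and b: "b \<in> B" and Y': "cadlag_process M Y'" and X': "ito_integral M F (Z b) (left_limit Y') X'"
    and t: "0 \<le> t" and g: "bounded_past 0 g"
  shows "(\<integral>\<omega>. g \<omega> * (X t \<omega> * X' t \<omega>) \<partial>M)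
    = c a b * (\<integral>(\<omega>, s). g \<omega> * (Y (max 0 s) \<omega> * Y' (max 0 s) \<omega>) \<partial>(M \<Otimes>\<^sub>M time_measure t))"
proof -
  let ?N = "M \<Otimes>\<^sub>M time_measure t"
  let ?Y = "\<lambda>(\<omega>, s). Y (max 0 s) \<omega>" and ?Y' = "\<lambda>(\<omega>, s). Y' (max 0 s) \<omega>"
  obtain S where S: "\<And>m. simple_predictable F (S m)"
    and S1: "L2_lim ?N (\<lambda>m (\<omega>, s). step_value (S m) s \<omega>) ?Y"
    and S2: "L2_lim M (\<lambda>m. step_integral (Z a) (S m) t) (X t)"
    by (rule ito_approx[OF a Y X t]) blast
  obtain R where R: "\<And>m. simple_predictable F (R m)"
    and R1: "L2_lim ?N (\<lambda>m (\<omega>, s). step_value (R m) s \<omega>) ?Y'"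
    and R2: "L2_lim M (\<lambda>m. step_integral (Z b) (R m) t) (X' t)"
    by (rule ito_approx[OF b Y' X' t]) blast
  obtain C where C: "\<And>\<omega>. \<omega> \<in> space M \<Longrightarrow> \<bar>g \<omega>\<bar> \<le> C" using g by (auto simp: bounded_past_def)
  have gN: "(\<lambda>x. g (fst x)) \<in> borel_measurable ?N" using bounded_past_measurable[OF g] by measurable
  have "(\<lambda>m. \<integral>\<omega>. (g \<omega> * step_integral (Z a) (S m) t \<omega>) * step_integral (Z b) (R m) t \<omega> \<partial>M)
    \<longlonglongrightarrow> (\<integral>\<omega>. (g \<omega> * X t \<omega>) * X' t \<omega> \<partial>M)"
    by (rule L2_lim_mult[OF L2_lim_bounded_past_mult[OF g S2] R2])
  then have 1: "(\<lambda>m. c a b * (\<integral>(\<omega>, s). g \<omega> * (step_value (S m) s \<omega> * step_value (R m) s \<omega>) \<partial>?N))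
    \<longlonglongrightarrow> (\<integral>\<omega>. g \<omega> * (X t \<omega> * X' t \<omega>) \<partial>M)"
    unfolding step_integral_cov[OF a b S R t g, symmetric] by (simp add: mult.assoc)
  have "(\<lambda>m. \<integral>x. (g (fst x) *\<^sub>R (case x of (\<omega>, s) \<Rightarrow> step_value (S m) s \<omega>)) * (case x of (\<omega>, s) \<Rightarrow> step_value (R m) s \<omega>) \<partial>?N)
    \<longlonglongrightarrow> (\<integral>x. (g (fst x) *\<^sub>R ?Y x) * ?Y' x \<partial>?N)"
    by (rule L2_lim_mult[OF L2_lim_bounded_scaleR[OF S1 gN] R1, of C]) (auto simp: space_pair_measure intro: C)
  then have "(\<lambda>m. \<integral>(\<omega>, s). g \<omega> * (step_value (S m) s \<omega> * step_value (R m) s \<omega>) \<partial>?N)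
    \<longlonglongrightarrow> (\<integral>(\<omega>, s). g \<omega> * (Y (max 0 s) \<omega> * Y' (max 0 s) \<omega>) \<partial>?N)"
    by (simp add: split_beta' mult.assoc)
  from tendsto_mult[OF tendsto_const this, of "c a b"]
  show ?thesis by (rule LIMSEQ_unique[OF 1])
qed

end

section \<open>Second moments of iterated integrals\<close>

lemma square_integrable_cong_AE:
  fixes X Y :: "'a \<Rightarrow> real"
  assumes X: "X \<in> borel_measurable M" and Y: "square_integrable M Y" and e: "AE \<omega> in M. X \<omega> = Y \<omega>"
  shows "square_integrable M X" "(\<integral>\<omega>. (X \<omega>)\<^sup>2 \<partial>M) = (\<integral>\<omega>. (Y \<omega>)\<^sup>2 \<partial>M)"
proof -
  note [measurable] = X square_integrable_measurable[OF Y]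
  have "integrable M (\<lambda>\<omega>. (norm (X \<omega>))\<^sup>2) \<longleftrightarrow> integrable M (\<lambda>\<omega>. (norm (Y \<omega>))\<^sup>2)"
    using e by (intro integrable_cong_AE) auto
  then show "square_integrable M X" using Y X by (simp add: square_integrable_def)
  show "(\<integral>\<omega>. (X \<omega>)\<^sup>2 \<partial>M) = (\<integral>\<omega>. (Y \<omega>)\<^sup>2 \<partial>M)"
    using e by (intro integral_cong_AE) auto
qed

lemma square_integral_time_measure_le:
  fixes f :: "real \<Rightarrow> real"
  assumes f: "square_integrable (time_measure t) f" and t: "0 \<le> t"
  shows "(\<integral>s. f s \<partial>time_measure t)\<^sup>2 \<le> t * (\<integral>s. (f s)\<^sup>2 \<partial>time_measure t)"
proof -
  have 1: "square_integrable (time_measure t) (\<lambda>_. 1::real)"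
    by (rule square_integrable_bounded[OF finite_measure_time_measure, of _ _ 1]) auto
  have m: "measure (time_measure t) UNIV = t"
    using emeasure_time_measure[OF t] t by (simp add: measure_def)
  have "\<bar>\<integral>s. f s \<partial>time_measure t\<bar> \<le> L2_norm (time_measure t) f * L2_norm (time_measure t) (\<lambda>_. 1::real)"
    using L2_norm_Cauchy_Schwarz[OF f 1] by simp
  then have "\<bar>\<integral>s. f s \<partial>time_measure t\<bar>\<^sup>2 \<le> (L2_norm (time_measure t) f * L2_norm (time_measure t) (\<lambda>_. 1::real))\<^sup>2"
    by (rule power_mono) simp
  then show ?thesis by (simp add: power_mult_distrib L2_norm_sq m mult.commute)
qed

text \<open>Integration by parts: the product is an integral over a square, which is cut along the
  diagonal.\<close>

lemma time_integral_product:
  fixes p q :: "real \<Rightarrow> real"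
  assumes p: "integrable (time_measure t) p" and q: "integrable (time_measure t) q"
  defines "P \<equiv> (\<lambda>f s. \<integral>r. indicat_real {..s} r * f r \<partial>time_measure t)"
  shows "(\<integral>s. p s \<partial>time_measure t) * (\<integral>s. q s \<partial>time_measure t)
    = (\<integral>s. p s * P q s \<partial>time_measure t) + (\<integral>s. q s * P p s \<partial>time_measure t)"
proof -
  interpret U: finite_measure "time_measure t" by (rule finite_measure_time_measure)
  interpret pair_sigma_finite "time_measure t" "time_measure t" ..
  let ?N = "time_measure t \<Otimes>\<^sub>M time_measure t"
  have [measurable]: "p \<in> borel_measurable borel" "q \<in> borel_measurable borel"
    using borel_measurable_integrable[OF p] borel_measurable_integrable[OF q] by auto
  note pq = integral_pair_mult[OF U.sigma_finite_measure_axioms U.sigma_finite_measure_axioms p q]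
  have i1: "integrable ?N (\<lambda>(r, s). indicat_real {..r} s * (p r * q s))"
    by (rule Bochner_Integration.integrable_bound[OF pq(1)])
       (auto simp: indicator_def split_beta')
  have i2: "integrable ?N (\<lambda>(r, s). indicat_real {..<s} r * (p r * q s))"
    by (rule Bochner_Integration.integrable_bound[OF pq(1)])
       (auto simp: indicator_def split_beta')
  have "(\<integral>s. p s \<partial>time_measure t) * (\<integral>s. q s \<partial>time_measure t) = (\<integral>(r, s). p r * q s \<partial>?N)"
    using pq(2) by simp
  \<comment> \<open>The closed half \<open>s \<le> r\<close> and the open half \<open>r < s\<close>
    partition the square without counting the diagonal twice.\<close>
  also have "\<dots> = (\<integral>x. (case x of (r, s) \<Rightarrow> indicat_real {..r} s * (p r * q s))
      + (case x of (r, s) \<Rightarrow> indicat_real {..<s} r * (p r * q s)) \<partial>?N)"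
    by (intro Bochner_Integration.integral_cong) (auto simp: indicator_def)
  also have "\<dots> = (\<integral>(r, s). indicat_real {..r} s * (p r * q s) \<partial>?N)
      + (\<integral>(r, s). indicat_real {..<s} r * (p r * q s) \<partial>?N)"
    by (rule Bochner_Integration.integral_add[OF i1 i2])
  also have "(\<integral>(r, s). indicat_real {..r} s * (p r * q s) \<partial>?N) = (\<integral>r. p r * P q r \<partial>time_measure t)"
    unfolding integral_fst[OF i1, symmetric] P_def
    by (simp add: mult.left_commute[of _ "p _"])
  also have "(\<integral>(r, s). indicat_real {..<s} r * (p r * q s) \<partial>?N) = (\<integral>s. q s * P p s \<partial>time_measure t)"
  proof -
    have "(\<integral>r. indicat_real {..<s} r * (p r * q s) \<partial>time_measure t) = q s * P p s" for s
    proof -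
      have "(\<integral>r. indicat_real {..<s} r * (p r * q s) \<partial>time_measure t)
         = (\<integral>r. q s * (indicat_real {..s} r * p r) \<partial>time_measure t)"
      proof (rule integral_cong_AE)
        \<comment> \<open>The diagonal is null, so that the open half may be closed and both terms
          take the form \<open>P\<close>.\<close>
        have "AE r in time_measure t. r \<noteq> s"
          unfolding time_measure_def using AE_lborel_singleton[of s]
          by (subst AE_density) (auto elim: eventually_mono)
        then show "AE r in time_measure t. indicat_real {..<s} r * (p r * q s) = q s * (indicat_real {..s} r * p r)"
          by eventually_elim (auto simp: indicator_def)
      qed measurable
      then show ?thesis by (simp add: P_def)
    qed
    then show ?thesis unfolding integral_snd[OF i2, symmetric] by simp
  qed
  finally show ?thesis .
qed

context filtered_prob_space
begin

text \<open>Cauchy-Schwarz in time along almost every path, followed by integration over the sample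
  space.\<close>

lemma time_integral_square:
  fixes Y X :: "real \<Rightarrow> 'a \<Rightarrow> real"
  assumes Y: "cadlag_process M Y" and X: "time_integral M (left_limit Y) X" and t: "0 \<le> t"
    and sq: "square_integrable (M \<Otimes>\<^sub>M time_measure t) (\<lambda>(\<omega>, s). Y (max 0 s) \<omega>)"
  shows "square_integrable M (X t)"
    and "(\<integral>\<omega>. (X t \<omega>)\<^sup>2 \<partial>M) \<le> t * (\<integral>(\<omega>, s). (Y (max 0 s) \<omega>)\<^sup>2 \<partial>(M \<Otimes>\<^sub>M time_measure t))"
proof -
  interpret P: pair_sigma_finite M "time_measure t" by (rule pair_sigma_finite_time)
  have i: "integrable (M \<Otimes>\<^sub>M time_measure t) (\<lambda>(\<omega>, s). (Y (max 0 s) \<omega>)\<^sup>2)"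
    using square_integrable_norm_sq[OF sq] by (simp add: split_beta')
  have AE1: "AE \<omega> in M. integrable (time_measure t) (\<lambda>s. (Y (max 0 s) \<omega>)\<^sup>2)"
    by (rule P.AE_integrable_fst[OF i])
  have le: "AE \<omega> in M. (X t \<omega>)\<^sup>2 \<le> t * (\<integral>s. (Y (max 0 s) \<omega>)\<^sup>2 \<partial>time_measure t)"
    using AE1 time_integral_cadlag(2)[OF Y X t] AE_space
  proof eventually_elim
    fix \<omega> assume "integrable (time_measure t) (\<lambda>s. (Y (max 0 s) \<omega>)\<^sup>2)"
      and e: "X t \<omega> = (\<integral>s. Y (max 0 s) \<omega> \<partial>time_measure t)" and \<omega>: "\<omega> \<in> space M"
    then have "square_integrable (time_measure t) (\<lambda>s. Y (max 0 s) \<omega>)"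
      using cadlag_path_measurable[OF Y \<omega>] by (simp add: square_integrable_def)
    from square_integral_time_measure_le[OF this t]
    show "(X t \<omega>)\<^sup>2 \<le> t * (\<integral>s. (Y (max 0 s) \<omega>)\<^sup>2 \<partial>time_measure t)" by (simp add: e)
  qed
  have XM: "X t \<in> borel_measurable M" by (rule time_integral_cadlag(1)[OF Y X t])
  have j: "integrable M (\<lambda>\<omega>. t * (\<integral>s. (Y (max 0 s) \<omega>)\<^sup>2 \<partial>time_measure t))"
    using P.integrable_fst[OF i] by simp
  have k: "integrable M (\<lambda>\<omega>. (X t \<omega>)\<^sup>2)"
    by (rule Bochner_Integration.integrable_bound[OF j]) (use XM le t in auto)
  then show "square_integrable M (X t)" using XM by (simp add: square_integrable_def)
  have "(\<integral>\<omega>. (X t \<omega>)\<^sup>2 \<partial>M) \<le> (\<integral>\<omega>. t * (\<integral>s. (Y (max 0 s) \<omega>)\<^sup>2 \<partial>time_measure t) \<partial>M)"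
    by (rule integral_mono_AE[OF k j le])
  also have "\<dots> = t * (\<integral>(\<omega>, s). (Y (max 0 s) \<omega>)\<^sup>2 \<partial>(M \<Otimes>\<^sub>M time_measure t))"
    using P.integral_fst[OF i] by simp
  finally show "(\<integral>\<omega>. (X t \<omega>)\<^sup>2 \<partial>M) \<le> t * (\<integral>(\<omega>, s). (Y (max 0 s) \<omega>)\<^sup>2 \<partial>(M \<Otimes>\<^sub>M time_measure t))" .
qed

lemma time_integral_pairing:
  fixes Y X :: "real \<Rightarrow> 'a \<Rightarrow> real"
  assumes Y: "cadlag_process M Y" and X: "time_integral M (left_limit Y) X" and t: "0 \<le> t"
    and sq: "square_integrable (M \<Otimes>\<^sub>M time_measure t) (\<lambda>(\<omega>, s). Y (max 0 s) \<omega>)"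
    and V: "square_integrable M V"
    and m: "\<And>s. 0 < s \<Longrightarrow> s \<le> t \<Longrightarrow> (\<integral>\<omega>. V \<omega> * Y s \<omega> \<partial>M) = D * s ^ k"
  shows "(\<integral>\<omega>. V \<omega> * X t \<omega> \<partial>M) = D * t ^ Suc k / Suc k"
proof -
  interpret P: pair_sigma_finite M "time_measure t" by (rule pair_sigma_finite_time)
  have i: "integrable (M \<Otimes>\<^sub>M time_measure t) (\<lambda>(\<omega>, s). V \<omega> * Y (max 0 s) \<omega>)"
    using square_integrable_mult[OF square_integrable_fst_time[OF V] sq] by (simp add: split_beta')
  have "(\<integral>\<omega>. V \<omega> * X t \<omega> \<partial>M) = (\<integral>\<omega>. (\<integral>s. V \<omega> * Y (max 0 s) \<omega> \<partial>time_measure t) \<partial>M)"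
  proof (rule integral_cong_AE)
    show "(\<lambda>\<omega>. V \<omega> * X t \<omega>) \<in> borel_measurable M"
      using square_integrable_measurable[OF V] time_integral_cadlag(1)[OF Y X t] by measurable
    show "(\<lambda>\<omega>. \<integral>s. V \<omega> * Y (max 0 s) \<omega> \<partial>time_measure t) \<in> borel_measurable M"
      using P.integrable_fst[OF i] by (rule borel_measurable_integrable)
    show "AE \<omega> in M. V \<omega> * X t \<omega> = (\<integral>s. V \<omega> * Y (max 0 s) \<omega> \<partial>time_measure t)"
      using time_integral_cadlag(2)[OF Y X t] by eventually_elim simp
  qed
  also have "\<dots> = (\<integral>(\<omega>, s). V \<omega> * Y (max 0 s) \<omega> \<partial>(M \<Otimes>\<^sub>M time_measure t))"
    by (rule P.integral_fst[OF i])
  also have "\<dots> = D * t ^ Suc k / Suc k"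
    by (rule integral_time_product_power[OF i t]) (simp add: m)
  finally show ?thesis .
qed

lemma time_integral_known:
  fixes Y X :: "real \<Rightarrow> 'a \<Rightarrow> real"
  assumes Y: "cadlag_process M Y" and X: "time_integral M (left_limit Y) X" and t: "0 \<le> t"
    and sq: "square_integrable (M \<Otimes>\<^sub>M time_measure t) (\<lambda>(\<omega>, s). Y (max 0 s) \<omega>)"
    and kn: "\<And>s. 0 \<le> s \<Longrightarrow> known_at s (Y s)"
  shows "known_at t (X t)"
proof -
  have "(\<integral>\<omega>. X t \<omega> * V \<omega> \<partial>M) = 0" if V: "orth_past t V" for V
  proof -
    \<comment> \<open>The vanishing pairing is written as a monomial with constant 0, the form that
      the pairing lemma asks for.\<close>
    have "(\<integral>\<omega>. V \<omega> * Y s \<omega> \<partial>M) = 0 * s ^ 0" if "0 < s" "s \<le> t" for s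
      using known_orth[OF known_at_mono[OF kn] V, of s] that by (simp add: mult.commute)
    from time_integral_pairing[OF Y X t sq orth_past_sq[OF V] this] show ?thesis
      by (simp add: mult.commute)
  qed
  then show ?thesis using time_integral_square(1)[OF Y X t sq] by (simp add: known_at_def)
qed

text \<open>The product rule in integrated form: \<open>X X'\<close> is the time integral of
  \<open>Y X' + X Y'\<close>, so the two monomial moments of lower degree determine the new
  one.\<close>

lemma time_integral_pairing2:
  fixes Y X Y' X' :: "real \<Rightarrow> 'a \<Rightarrow> real"
  assumes Y: "cadlag_process M Y" and X: "time_integral M (left_limit Y) X"
    and Y': "cadlag_process M Y'" and X': "time_integral M (left_limit Y') X'" and t: "0 \<le> t"
    and sq: "square_integrable (M \<Otimes>\<^sub>M time_measure t) (\<lambda>(\<omega>, s). Y (max 0 s) \<omega>)"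
    and sq': "square_integrable (M \<Otimes>\<^sub>M time_measure t) (\<lambda>(\<omega>, s). Y' (max 0 s) \<omega>)"
    and g: "bounded_past r g"
    and m: "\<And>s. 0 < s \<Longrightarrow> s \<le> t \<Longrightarrow> (\<integral>\<omega>. g \<omega> * (Y s \<omega> * X' s \<omega>) \<partial>M) = D * s ^ k"
    and m': "\<And>s. 0 < s \<Longrightarrow> s \<le> t \<Longrightarrow> (\<integral>\<omega>. g \<omega> * (X s \<omega> * Y' s \<omega>) \<partial>M) = D' * s ^ k"
  shows "(\<integral>\<omega>. g \<omega> * (X t \<omega> * X' t \<omega>) \<partial>M) = (D + D') * t ^ Suc k / Suc k"
proof -
  interpret U: finite_measure "time_measure t" by (rule finite_measure_time_measure)
  interpret P: pair_sigma_finite M "time_measure t" by (rule pair_sigma_finite_time)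
  let ?N = "M \<Otimes>\<^sub>M time_measure t"
  \<comment> \<open>\<open>X\<close> and \<open>X'\<close> agree with the running integrals only
    almost surely at each single time. \<open>Q f\<close> is a version that is jointly measurable in
    sample point and time, as Fubini requires.\<close>
  define Q where "Q f x = (\<integral>r. indicat_real {..snd x} r * f (max 0 r) (fst x) \<partial>time_measure t)"
    for f :: "real \<Rightarrow> 'a \<Rightarrow> real" and x :: "'a \<times> real"
  have Q_eq: "AE \<omega> in M. Q f (\<omega>, s) = G s \<omega>" if f: "cadlag_process M f" and G: "time_integral M (left_limit f) G"
    and s: "0 < s" "s \<le> t" for f G s
    using time_integral_cadlag(2)[OF f G less_imp_le[OF s(1)]] AE_space
  proof eventually_elim
    fix \<omega> assume e: "G s \<omega> = (\<integral>r. f (max 0 r) \<omega> \<partial>time_measure s)" and \<omega>: "\<omega> \<in> space M"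
    note [measurable] = cadlag_path_measurable[OF f \<omega>]
    have "Q f (\<omega>, s) = (\<integral>r. indicat_real {0<..t} r * (indicat_real {..s} r * f (max 0 r) \<omega>) \<partial>lborel)"
      unfolding Q_def fst_conv snd_conv by (rule integral_time_measure) measurable
    also have "\<dots> = (\<integral>r. indicat_real {0<..s} r * f (max 0 r) \<omega> \<partial>lborel)"
      using s by (intro Bochner_Integration.integral_cong) (auto simp: indicator_def)
    also have "\<dots> = G s \<omega>" unfolding e by (rule integral_time_measure[symmetric]) measurable
    finally show "Q f (\<omega>, s) = G s \<omega>" .
  qed
  have Q_meas: "Q f \<in> borel_measurable (M \<Otimes>\<^sub>M borel)" if f: "cadlag_process M f" for f
  proof -
    have *: "(\<lambda>y. f (max 0 (snd y)) (fst (fst y))) \<in> borel_measurable ((M \<Otimes>\<^sub>M (borel :: real measure)) \<Otimes>\<^sub>M borel)"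
    proof -
      have "(\<lambda>y. (fst (fst y), snd y)) \<in> (M \<Otimes>\<^sub>M (borel :: real measure)) \<Otimes>\<^sub>M borel \<rightarrow>\<^sub>M M \<Otimes>\<^sub>M (borel :: real measure)"
        by measurable
      from measurable_compose[OF this cadlag_joint_measurable[OF f]] show ?thesis by simp
    qed
    have "(\<lambda>(x, r). indicat_real {..snd x} r * f (max 0 r) (fst x)) \<in> borel_measurable ((M \<Otimes>\<^sub>M borel) \<Otimes>\<^sub>M borel)"
    proof -
      have "(\<lambda>y. if snd y \<le> snd (fst y) then f (max 0 (snd y)) (fst (fst y)) else 0)
         \<in> borel_measurable ((M \<Otimes>\<^sub>M (borel :: real measure)) \<Otimes>\<^sub>M borel)"
        using * by measurable
      also have "(\<lambda>y. if snd y \<le> snd (fst y) then f (max 0 (snd y)) (fst (fst y)) else 0)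
         = (\<lambda>(x, r). indicat_real {..snd x} r * f (max 0 r) (fst x))"
        by (auto simp: fun_eq_iff)
      finally show ?thesis .
    qed
    then have "(\<lambda>(x, r). indicat_real {..snd x} r * f (max 0 r) (fst x)) \<in> borel_measurable ((M \<Otimes>\<^sub>M borel) \<Otimes>\<^sub>M time_measure t)"
      by (simp cong: measurable_cong_sets sets_pair_measure_cong)
    from U.borel_measurable_lebesgue_integral[OF this] show ?thesis unfolding Q_def .
  qed
  have Q_sec: "(\<lambda>\<omega>. Q f (\<omega>, s)) \<in> borel_measurable M" if "cadlag_process M f" for f s
    using measurable_compose[OF _ Q_meas[OF that], of "\<lambda>\<omega>. (\<omega>, s)"] by simp
  \<comment> \<open>The Cauchy-Schwarz estimate at each \<open>s \<le> t\<close> gives second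
    moments bounded uniformly in \<open>s\<close>.\<close>
  have Q_sq: "square_integrable ?N (Q f)" if f: "cadlag_process M f" and G: "time_integral M (left_limit f) G"
    and sqf: "square_integrable ?N (\<lambda>(\<omega>, s). f (max 0 s) \<omega>)" for f G
  proof (rule square_integrable_time_product[OF Q_meas[OF f]])
    fix s assume s: "0 < s" "s \<le> t"
    have sqs: "square_integrable (M \<Otimes>\<^sub>M time_measure s) (\<lambda>(\<omega>, s). f (max 0 s) \<omega>)"
      by (rule square_integrable_time_mono(1)[OF sqf s(2)])
    have le1: "(\<integral>(\<omega>, s). (f (max 0 s) \<omega>)\<^sup>2 \<partial>(M \<Otimes>\<^sub>M time_measure s)) \<le> (\<integral>(\<omega>, s). (f (max 0 s) \<omega>)\<^sup>2 \<partial>?N)"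
      using square_integrable_time_mono(2)[OF sqf s(2)] by (simp add: split_beta')
    note ts = time_integral_square[OF f G less_imp_le[OF s(1)] sqs]
    note sc = square_integrable_cong_AE[OF Q_sec[OF f] ts(1) Q_eq[OF f G s]]
    have "(\<integral>\<omega>. (Q f (\<omega>, s))\<^sup>2 \<partial>M) \<le> s * (\<integral>(\<omega>, s). (f (max 0 s) \<omega>)\<^sup>2 \<partial>(M \<Otimes>\<^sub>M time_measure s))"
      using ts(2) sc(2) by simp
    also have "\<dots> \<le> t * (\<integral>(\<omega>, s). (f (max 0 s) \<omega>)\<^sup>2 \<partial>?N)"
      using s le1 by (intro mult_mono) (auto intro!: integral_nonneg_AE)
    finally show "square_integrable M (\<lambda>\<omega>. Q f (\<omega>, s)) \<and>
       (\<integral>\<omega>. (Q f (\<omega>, s))\<^sup>2 \<partial>M) \<le> t * (\<integral>(\<omega>, s). (f (max 0 s) \<omega>)\<^sup>2 \<partial>?N)"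
      using sc(1) by simp
  qed
  obtain C where C: "\<And>\<omega>. \<omega> \<in> space M \<Longrightarrow> \<bar>g \<omega>\<bar> \<le> C" using g by (auto simp: bounded_past_def)
  have gN: "(\<lambda>x. g (fst x)) \<in> borel_measurable ?N" using bounded_past_measurable[OF g] by measurable
  have gsq: "square_integrable ?N (\<lambda>x. g (fst x) * f x)" if "square_integrable ?N f" for f
    by (rule square_integrable_bounded_mult[OF that gN, of C]) (auto simp: space_pair_measure intro: C)
  have i1: "integrable ?N (\<lambda>(\<omega>, s). g \<omega> * (Y (max 0 s) \<omega> * Q Y' (\<omega>, s)))"
    using square_integrable_mult[OF gsq[OF sq] Q_sq[OF Y' X' sq']] by (simp add: split_beta' mult.assoc)
  have i2: "integrable ?N (\<lambda>(\<omega>, s). g \<omega> * (Y' (max 0 s) \<omega> * Q Y (\<omega>, s)))"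
    using square_integrable_mult[OF gsq[OF sq'] Q_sq[OF Y X sq]] by (simp add: split_beta' mult.assoc)
  have int: "AE \<omega> in M. integrable (time_measure t) (\<lambda>s. f (max 0 s) \<omega>)"
    if "square_integrable ?N (\<lambda>(\<omega>, s). f (max 0 s) \<omega>)" for f :: "real \<Rightarrow> 'a \<Rightarrow> real"
    by (rule P.AE_integrable_fst[OF square_integrable_integrable[OF finite_measure_time_product that]])
  have "(\<integral>\<omega>. g \<omega> * (X t \<omega> * X' t \<omega>) \<partial>M)
    = (\<integral>\<omega>. (\<integral>s. g \<omega> * (Y (max 0 s) \<omega> * Q Y' (\<omega>, s)) \<partial>time_measure t)
         + (\<integral>s. g \<omega> * (Y' (max 0 s) \<omega> * Q Y (\<omega>, s)) \<partial>time_measure t) \<partial>M)"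
  proof (rule integral_cong_AE)
    show "(\<lambda>\<omega>. g \<omega> * (X t \<omega> * X' t \<omega>)) \<in> borel_measurable M"
      using bounded_past_measurable[OF g] time_integral_cadlag(1)[OF Y X t] time_integral_cadlag(1)[OF Y' X' t]
      by measurable
    show "(\<lambda>\<omega>. (\<integral>s. g \<omega> * (Y (max 0 s) \<omega> * Q Y' (\<omega>, s)) \<partial>time_measure t)
         + (\<integral>s. g \<omega> * (Y' (max 0 s) \<omega> * Q Y (\<omega>, s)) \<partial>time_measure t)) \<in> borel_measurable M"
      using P.integrable_fst[OF i1] P.integrable_fst[OF i2] by simp
    show "AE \<omega> in M. g \<omega> * (X t \<omega> * X' t \<omega>)
      = (\<integral>s. g \<omega> * (Y (max 0 s) \<omega> * Q Y' (\<omega>, s)) \<partial>time_measure t)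
         + (\<integral>s. g \<omega> * (Y' (max 0 s) \<omega> * Q Y (\<omega>, s)) \<partial>time_measure t)"
      using time_integral_cadlag(2)[OF Y X t] time_integral_cadlag(2)[OF Y' X' t] int[OF sq] int[OF sq']
    proof eventually_elim
      fix \<omega> assume e: "X t \<omega> = (\<integral>s. Y (max 0 s) \<omega> \<partial>time_measure t)"
          "X' t \<omega> = (\<integral>s. Y' (max 0 s) \<omega> \<partial>time_measure t)"
        and ii: "integrable (time_measure t) (\<lambda>s. Y (max 0 s) \<omega>)" "integrable (time_measure t) (\<lambda>s. Y' (max 0 s) \<omega>)"
      show "g \<omega> * (X t \<omega> * X' t \<omega>)
        = (\<integral>s. g \<omega> * (Y (max 0 s) \<omega> * Q Y' (\<omega>, s)) \<partial>time_measure t)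
         + (\<integral>s. g \<omega> * (Y' (max 0 s) \<omega> * Q Y (\<omega>, s)) \<partial>time_measure t)"
        using time_integral_product[OF ii] by (simp add: e Q_def distrib_left)
    qed
  qed
  also have "\<dots> = (\<integral>(\<omega>, s). g \<omega> * (Y (max 0 s) \<omega> * Q Y' (\<omega>, s)) \<partial>?N)
      + (\<integral>(\<omega>, s). g \<omega> * (Y' (max 0 s) \<omega> * Q Y (\<omega>, s)) \<partial>?N)"
    unfolding P.integral_fst[OF i1, symmetric] P.integral_fst[OF i2, symmetric]
    by (rule Bochner_Integration.integral_add[OF P.integrable_fst[OF i1] P.integrable_fst[OF i2]])
  also have "(\<integral>(\<omega>, s). g \<omega> * (Y (max 0 s) \<omega> * Q Y' (\<omega>, s)) \<partial>?N) = D * t ^ Suc k / Suc k"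
  proof (rule integral_time_product_power[OF i1 t])
    fix s assume s: "0 < s" "s \<le> t"
    note [measurable] = bounded_past_measurable[OF g] Q_sec[OF Y'] time_integral_cadlag(1)[OF Y' X' less_imp_le[OF s(1)]]
    have [measurable]: "Y s \<in> borel_measurable M" using Y s by (auto simp: cadlag_process_def)
    have "(\<integral>\<omega>. g \<omega> * (Y s \<omega> * Q Y' (\<omega>, s)) \<partial>M) = (\<integral>\<omega>. g \<omega> * (Y s \<omega> * X' s \<omega>) \<partial>M)"
      using Q_eq[OF Y' X' s] by (intro integral_cong_AE) auto
    then show "(\<integral>\<omega>. (case (\<omega>, s) of (\<omega>, s) \<Rightarrow> g \<omega> * (Y (max 0 s) \<omega> * Q Y' (\<omega>, s))) \<partial>M) = D * s ^ k"
      using s m by simp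
  qed
  also have "(\<integral>(\<omega>, s). g \<omega> * (Y' (max 0 s) \<omega> * Q Y (\<omega>, s)) \<partial>?N) = D' * t ^ Suc k / Suc k"
  proof (rule integral_time_product_power[OF i2 t])
    fix s assume s: "0 < s" "s \<le> t"
    note [measurable] = bounded_past_measurable[OF g] Q_sec[OF Y] time_integral_cadlag(1)[OF Y X less_imp_le[OF s(1)]]
    have [measurable]: "Y' s \<in> borel_measurable M" using Y' s by (auto simp: cadlag_process_def)
    have "(\<integral>\<omega>. g \<omega> * (Y' s \<omega> * Q Y (\<omega>, s)) \<partial>M) = (\<integral>\<omega>. g \<omega> * (X s \<omega> * Y' s \<omega>) \<partial>M)"
      using Q_eq[OF Y X s] by (intro integral_cong_AE) auto
    then show "(\<integral>\<omega>. (case (\<omega>, s) of (\<omega>, s) \<Rightarrow> g \<omega> * (Y' (max 0 s) \<omega> * Q Y (\<omega>, s))) \<partial>M) = D' * s ^ k"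
      using s m' by simp
  qed
  finally show ?thesis by (simp only: distrib_right add_divide_distrib)
qed

end

section \<open>Moments of pairs of words\<close>

lemma zero_count_append [simp]: "zero_count (u @ v) = zero_count u + zero_count v"
  by (simp add: zero_count_def)

lemma nonzero_count_append [simp]: "nonzero_count (u @ v) = nonzero_count u + nonzero_count v"
  by (simp add: nonzero_count_def)

lemma count_simps [simp]:
  "zero_count [] = 0" "nonzero_count [] = 0"
  "zero_count [Base 0] = 1" "nonzero_count [Base 0] = 0"
  "a \<noteq> Base 0 \<Longrightarrow> zero_count [a] = 0" "a \<noteq> Base 0 \<Longrightarrow> nonzero_count [a] = 1"
  by (auto simp: zero_count_def nonzero_count_def)

text \<open>The letter \<open>Base 0\<close> is separated from the noise letters because its driver
  is time itself, which is not a martingale.\<close>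

locale iterated_integral_space = driven_space M F "A - {Base 0}" Z c
  for M :: "'a measure" and F :: "real \<Rightarrow> 'a measure" and A :: "letter set"
    and Z :: "letter \<Rightarrow> real \<Rightarrow> 'a \<Rightarrow> real" and c :: "letter \<Rightarrow> letter \<Rightarrow> real" +
  fixes I :: "letter list \<Rightarrow> real \<Rightarrow> 'a \<Rightarrow> real"
  assumes iterated: "iterated_integrals M F A Z I"
begin

lemma I_Nil [simp]: "I [] t \<omega> = 1"
  using iterated by (simp add: iterated_integrals_def)

lemma cadlag_I:
  assumes "w \<in> lists A"
  shows "cadlag_process M (I w)"
proof (cases w rule: rev_cases)
  case Nil
  then have "I w = (\<lambda>t \<omega>. 1)" by (auto simp: fun_eq_iff)
  then show ?thesis by (auto simp: cadlag_process_def)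
next
  case (snoc v a)
  then show ?thesis using assms iterated by (auto simp: iterated_integrals_def)
qed

lemma I_ito:
  assumes "w \<in> lists A" "a \<in> A" "a \<noteq> Base 0"
  shows "ito_integral M F (Z a) (left_limit (I w)) (I (w @ [a]))"
  using assms iterated unfolding iterated_integrals_def by (metis (no_types, lifting))

lemma I_time:
  assumes "w \<in> lists A" "Base 0 \<in> A"
  shows "time_integral M (left_limit (I w)) (I (w @ [Base 0]))"
  using assms iterated unfolding iterated_integrals_def by (metis (no_types, lifting))

text \<open>Both properties are carried through one induction, since the next integration asks both
  of its integrand.\<close>

lemma I_known_square_integrable:
  assumes "w \<in> lists A"
  shows "(\<forall>t\<ge>0. known_at t (I w t)) \<and>
    (\<forall>t\<ge>0. square_integrable (M \<Otimes>\<^sub>M time_measure t) (\<lambda>(\<omega>, s). I w (max 0 s) \<omega>))"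
  using assms
proof (induction w rule: rev_induct)
  case Nil
  have e: "I [] t = (\<lambda>_. 1)" for t by (simp add: fun_eq_iff)
  have "known_at t (I [] t)" for t
    unfolding e by (intro known_at_measurable) (auto simp: square_integrable_def)
  moreover have "square_integrable (M \<Otimes>\<^sub>M time_measure t) (\<lambda>(\<omega>, s). I [] (max 0 s) \<omega>)" for t
    by (rule square_integrable_bounded[OF finite_measure_time_product, of _ _ 1]) (auto simp: split_beta')
  ultimately show ?case by blast
next
  case (snoc a w)
  then have w: "w \<in> lists A" and a: "a \<in> A" by auto
  note kn = snoc.IH[OF w, THEN conjunct1, rule_format] and sq = snoc.IH[OF w, THEN conjunct2, rule_format]
  note cad = cadlag_I[OF w] and cad' = cadlag_I[OF snoc.prems]
  define X where "X = I (w @ [a])"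
  \<comment> \<open>The second moment of the integrand accumulated up to time \<open>t\<close>. It
    is monotone in \<open>t\<close>, so it bounds what is accumulated at all earlier times.\<close>
  define E where "E t = (\<integral>(\<omega>, s). (I w (max 0 s) \<omega>)\<^sup>2 \<partial>(M \<Otimes>\<^sub>M time_measure t))" for t
  have E_nonneg: "0 \<le> E t" for t unfolding E_def by (auto intro!: integral_nonneg_AE)
  have E_mono: "E s \<le> E t" if "0 \<le> s" "s \<le> t" for s t
    using square_integrable_time_mono(2)[OF sq that(2)] that by (simp add: E_def split_beta')
  \<comment> \<open>\<open>D t\<close> has to serve all \<open>s \<le> t\<close> at once, because
    these second moments are then integrated over time.\<close>
  have *: "(\<forall>t\<ge>0. known_at t (X t)) \<and> (\<exists>D. \<forall>t\<ge>0. \<forall>s. 0 \<le> s \<and> s \<le> t \<longrightarrow> (\<integral>\<omega>. (X s \<omega>)\<^sup>2 \<partial>M) \<le> D t)"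
  proof (cases "a = Base 0")
    case True
    have tm: "time_integral M (left_limit (I w)) X" unfolding X_def True using I_time[OF w] a True by simp
    have "(\<integral>\<omega>. (X s \<omega>)\<^sup>2 \<partial>M) \<le> t * E t" if "0 \<le> s" "s \<le> t" for s t
    proof -
      have "(\<integral>\<omega>. (X s \<omega>)\<^sup>2 \<partial>M) \<le> s * E s"
        unfolding E_def by (rule time_integral_square(2)[OF cad tm that(1) sq[OF that(1)]])
      also have "\<dots> \<le> t * E t" using E_mono[OF that] E_nonneg that by (intro mult_mono) auto
      finally show ?thesis .
    qed
    then have "\<exists>D. \<forall>t\<ge>0. \<forall>s. 0 \<le> s \<and> s \<le> t \<longrightarrow> (\<integral>\<omega>. (X s \<omega>)\<^sup>2 \<partial>M) \<le> D t"
      by (intro exI[of _ "\<lambda>t. t * E t"]) auto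
    moreover have "known_at t (X t)" if "0 \<le> t" for t
      by (rule time_integral_known[OF cad tm that sq[OF that] kn])
    ultimately show ?thesis by blast
  next
    case False
    then have aB: "a \<in> A - {Base 0}" using a by simp
    note it = I_ito[OF w a False, folded X_def]
    have "(\<integral>\<omega>. (X s \<omega>)\<^sup>2 \<partial>M) \<le> \<bar>c a a\<bar> * E t" if "0 \<le> s" "s \<le> t" for s t
    proof -
      have "(\<integral>\<omega>. (X s \<omega>)\<^sup>2 \<partial>M) = c a a * E s"
        using ito_cov[OF aB cad it aB cad it that(1), of "\<lambda>_. 1"] by (simp add: power2_eq_square E_def)
      also have "\<dots> \<le> \<bar>c a a\<bar> * E t" using E_mono[OF that] E_nonneg by (intro mult_mono) auto
      finally show ?thesis .
    qed
    then have "\<exists>D. \<forall>t\<ge>0. \<forall>s. 0 \<le> s \<and> s \<le> t \<longrightarrow> (\<integral>\<omega>. (X s \<omega>)\<^sup>2 \<partial>M) \<le> D t"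
      by (intro exI[of _ "\<lambda>t. \<bar>c a a\<bar> * E t"]) auto
    moreover have "known_at t (X t)" if "0 \<le> t" for t
      by (rule ito_known[OF aB cad it that])
    ultimately show ?thesis by blast
  qed
  then obtain D where knX: "\<And>t. 0 \<le> t \<Longrightarrow> known_at t (X t)"
    and D: "\<And>s t. 0 \<le> s \<Longrightarrow> s \<le> t \<Longrightarrow> (\<integral>\<omega>. (X s \<omega>)\<^sup>2 \<partial>M) \<le> D t"
    by (metis order_trans)
  have "square_integrable (M \<Otimes>\<^sub>M time_measure t) (\<lambda>(\<omega>, s). X (max 0 s) \<omega>)" if "0 \<le> t" for t
    by (rule square_integrable_time_product[OF cadlag_joint_measurable[OF cad', folded X_def], of t "D t"])
       (use D knX[THEN known_at_sq] in auto)
  then show ?case using knX by (simp add: X_def)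
qed

lemmas known_I = I_known_square_integrable[THEN conjunct1, rule_format]
  and square_integrable_I = I_known_square_integrable[THEN conjunct2, rule_format]

text \<open>The constant depends on the two words only; time enters through a monomial and the
  weight through its mean. The weight is what later admits random initial data. The exponent names
  the nonzero letters of \<open>u\<close> alone, which is unambiguous where it matters, as
  \<open>C\<close> vanishes if the counts differ.\<close>

definition moment :: "letter list \<Rightarrow> letter list \<Rightarrow> real \<Rightarrow> bool" where
  "moment u v C \<longleftrightarrow> (nonzero_count u \<noteq> nonzero_count v \<longrightarrow> C = 0) \<and>
    (\<forall>g t. bounded_past 0 g \<longrightarrow> 0 \<le> t \<longrightarrow>
      (\<integral>\<omega>. g \<omega> * (I u t \<omega> * I v t \<omega>) \<partial>M)
        = (C * (\<integral>\<omega>. g \<omega> \<partial>M)) * t ^ (zero_count u + zero_count v + nonzero_count u))"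

lemma momentD:
  "moment u v C \<Longrightarrow> bounded_past 0 g \<Longrightarrow> 0 \<le> t \<Longrightarrow> (\<integral>\<omega>. g \<omega> * (I u t \<omega> * I v t \<omega>) \<partial>M)
        = (C * (\<integral>\<omega>. g \<omega> \<partial>M)) * t ^ (zero_count u + zero_count v + nonzero_count u)"
  by (simp add: moment_def)

text \<open>The exponent distinguishes \<open>u\<close> from \<open>v\<close> only if their nonzero
  counts differ, and then the constant is 0.\<close>

lemma moment_sym: "moment u v C \<Longrightarrow> moment v u C"
  unfolding moment_def by (cases "C = 0") (auto simp: mult.commute[of "I u _ _"] add_ac)

text \<open>By the isometry the two last letters contribute the factor \<open>c a b\<close> and one
  time integration of the moment of the shorter words.\<close>

lemma moment_ito_ito:
  assumes u: "u \<in> lists A" and a: "a \<in> A" "a \<noteq> Base 0" and v: "v \<in> lists A" and b: "b \<in> A" "b \<noteq> Base 0"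
    and m: "moment u v C"
  shows "\<exists>C. moment (u @ [a]) (v @ [b]) C"
proof -
  define k where "k = zero_count u + zero_count v + nonzero_count u"
  have "(\<integral>\<omega>. g \<omega> * (I (u @ [a]) t \<omega> * I (v @ [b]) t \<omega>) \<partial>M)
      = (c a b * C / Suc k) * (\<integral>\<omega>. g \<omega> \<partial>M) * t ^ Suc k" if g: "bounded_past 0 g" and t: "0 \<le> t" for g t
  proof -
    let ?N = "M \<Otimes>\<^sub>M time_measure t"
    obtain D where D: "\<And>\<omega>. \<omega> \<in> space M \<Longrightarrow> \<bar>g \<omega>\<bar> \<le> D" using g by (auto simp: bounded_past_def)
    have gN: "(\<lambda>x. g (fst x)) \<in> borel_measurable ?N" using bounded_past_measurable[OF g] by measurable
    have "square_integrable ?N (\<lambda>x. g (fst x) * (case x of (\<omega>, s) \<Rightarrow> I u (max 0 s) \<omega>))"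
      by (rule square_integrable_bounded_mult[OF square_integrable_I[OF u t] gN, of D])
         (auto simp: space_pair_measure intro: D)
    from square_integrable_mult[OF this square_integrable_I[OF v t]]
    have i: "integrable ?N (\<lambda>(\<omega>, s). g \<omega> * (I u (max 0 s) \<omega> * I v (max 0 s) \<omega>))"
      by (simp add: split_beta' mult.assoc)
    have "(\<integral>(\<omega>, s). g \<omega> * (I u (max 0 s) \<omega> * I v (max 0 s) \<omega>) \<partial>?N)
       = (C * (\<integral>\<omega>. g \<omega> \<partial>M)) * t ^ Suc k / Suc k"
      by (rule integral_time_product_power[OF i t]) (simp add: momentD[OF m g] k_def)
    then show ?thesis
      using ito_cov[OF _ cadlag_I[OF u] I_ito[OF u a] _ cadlag_I[OF v] I_ito[OF v b] t g] a b by simp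
  qed
  moreover have "zero_count (u @ [a]) + zero_count (v @ [b]) + nonzero_count (u @ [a]) = Suc k"
    using a b by (simp add: k_def)
  moreover have "nonzero_count (u @ [a]) \<noteq> nonzero_count (v @ [b]) \<longrightarrow> c a b * C / Suc k = 0"
    using m a b by (simp add: moment_def)
  ultimately have "moment (u @ [a]) (v @ [b]) (c a b * C / Suc k)" by (simp add: moment_def)
  then show ?thesis ..
qed

text \<open>If \<open>u\<close> is empty or ends in a noise letter, \<open>I u\<close> is a
  martingale. Under the time integral that closes the second word, \<open>I u t\<close> may
  therefore be replaced by \<open>I u s\<close> against quantities known at
  \<open>s\<close>.\<close>

lemma moment_ito_time:
  assumes u: "u = [] \<or> (\<exists>u' a. u = u' @ [a] \<and> a \<noteq> Base 0)" "u \<in> lists A" and v: "v \<in> lists A" and b: "Base 0 \<in> A"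
    and m: "moment u v C"
  shows "\<exists>C. moment u (v @ [Base 0]) C"
proof -
  define k where "k = zero_count u + zero_count v + nonzero_count u"
  have mart: "orth_past s (\<lambda>\<omega>. I u t \<omega> - I u s \<omega>)" if "0 \<le> s" "s \<le> t" for s t
    using u(1)
  proof
    assume "\<exists>u' a. u = u' @ [a] \<and> a \<noteq> Base 0"
    then obtain u' a where e: "u = u' @ [a]" "a \<noteq> Base 0" by blast
    then have "u' \<in> lists A" "a \<in> A" using u(2) by auto
    then show ?thesis unfolding e using e that
      by (intro ito_orth[OF _ cadlag_I I_ito]) auto
  qed simp
  have "(\<integral>\<omega>. g \<omega> * (I u t \<omega> * I (v @ [Base 0]) t \<omega>) \<partial>M)
      = (C / Suc k) * (\<integral>\<omega>. g \<omega> \<partial>M) * t ^ Suc k" if g: "bounded_past 0 g" and t: "0 \<le> t" for g t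
  proof -
    have "(\<integral>\<omega>. (g \<omega> * I u t \<omega>) * I v s \<omega> \<partial>M) = (C * (\<integral>\<omega>. g \<omega> \<partial>M)) * s ^ k" if s: "0 < s" "s \<le> t" for s
    proof -
      have gs: "bounded_past s g" using bounded_past_mono[OF g] s by simp
      have k1: "known_at s (\<lambda>\<omega>. g \<omega> * I v s \<omega>)"
        using s by (intro known_at_mult[OF gs] known_I[OF v]) auto
      have o: "orth_past s (\<lambda>\<omega>. I u t \<omega> - I u s \<omega>)" using mart s by simp
      have "(\<integral>\<omega>. (g \<omega> * I u t \<omega>) * I v s \<omega> \<partial>M)
         = (\<integral>\<omega>. (g \<omega> * I v s \<omega>) * (I u t \<omega> - I u s \<omega>) + (g \<omega> * I v s \<omega>) * I u s \<omega> \<partial>M)"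
        by (intro Bochner_Integration.integral_cong) (auto simp: algebra_simps)
      also have "\<dots> = (\<integral>\<omega>. (g \<omega> * I v s \<omega>) * (I u t \<omega> - I u s \<omega>) \<partial>M) + (\<integral>\<omega>. (g \<omega> * I v s \<omega>) * I u s \<omega> \<partial>M)"
        using s by (intro Bochner_Integration.integral_add square_integrable_mult known_at_sq[OF k1]
          orth_past_sq[OF o] known_at_sq[OF known_I[OF u(2)]]) auto
      also have "\<dots> = (\<integral>\<omega>. g \<omega> * (I u s \<omega> * I v s \<omega>) \<partial>M)"
        using known_orth[OF k1 o] by (simp add: mult_ac)
      finally show ?thesis using momentD[OF m g, of s] s by (simp add: k_def)
    qed
    from time_integral_pairing[OF cadlag_I[OF v] I_time[OF v b] t square_integrable_I[OF v t]
        square_integrable_bounded_past_mult[OF g known_at_sq[OF known_I[OF u(2) t]]] this]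
    show ?thesis by (simp add: mult.assoc)
  qed
  moreover have "zero_count u + zero_count (v @ [Base 0]) + nonzero_count u = Suc k"
    by (simp add: k_def)
  moreover have "nonzero_count u \<noteq> nonzero_count (v @ [Base 0]) \<longrightarrow> C / Suc k = 0"
    using m by (simp add: moment_def)
  ultimately have "moment u (v @ [Base 0]) (C / Suc k)" by (simp add: moment_def)
  then show ?thesis ..
qed

text \<open>The product rule strips the final zero from one word at a time. The two resulting pairs
  have the same exponent, so their constants add.\<close>

lemma moment_time_time:
  assumes u: "u \<in> lists A" and v: "v \<in> lists A" and b: "Base 0 \<in> A"
    and m: "moment u (v @ [Base 0]) C" and m': "moment (u @ [Base 0]) v C'"
  shows "\<exists>C. moment (u @ [Base 0]) (v @ [Base 0]) C"
proof -
  define k where "k = Suc (zero_count u + zero_count v + nonzero_count u)"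
  have "(\<integral>\<omega>. g \<omega> * (I (u @ [Base 0]) t \<omega> * I (v @ [Base 0]) t \<omega>) \<partial>M)
      = ((C + C') / Suc k) * (\<integral>\<omega>. g \<omega> \<partial>M) * t ^ Suc k" if g: "bounded_past 0 g" and t: "0 \<le> t" for g t
  proof -
    have "(\<integral>\<omega>. g \<omega> * (I u s \<omega> * I (v @ [Base 0]) s \<omega>) \<partial>M) = (C * (\<integral>\<omega>. g \<omega> \<partial>M)) * s ^ k" if "0 < s" "s \<le> t" for s
      using momentD[OF m g, of s] that by (simp add: k_def)
    moreover have "(\<integral>\<omega>. g \<omega> * (I (u @ [Base 0]) s \<omega> * I v s \<omega>) \<partial>M) = (C' * (\<integral>\<omega>. g \<omega> \<partial>M)) * s ^ k" if "0 < s" "s \<le> t" for s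
      using momentD[OF m' g, of s] that by (simp add: k_def)
    ultimately have "(\<integral>\<omega>. g \<omega> * (I (u @ [Base 0]) t \<omega> * I (v @ [Base 0]) t \<omega>) \<partial>M)
      = (C * (\<integral>\<omega>. g \<omega> \<partial>M) + C' * (\<integral>\<omega>. g \<omega> \<partial>M)) * t ^ Suc k / Suc k"
      by (rule time_integral_pairing2[OF cadlag_I[OF u] I_time[OF u b] cadlag_I[OF v] I_time[OF v b] t
        square_integrable_I[OF u t] square_integrable_I[OF v t] g])
    then show ?thesis by (simp add: algebra_simps)
  qed
  moreover have "zero_count (u @ [Base 0]) + zero_count (v @ [Base 0]) + nonzero_count (u @ [Base 0]) = Suc k"
    by (simp add: k_def)
  moreover have "nonzero_count (u @ [Base 0]) \<noteq> nonzero_count (v @ [Base 0]) \<longrightarrow> (C + C') / Suc k = 0"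
    using m m' by (simp add: moment_def)
  ultimately have "moment (u @ [Base 0]) (v @ [Base 0]) ((C + C') / Suc k)" by (simp add: moment_def)
  then show ?thesis ..
qed

text \<open>An Ito integral is orthogonal to all weights known at time 0.\<close>

lemma moment_Nil_ito:
  assumes v: "v \<in> lists A" and b: "b \<in> A" "b \<noteq> Base 0"
  shows "moment [] (v @ [b]) 0"
proof -
  have "orth_past 0 (I (v @ [b]) t)" if "0 \<le> t" for t
    using b that by (intro ito_orth_initial[OF _ cadlag_I[OF v] I_ito[OF v b]]) auto
  then show ?thesis by (simp add: moment_def orth_past_def)
qed

text \<open>The induction runs over the total length because two final zeros lead to pairs in which
  only one of the words is shortened.\<close>

theorem moment_exists:
  assumes "u \<in> lists A" "v \<in> lists A"
  shows "\<exists>C. moment u v C"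
  using assms
proof (induction "length u + length v" arbitrary: u v rule: less_induct)
  case less
  note IH = less.hyps[rule_format] and uA = less.prems(1) and vA = less.prems(2)
  show ?case
  proof (cases v rule: rev_cases)
    case vn: Nil
    show ?thesis
    proof (cases u rule: rev_cases)
      case Nil
      then have "moment u v 1" using vn by (simp add: moment_def)
      then show ?thesis ..
    next
      case (snoc u' a)
      then have u': "u' \<in> lists A" "a \<in> A" using uA by auto
      show ?thesis
      proof (cases "a = Base 0")
        case True
        obtain C where "moment u' v C" using IH[of u' v] u' vA snoc by auto
        then show ?thesis using moment_ito_time[of v u' C] vn u' vA True snoc moment_sym by blast
      next
        case False
        then show ?thesis using moment_Nil_ito[OF u' False] snoc vn moment_sym by blast
      qed
    qed
  next
    case vs: (snoc v' b)
    then have v': "v' \<in> lists A" "b \<in> A" using vA by auto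
    obtain Cv where Cv: "moment u v' Cv" using IH[of u v'] uA v' vs by auto
    show ?thesis
    proof (cases u rule: rev_cases)
      case un: Nil
      show ?thesis
      proof (cases "b = Base 0")
        case True
        then show ?thesis using moment_ito_time[OF _ uA v'(1) _ Cv] un v' vs by blast
      next
        case False
        then show ?thesis using moment_Nil_ito[OF v' False] vs un by blast
      qed
    next
      case us: (snoc u' a)
      then have u': "u' \<in> lists A" "a \<in> A" using uA by auto
      obtain Cu where Cu: "moment u' v Cu" using IH[of u' v] vA u' us by auto
      obtain C where C: "moment u' v' C" using IH[of u' v'] v' u' us vs by auto
      consider "a = Base 0" "b = Base 0" | "a \<noteq> Base 0" "b = Base 0" | "a = Base 0" "b \<noteq> Base 0" | "a \<noteq> Base 0" "b \<noteq> Base 0"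
        by blast
      then show ?thesis
      proof cases
        case 1
        then show ?thesis using moment_time_time[OF u'(1) v'(1)] Cu Cv us vs u' by blast
      next
        case 2
        then show ?thesis using moment_ito_time[OF _ uA v'(1) _ Cv] us vs v' by blast
      next
        case 3
        then show ?thesis using moment_ito_time[OF _ vA u'(1) _ moment_sym[OF Cu]] us vs u' moment_sym by blast
      next
        case 4
        then show ?thesis using moment_ito_ito[OF u'(1) u'(2) _ v'(1) v'(2) _ C] us vs by blast
      qed
    qed
  qed
qed

end

section \<open>Poisson random measures\<close>

lemma poisson_series:
  fixes r :: real
  shows "(\<lambda>k. real k * (r ^ k / fact k * exp (- r))) sums r"
    and "(\<lambda>k. (real k)\<^sup>2 * (r ^ k / fact k * exp (- r))) sums (r + r\<^sup>2)"
proof -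
  define f where "f k = r ^ k / fact k" for k
  have f: "f sums exp r"
    unfolding f_def using exp_converges[of r] by (simp add: field_simps scaleR_conv_of_real)
  \<comment> \<open>The index shift \<open>(k + 1) f (k + 1) = r f k\<close> reduces each moment to
    lower ones.\<close>
  have "(\<lambda>k. real (Suc k) * f (Suc k)) sums (r * exp r)"
    using sums_mult[OF f, of r] by (simp add: f_def field_simps del: of_nat_Suc)
  then have g: "(\<lambda>k. real k * f k) sums (r * exp r)"
    by (subst (asm) sums_Suc_iff) simp
  have "(\<lambda>k. (real (Suc k))\<^sup>2 * f (Suc k)) sums (r * (r * exp r + exp r))"
  proof -
    have "(real (Suc k))\<^sup>2 * f (Suc k) = r * (real k * f k + f k)" for k
    proof -
      have "real (Suc k) * f (Suc k) = r * f k" by (simp add: f_def field_simps del: of_nat_Suc)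
      then have "(real (Suc k))\<^sup>2 * f (Suc k) = real (Suc k) * (r * f k)"
        by (simp add: power2_eq_square mult.assoc del: of_nat_Suc)
      then show ?thesis by (simp add: algebra_simps)
    qed
    then show ?thesis using sums_mult[OF sums_add[OF g f], of r] by simp
  qed
  then have h: "(\<lambda>k. (real k)\<^sup>2 * f k) sums (r * (r * exp r + exp r))"
    by (subst (asm) sums_Suc_iff) simp
  show "(\<lambda>k. real k * (r ^ k / fact k * exp (- r))) sums r"
    using sums_mult2[OF g, of "exp (- r)"] by (simp add: f_def mult.assoc exp_minus_inverse)
  show "(\<lambda>k. (real k)\<^sup>2 * (r ^ k / fact k * exp (- r))) sums (r + r\<^sup>2)"
    using sums_mult2[OF h, of "exp (- r)"]
    by (simp add: f_def mult.assoc exp_minus_inverse algebra_simps power2_eq_square)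
qed

lemma poisson_series_total: "(\<lambda>k. r ^ k / fact k * exp (- r)) sums (1::real)"
proof -
  have "(\<lambda>k. r ^ k / fact k) sums exp r"
    using exp_converges[of r] by (simp add: field_simps scaleR_conv_of_real)
  from sums_mult2[OF this, of "exp (- r)"] show ?thesis by (simp add: exp_minus_inverse)
qed

text \<open>\<open>N\<close> has extended values and only the masses of the naturals are given. They
  already sum to 1, so \<open>N\<close> is almost surely a natural number and the integral is a
  series.\<close>

lemma (in prob_space) nn_integral_poisson:
  fixes N :: "'a \<Rightarrow> ennreal" and \<phi> :: "ennreal \<Rightarrow> ennreal"
  assumes N: "N \<in> borel_measurable M"
    and P: "\<And>k. measure M {\<omega> \<in> space M. N \<omega> = of_nat k} = r ^ k / fact k * exp (- r)"
  shows "(\<integral>\<^sup>+\<omega>. \<phi> (N \<omega>) \<partial>M) = (\<Sum>k. \<phi> (of_nat k) * ennreal (r ^ k / fact k * exp (- r)))"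
proof -
  define E where "E k = {\<omega> \<in> space M. N \<omega> = of_nat k}" for k :: nat
  have E: "E k \<in> sets M" for k unfolding E_def using N by measurable
  have dis: "disjoint_family E" by (auto simp: disjoint_family_on_def E_def)
  have "(\<lambda>k. measure M (E k)) sums measure M (\<Union>k. E k)"
    using E dis by (intro finite_measure_UNION) auto
  then have "measure M (\<Union>k. E k) = 1"
    using poisson_series_total[of r] P by (simp add: E_def sums_unique2)
  then have AE1: "AE \<omega> in M. \<omega> \<in> (\<Union>k. E k)" by (rule AE_prob_1)
  have "(\<integral>\<^sup>+\<omega>. \<phi> (N \<omega>) \<partial>M) = (\<integral>\<^sup>+\<omega>. (\<Sum>k. \<phi> (of_nat k) * indicator (E k) \<omega>) \<partial>M)"
  proof (rule nn_integral_cong_AE, use AE1 in eventually_elim)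
    fix \<omega> assume "\<omega> \<in> (\<Union>k. E k)"
    then obtain j where j: "\<omega> \<in> E j" by blast
    then have "(\<lambda>k. \<phi> (of_nat k) * indicator (E k) \<omega>) = (\<lambda>k. if k = j then \<phi> (N \<omega>) else 0)"
      by (auto simp: E_def indicator_def fun_eq_iff)
    then show "\<phi> (N \<omega>) = (\<Sum>k. \<phi> (of_nat k) * indicator (E k) \<omega>)"
      using sums_unique[OF sums_single[of j "\<lambda>_. \<phi> (N \<omega>)"]] by simp
  qed
  also have "\<dots> = (\<Sum>k. \<integral>\<^sup>+\<omega>. \<phi> (of_nat k) * indicator (E k) \<omega> \<partial>M)"
    using E by (intro nn_integral_suminf) auto
  also have "\<dots> = (\<Sum>k. \<phi> (of_nat k) * ennreal (r ^ k / fact k * exp (- r)))"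
    using E P by (simp add: nn_integral_cmult_indicator emeasure_eq_measure E_def)
  finally show ?thesis .
qed

lemma (in prob_space) nn_integral_poisson_moments:
  fixes N :: "'a \<Rightarrow> ennreal"
  assumes N: "N \<in> borel_measurable M" and r: "0 \<le> r"
    and P: "\<And>k. measure M {\<omega> \<in> space M. N \<omega> = of_nat k} = r ^ k / fact k * exp (- r)"
  shows "(\<integral>\<^sup>+\<omega>. N \<omega> \<partial>M) = ennreal r" "(\<integral>\<^sup>+\<omega>. N \<omega> * N \<omega> \<partial>M) = ennreal r + ennreal r * ennreal r"
proof -
  have "(\<integral>\<^sup>+\<omega>. N \<omega> \<partial>M) = (\<Sum>k. of_nat k * ennreal (r ^ k / fact k * exp (- r)))"
    by (rule nn_integral_poisson[OF N P])
  also have "\<dots> = (\<Sum>k. ennreal (real k * (r ^ k / fact k * exp (- r))))"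
    using r by (subst ennreal_mult) (auto simp: ennreal_of_nat_eq_real_of_nat)
  also have "\<dots> = ennreal r"
    using poisson_series(1)[of r] r by (intro suminf_ennreal_eq) auto
  finally show "(\<integral>\<^sup>+\<omega>. N \<omega> \<partial>M) = ennreal r" .
  have "(\<integral>\<^sup>+\<omega>. N \<omega> * N \<omega> \<partial>M) = (\<Sum>k. (of_nat k * of_nat k) * ennreal (r ^ k / fact k * exp (- r)))"
    by (rule nn_integral_poisson[OF N P])
  also have "\<dots> = (\<Sum>k. ennreal ((real k)\<^sup>2 * (r ^ k / fact k * exp (- r))))"
    using r by (subst ennreal_mult) (auto simp: ennreal_of_nat_eq_real_of_nat power2_eq_square ennreal_mult)
  also have "\<dots> = ennreal (r + r\<^sup>2)"
    using poisson_series(2)[of r] r by (intro suminf_ennreal_eq) auto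
  finally show "(\<integral>\<^sup>+\<omega>. N \<omega> * N \<omega> \<partial>M) = ennreal r + ennreal r * ennreal r"
    using r by (simp add: ennreal_plus ennreal_mult power2_eq_square)
qed

section \<open>Campbell formulas for random measures\<close>

lemma measurable_nn_integral_random_measure:
  assumes sets: "\<And>\<omega>. \<omega> \<in> space M \<Longrightarrow> sets (R \<omega>) = sets N"
    and meas: "\<And>B. B \<in> sets N \<Longrightarrow> (\<lambda>\<omega>. emeasure (R \<omega>) B) \<in> borel_measurable M"
    and f: "f \<in> borel_measurable N"
  shows "(\<lambda>\<omega>. \<integral>\<^sup>+x. f x \<partial>R \<omega>) \<in> borel_measurable M"
proof -
  have fR: "h \<in> borel_measurable (R \<omega>)" if "h \<in> borel_measurable N" "\<omega> \<in> space M" for h :: "'b \<Rightarrow> ennreal" and \<omega>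
    using that sets by (simp cong: measurable_cong_sets)
  show ?thesis using f
  proof (induction f rule: borel_measurable_induct)
    case (cong f g)
    then have "(\<integral>\<^sup>+x. f x \<partial>R \<omega>) = (\<integral>\<^sup>+x. g x \<partial>R \<omega>)" if "\<omega> \<in> space M" for \<omega>
      using sets_eq_imp_space_eq[OF sets[OF that]] by (intro nn_integral_cong) auto
    then show ?case using cong by (simp cong: measurable_cong)
  next
    case (set A)
    then have "(\<integral>\<^sup>+x. indicator A x \<partial>R \<omega>) = emeasure (R \<omega>) A" if "\<omega> \<in> space M" for \<omega>
      using sets[OF that] by simp
    then show ?case using meas[OF set] by (simp cong: measurable_cong)
  next
    case (mult u k)
    have "(\<integral>\<^sup>+x. k * u x \<partial>R \<omega>) = k * (\<integral>\<^sup>+x. u x \<partial>R \<omega>)" if "\<omega> \<in> space M" for \<omega>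
      by (rule nn_integral_cmult[OF fR[OF mult.hyps(2) that]])
    then have "(\<lambda>\<omega>. \<integral>\<^sup>+x. k * u x \<partial>R \<omega>) \<in> borel_measurable M
        \<longleftrightarrow> (\<lambda>\<omega>. k * (\<integral>\<^sup>+x. u x \<partial>R \<omega>)) \<in> borel_measurable M" by (rule measurable_cong)
    then show ?case using mult.IH by simp
  next
    case (add u v)
    have "(\<integral>\<^sup>+x. v x + u x \<partial>R \<omega>) = (\<integral>\<^sup>+x. v x \<partial>R \<omega>) + (\<integral>\<^sup>+x. u x \<partial>R \<omega>)" if "\<omega> \<in> space M" for \<omega>
      by (rule nn_integral_add[OF fR[OF add.hyps(3) that] fR[OF add.hyps(1) that]])
    then have "(\<lambda>\<omega>. \<integral>\<^sup>+x. v x + u x \<partial>R \<omega>) \<in> borel_measurable M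
        \<longleftrightarrow> (\<lambda>\<omega>. (\<integral>\<^sup>+x. v x \<partial>R \<omega>) + (\<integral>\<^sup>+x. u x \<partial>R \<omega>)) \<in> borel_measurable M" by (rule measurable_cong)
    then show ?case using add.IH by simp
  next
    case (seq U)
    have "(\<integral>\<^sup>+x. (SUP i. U i) x \<partial>R \<omega>) = (SUP i. \<integral>\<^sup>+x. U i x \<partial>R \<omega>)" if "\<omega> \<in> space M" for \<omega>
      unfolding SUP_apply by (rule nn_integral_monotone_convergence_SUP[OF seq.hyps(3) fR[OF seq.hyps(1) that]])
    then have "(\<lambda>\<omega>. \<integral>\<^sup>+x. (SUP i. U i) x \<partial>R \<omega>) \<in> borel_measurable M
        \<longleftrightarrow> (\<lambda>\<omega>. SUP i. \<integral>\<^sup>+x. U i x \<partial>R \<omega>) \<in> borel_measurable M" by (rule measurable_cong)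
    then show ?case using seq.IH by simp
  qed
qed

text \<open>The random weight \<open>H\<close> and the density \<open>G\<close> allow iteration:
  \<open>H = 1\<close> gives the mean of an integral, and another integral in the role of
  \<open>H\<close> gives mixed moments. The step from sets to functions is the usual monotone
  approximation.\<close>

lemma campbell_first:
  assumes sets: "\<And>\<omega>. \<omega> \<in> space M \<Longrightarrow> sets (R \<omega>) = sets N" and setsL: "sets L = sets N"
    and meas: "\<And>B. B \<in> sets N \<Longrightarrow> (\<lambda>\<omega>. emeasure (R \<omega>) B) \<in> borel_measurable M"
    and H: "H \<in> borel_measurable M"
    and E: "\<And>B. B \<in> sets N \<Longrightarrow> (\<integral>\<^sup>+\<omega>. emeasure (R \<omega>) B * H \<omega> \<partial>M) = (\<integral>\<^sup>+x. indicator B x * G x \<partial>L)"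
    and G: "G \<in> borel_measurable N"
    and f: "f \<in> borel_measurable N"
  shows "(\<integral>\<^sup>+\<omega>. (\<integral>\<^sup>+x. f x \<partial>R \<omega>) * H \<omega> \<partial>M) = (\<integral>\<^sup>+x. f x * G x \<partial>L)"
proof -
  have fR: "h \<in> borel_measurable (R \<omega>)" if "h \<in> borel_measurable N" "\<omega> \<in> space M" for h :: "'b \<Rightarrow> ennreal" and \<omega>
    using that sets by (simp cong: measurable_cong_sets)
  have fL: "h \<in> borel_measurable L" if "h \<in> borel_measurable N" for h :: "'b \<Rightarrow> ennreal"
    using that setsL by (simp cong: measurable_cong_sets)
  have mR: "(\<lambda>\<omega>. \<integral>\<^sup>+x. h x \<partial>R \<omega>) \<in> borel_measurable M" if "h \<in> borel_measurable N" for h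
    by (rule measurable_nn_integral_random_measure[OF sets meas that])
  note [measurable] = H fL[OF G]
  show ?thesis using f
  proof (induction f rule: borel_measurable_induct)
    case (cong f g)
    have "(\<integral>\<^sup>+x. f x \<partial>R \<omega>) = (\<integral>\<^sup>+x. g x \<partial>R \<omega>)" if "\<omega> \<in> space M" for \<omega>
      using sets_eq_imp_space_eq[OF sets[OF that]] cong by (intro nn_integral_cong) auto
    then have "(\<integral>\<^sup>+\<omega>. (\<integral>\<^sup>+x. f x \<partial>R \<omega>) * H \<omega> \<partial>M) = (\<integral>\<^sup>+\<omega>. (\<integral>\<^sup>+x. g x \<partial>R \<omega>) * H \<omega> \<partial>M)"
      by (intro nn_integral_cong) simp
    moreover have "(\<integral>\<^sup>+x. f x * G x \<partial>L) = (\<integral>\<^sup>+x. g x * G x \<partial>L)"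
      using sets_eq_imp_space_eq[OF setsL] cong by (intro nn_integral_cong) auto
    ultimately show ?case using cong by simp
  next
    case (set A)
    have "(\<integral>\<^sup>+\<omega>. (\<integral>\<^sup>+x. indicator A x \<partial>R \<omega>) * H \<omega> \<partial>M) = (\<integral>\<^sup>+\<omega>. emeasure (R \<omega>) A * H \<omega> \<partial>M)"
      using sets set by (intro nn_integral_cong) simp
    then show ?case using E[OF set] by simp
  next
    case (mult u k)
    note [measurable] = mR[OF mult.hyps(2)] fL[OF mult.hyps(2)]
    have "(\<integral>\<^sup>+\<omega>. (\<integral>\<^sup>+x. k * u x \<partial>R \<omega>) * H \<omega> \<partial>M) = (\<integral>\<^sup>+\<omega>. k * ((\<integral>\<^sup>+x. u x \<partial>R \<omega>) * H \<omega>) \<partial>M)"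
      by (intro nn_integral_cong) (simp add: nn_integral_cmult[OF fR[OF mult.hyps(2)]] mult.assoc)
    also have "\<dots> = k * (\<integral>\<^sup>+x. u x * G x \<partial>L)"
      by (subst nn_integral_cmult) (auto simp: mult.IH)
    also have "\<dots> = (\<integral>\<^sup>+x. k * u x * G x \<partial>L)"
      unfolding mult.assoc by (subst nn_integral_cmult) auto
    finally show ?case .
  next
    case (add u v)
    note [measurable] = mR[OF add.hyps(1)] fL[OF add.hyps(1)] mR[OF add.hyps(3)] fL[OF add.hyps(3)]
    have "(\<integral>\<^sup>+\<omega>. (\<integral>\<^sup>+x. v x + u x \<partial>R \<omega>) * H \<omega> \<partial>M)
       = (\<integral>\<^sup>+\<omega>. (\<integral>\<^sup>+x. v x \<partial>R \<omega>) * H \<omega> + (\<integral>\<^sup>+x. u x \<partial>R \<omega>) * H \<omega> \<partial>M)"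
      by (intro nn_integral_cong) (simp add: nn_integral_add[OF fR[OF add.hyps(3)] fR[OF add.hyps(1)]] distrib_right)
    also have "\<dots> = (\<integral>\<^sup>+x. v x * G x \<partial>L) + (\<integral>\<^sup>+x. u x * G x \<partial>L)"
      by (subst nn_integral_add) (auto simp: add.IH)
    also have "\<dots> = (\<integral>\<^sup>+x. (v x + u x) * G x \<partial>L)"
      unfolding distrib_right by (subst nn_integral_add) auto
    finally show ?case .
  next
    case (seq U)
    note [measurable] = mR[OF seq.hyps(1)] fL[OF seq.hyps(1)]
    have inc: "incseq (\<lambda>i. \<integral>\<^sup>+x. U i x \<partial>R \<omega>)" for \<omega>
      using seq.hyps(3) by (auto simp: incseq_def le_fun_def intro!: nn_integral_mono)
    have "(\<integral>\<^sup>+\<omega>. (\<integral>\<^sup>+x. (SUP i. U i) x \<partial>R \<omega>) * H \<omega> \<partial>M) = (\<integral>\<^sup>+\<omega>. (SUP i. (\<integral>\<^sup>+x. U i x \<partial>R \<omega>) * H \<omega>) \<partial>M)"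
    proof (rule nn_integral_cong)
      fix \<omega> assume \<omega>: "\<omega> \<in> space M"
      have "(\<integral>\<^sup>+x. (SUP i. U i) x \<partial>R \<omega>) = (SUP i. \<integral>\<^sup>+x. U i x \<partial>R \<omega>)"
        unfolding SUP_apply by (rule nn_integral_monotone_convergence_SUP[OF seq.hyps(3) fR[OF seq.hyps(1) \<omega>]])
      then show "(\<integral>\<^sup>+x. (SUP i. U i) x \<partial>R \<omega>) * H \<omega> = (SUP i. (\<integral>\<^sup>+x. U i x \<partial>R \<omega>) * H \<omega>)"
        by (simp add: SUP_mult_right_ennreal)
    qed
    also have "\<dots> = (SUP i. \<integral>\<^sup>+\<omega>. (\<integral>\<^sup>+x. U i x \<partial>R \<omega>) * H \<omega> \<partial>M)"
      using inc by (intro nn_integral_monotone_convergence_SUP)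
         (auto simp: incseq_def le_fun_def intro!: mult_right_mono)
    also have "\<dots> = (SUP i. \<integral>\<^sup>+x. U i x * G x \<partial>L)" by (simp add: seq.IH)
    also have "\<dots> = (\<integral>\<^sup>+x. (SUP i. U i x * G x) \<partial>L)"
      using seq.hyps(3) by (intro nn_integral_monotone_convergence_SUP[symmetric])
         (auto simp: incseq_def le_fun_def intro!: mult_right_mono)
    also have "\<dots> = (\<integral>\<^sup>+x. (SUP i. U i) x * G x \<partial>L)"
      unfolding SUP_apply SUP_mult_right_ennreal ..
    finally show ?case .
  qed
qed

text \<open>The second moment is bilinear in the pair of integrands, so that it suffices to apply the
  linear version in each of them.\<close>

lemma campbell_second:
  assumes sets: "\<And>\<omega>. \<omega> \<in> space M \<Longrightarrow> sets (R \<omega>) = sets N" and setsL: "sets L = sets N"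
    and meas: "\<And>B. B \<in> sets N \<Longrightarrow> (\<lambda>\<omega>. emeasure (R \<omega>) B) \<in> borel_measurable M"
    and E: "\<And>B C. B \<in> sets N \<Longrightarrow> C \<in> sets N \<Longrightarrow> (\<integral>\<^sup>+\<omega>. emeasure (R \<omega>) B * emeasure (R \<omega>) C \<partial>M)
        = emeasure L B * emeasure L C + emeasure L (B \<inter> C)"
    and f: "f \<in> borel_measurable N" and g: "g \<in> borel_measurable N"
  shows "(\<integral>\<^sup>+\<omega>. (\<integral>\<^sup>+x. f x \<partial>R \<omega>) * (\<integral>\<^sup>+x. g x \<partial>R \<omega>) \<partial>M)
    = (\<integral>\<^sup>+x. f x \<partial>L) * (\<integral>\<^sup>+x. g x \<partial>L) + (\<integral>\<^sup>+x. f x * g x \<partial>L)"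
proof -
  have fL: "h \<in> borel_measurable L" if "h \<in> borel_measurable N" for h :: "'b \<Rightarrow> ennreal"
    using that setsL by (simp cong: measurable_cong_sets)
  note [measurable] = fL[OF f] fL[OF g]
  have mR: "(\<lambda>\<omega>. \<integral>\<^sup>+x. h x \<partial>R \<omega>) \<in> borel_measurable M" if "h \<in> borel_measurable N" for h
    by (rule measurable_nn_integral_random_measure[OF sets meas that])
  have lin: "(\<integral>\<^sup>+x. h x * (C + k x) \<partial>L) = C * (\<integral>\<^sup>+x. h x \<partial>L) + (\<integral>\<^sup>+x. h x * k x \<partial>L)"
    if [measurable]: "h \<in> borel_measurable L" "k \<in> borel_measurable L" for h k :: "'b \<Rightarrow> ennreal" and C
    by (simp add: distrib_left nn_integral_add nn_integral_multc mult.commute[of C])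
  \<comment> \<open>The second factor is still a count. By the covariance formula on sets, weighting
    with the count of \<open>C\<close> produces the density
    \<open>emeasure L C + indicator C\<close> with respect to \<open>L\<close>.\<close>
  have one: "(\<integral>\<^sup>+\<omega>. (\<integral>\<^sup>+x. f x \<partial>R \<omega>) * emeasure (R \<omega>) C \<partial>M)
      = (\<integral>\<^sup>+x. f x * (emeasure L C + indicator C x) \<partial>L)" if C: "C \<in> sets N" for C
  proof (rule campbell_first[OF sets setsL meas meas[OF C] _ _ f])
    fix B assume B: "B \<in> sets N"
    have [measurable]: "B \<in> sets L" "C \<in> sets L" using B C setsL by auto
    have "(\<integral>\<^sup>+x. indicator B x * (emeasure L C + indicator C x) \<partial>L) = emeasure L C * emeasure L B + emeasure L (B \<inter> C)"
      by (subst lin) (auto simp: indicator_inter_arith[symmetric])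
    then show "(\<integral>\<^sup>+\<omega>. emeasure (R \<omega>) B * emeasure (R \<omega>) C \<partial>M) = (\<integral>\<^sup>+x. indicator B x * (emeasure L C + indicator C x) \<partial>L)"
      using E[OF B C] by (simp add: mult.commute)
  qed (use C in auto)
  \<comment> \<open>The roles are exchanged: the integral of \<open>f\<close> is now the weight, and
    the preceding formula is the hypothesis on sets.\<close>
  have "(\<integral>\<^sup>+\<omega>. (\<integral>\<^sup>+x. g x \<partial>R \<omega>) * (\<integral>\<^sup>+x. f x \<partial>R \<omega>) \<partial>M)
      = (\<integral>\<^sup>+x. g x * ((\<integral>\<^sup>+x. f x \<partial>L) + f x) \<partial>L)"
  proof (rule campbell_first[OF sets setsL meas mR[OF f] _ _ g])
    fix C assume C: "C \<in> sets N"
    have [measurable]: "C \<in> sets L" using C setsL by auto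
    show "(\<integral>\<^sup>+\<omega>. emeasure (R \<omega>) C * (\<integral>\<^sup>+x. f x \<partial>R \<omega>) \<partial>M) = (\<integral>\<^sup>+x. indicator C x * ((\<integral>\<^sup>+x. f x \<partial>L) + f x) \<partial>L)"
      using one[OF C] by (simp add: lin mult.commute)
  qed (use f in auto)
  then show ?thesis by (simp add: lin mult.commute)
qed

lemma sets_intensity: "sets \<rho> = sets borel \<Longrightarrow> sets (intensity \<rho>) = sets borel"
  unfolding intensity_def borel_prod[symmetric] by (intro sets_pair_measure_cong) auto

text \<open>The counts of the three pieces cut out by \<open>B\<close> and \<open>C\<close> are
  independent. Only the square of the common count, with the Poisson second moment
  \<open>m + m * m\<close>, adds a term to the product of the means.\<close>

lemma (in prob_space) poisson_measure_second_moment: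
  assumes P: "poisson_measure M \<rho> Q" and \<rho>: "sets \<rho> = sets borel"
    and B: "B \<in> sets borel" "emeasure (intensity \<rho>) B < \<infinity>" and C: "C \<in> sets borel" "emeasure (intensity \<rho>) C < \<infinity>"
  shows "(\<integral>\<^sup>+\<omega>. emeasure (Q \<omega>) B \<partial>M) = emeasure (intensity \<rho>) B"
    and "(\<integral>\<^sup>+\<omega>. emeasure (Q \<omega>) B * emeasure (Q \<omega>) C \<partial>M)
      = emeasure (intensity \<rho>) B * emeasure (intensity \<rho>) C + emeasure (intensity \<rho>) (B \<inter> C)"
proof -
  let ?e = "emeasure (intensity \<rho>)"
  have sQ: "sets (Q \<omega>) = sets borel" if "\<omega> \<in> space M" for \<omega>
    using P that by (auto simp: poisson_measure_def)
  have meas: "(\<lambda>\<omega>. emeasure (Q \<omega>) X) \<in> borel_measurable M" if "X \<in> sets borel" for X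
    using P that by (auto simp: poisson_measure_def)
  note sL = sets_intensity[OF \<rho>]
  have fin: "?e X < \<infinity>" if "X \<in> sets borel" "X \<subseteq> B \<or> X \<subseteq> C" for X
    using that B C emeasure_mono[of X B "intensity \<rho>"] emeasure_mono[of X C "intensity \<rho>"] sL
    by (auto intro: le_less_trans)
  have law: "(\<integral>\<^sup>+\<omega>. emeasure (Q \<omega>) X \<partial>M) = ?e X"
      "(\<integral>\<^sup>+\<omega>. emeasure (Q \<omega>) X * emeasure (Q \<omega>) X \<partial>M) = ?e X + ?e X * ?e X"
    if X: "X \<in> sets borel" "?e X < \<infinity>" for X
  proof -
    have "measure M {\<omega> \<in> space M. emeasure (Q \<omega>) X = of_nat k}
        = measure (intensity \<rho>) X ^ k / fact k * exp (- measure (intensity \<rho>) X)" for k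
      using P X by (auto simp: poisson_measure_def)
    note * = nn_integral_poisson_moments[OF meas[OF X(1)] _ this]
    have "ennreal (measure (intensity \<rho>) X) = ?e X" using X by (intro emeasure_eq_ennreal_measure[symmetric]) auto
    then show "(\<integral>\<^sup>+\<omega>. emeasure (Q \<omega>) X \<partial>M) = ?e X"
      "(\<integral>\<^sup>+\<omega>. emeasure (Q \<omega>) X * emeasure (Q \<omega>) X \<partial>M) = ?e X + ?e X * ?e X"
      using * by auto
  qed
  have ind: "(\<integral>\<^sup>+\<omega>. emeasure (Q \<omega>) X * emeasure (Q \<omega>) Y \<partial>M) = ?e X * ?e Y"
    if X: "X \<in> sets borel" "?e X < \<infinity>" and Y: "Y \<in> sets borel" "?e Y < \<infinity>" and XY: "X \<inter> Y = {}" for X Y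
  proof -
    \<comment> \<open>Independence is available for sequences of disjoint sets, hence the padding
      with empty sets.\<close>
    define S where "S k = (if k = 0 then X else if k = 1 then Y else {})" for k :: nat
    have "range S \<subseteq> sets borel \<and> disjoint_family S"
      using X Y XY by (auto simp: S_def disjoint_family_on_def)
    then have "indep_vars (\<lambda>_. borel) (\<lambda>k \<omega>. emeasure (Q \<omega>) (S k)) UNIV"
      using P by (auto simp: poisson_measure_def)
    then have "indep_vars (\<lambda>_. borel) (\<lambda>k \<omega>. emeasure (Q \<omega>) (S k)) {0, 1}"
      by (rule indep_vars_subset) simp
    from indep_vars_nn_integral[OF _ this]
    show ?thesis using law X Y by (simp add: S_def)
  qed
  show "(\<integral>\<^sup>+\<omega>. emeasure (Q \<omega>) B \<partial>M) = ?e B" by (rule law(1)[OF B])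
  define B1 D C1 where "B1 = B - C" and "D = B \<inter> C" and "C1 = C - B"
  have s: "B1 \<in> sets borel" "D \<in> sets borel" "C1 \<in> sets borel" using B C by (auto simp: B1_def D_def C1_def)
  have f: "?e B1 < \<infinity>" "?e D < \<infinity>" "?e C1 < \<infinity>" using fin s by (auto simp: B1_def D_def C1_def)
  have split: "emeasure N B = emeasure N B1 + emeasure N D" "emeasure N C = emeasure N D + emeasure N C1"
    if "sets N = sets borel" for N :: "(real \<times> real) measure"
  proof -
    have "emeasure N (B1 \<union> D) = emeasure N B1 + emeasure N D" "emeasure N (D \<union> C1) = emeasure N D + emeasure N C1"
      using s that by (intro plus_emeasure[symmetric]; auto simp: B1_def D_def C1_def)+
    moreover have "B1 \<union> D = B" "D \<union> C1 = C" by (auto simp: B1_def D_def C1_def)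
    ultimately show "emeasure N B = emeasure N B1 + emeasure N D" "emeasure N C = emeasure N D + emeasure N C1" by simp_all
  qed
  have dj: "B1 \<inter> D = {}" "B1 \<inter> C1 = {}" "D \<inter> C1 = {}" by (auto simp: B1_def D_def C1_def)
  note [measurable] = meas[OF s(1)] meas[OF s(2)] meas[OF s(3)]
  have "(\<integral>\<^sup>+\<omega>. emeasure (Q \<omega>) B * emeasure (Q \<omega>) C \<partial>M)
    = (\<integral>\<^sup>+\<omega>. (emeasure (Q \<omega>) B1 * emeasure (Q \<omega>) D + emeasure (Q \<omega>) B1 * emeasure (Q \<omega>) C1)
        + (emeasure (Q \<omega>) D * emeasure (Q \<omega>) D + emeasure (Q \<omega>) D * emeasure (Q \<omega>) C1) \<partial>M)"
    by (intro nn_integral_cong) (simp add: split[OF sQ] distrib_left distrib_right add_ac)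
  also have "\<dots> = (?e B1 * ?e D + ?e B1 * ?e C1) + ((?e D + ?e D * ?e D) + ?e D * ?e C1)"
    by (simp add: nn_integral_add ind[OF s(1) f(1) s(2) f(2) dj(1)] ind[OF s(1) f(1) s(3) f(3) dj(2)]
      ind[OF s(2) f(2) s(3) f(3) dj(3)] law(2)[OF s(2) f(2)])
  also have "\<dots> = ?e B * ?e C + ?e (B \<inter> C)"
    by (simp add: split[OF sL] D_def[symmetric] distrib_left distrib_right add_ac)
  finally show "(\<integral>\<^sup>+\<omega>. emeasure (Q \<omega>) B * emeasure (Q \<omega>) C \<partial>M) = ?e B * ?e C + ?e (B \<inter> C)" .
qed

text \<open>The Poisson law is given on sets of finite intensity. After restriction of both measures
  to \<open>K\<close> it is available for every Borel set, as the Campbell formulas require.\<close>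

lemma (in prob_space) poisson_campbell:
  fixes f g :: "real \<times> real \<Rightarrow> ennreal"
  assumes P: "poisson_measure M \<rho> Q" and \<rho>: "sets \<rho> = sets borel"
    and K: "K \<in> sets borel" "emeasure (intensity \<rho>) K < \<infinity>"
    and f: "f \<in> borel_measurable borel" and g: "g \<in> borel_measurable borel"
  shows "(\<integral>\<^sup>+\<omega>. (\<integral>\<^sup>+x. indicator K x * f x \<partial>Q \<omega>) \<partial>M) = (\<integral>\<^sup>+x. indicator K x * f x \<partial>intensity \<rho>)"
    and "(\<integral>\<^sup>+\<omega>. (\<integral>\<^sup>+x. indicator K x * f x \<partial>Q \<omega>) * (\<integral>\<^sup>+x. indicator K x * g x \<partial>Q \<omega>) \<partial>M)
      = (\<integral>\<^sup>+x. indicator K x * f x \<partial>intensity \<rho>) * (\<integral>\<^sup>+x. indicator K x * g x \<partial>intensity \<rho>)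
        + (\<integral>\<^sup>+x. indicator K x * (f x * g x) \<partial>intensity \<rho>)"
proof -
  define R where "R \<omega> = density (Q \<omega>) (indicator K)" for \<omega>
  define L where "L = density (intensity \<rho>) (indicator K)"
  note sI = sets_intensity[OF \<rho>]
  have sQ: "sets (Q \<omega>) = sets borel" if "\<omega> \<in> space M" for \<omega>
    using P that by (auto simp: poisson_measure_def)
  have sR: "sets (R \<omega>) = sets borel" if "\<omega> \<in> space M" for \<omega>
    using sQ[OF that] by (simp add: R_def)
  have sL: "sets L = sets borel" using sI by (simp add: L_def)
  have eR: "emeasure (R \<omega>) B = emeasure (Q \<omega>) (K \<inter> B)" if "B \<in> sets borel" "\<omega> \<in> space M" for B \<omega>
    unfolding R_def using that K sQ by (intro emeasure_restricted) auto
  have eL: "emeasure L B = emeasure (intensity \<rho>) (K \<inter> B)" if "B \<in> sets borel" for B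
    unfolding L_def using that K sI by (intro emeasure_restricted) auto
  have nR: "(\<integral>\<^sup>+x. h x \<partial>R \<omega>) = (\<integral>\<^sup>+x. indicator K x * h x \<partial>Q \<omega>)"
    if "h \<in> borel_measurable borel" "\<omega> \<in> space M" for h :: "real \<times> real \<Rightarrow> ennreal" and \<omega>
    unfolding R_def using that K sQ[OF that(2)] by (intro nn_integral_density) (auto cong: measurable_cong_sets)
  have nL: "(\<integral>\<^sup>+x. h x \<partial>L) = (\<integral>\<^sup>+x. indicator K x * h x \<partial>intensity \<rho>)"
    if "h \<in> borel_measurable borel" for h :: "real \<times> real \<Rightarrow> ennreal"
    unfolding L_def using that K sI by (intro nn_integral_density) (auto cong: measurable_cong_sets)
  have fin: "emeasure (intensity \<rho>) (K \<inter> B) < \<infinity>" if "B \<in> sets borel" for B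
    using K emeasure_mono[of "K \<inter> B" K "intensity \<rho>"] sI by (auto intro: le_less_trans)
  have mR: "(\<lambda>\<omega>. emeasure (R \<omega>) B) \<in> borel_measurable M" if "B \<in> sets borel" for B
  proof -
    have "(\<lambda>\<omega>. emeasure (Q \<omega>) (K \<inter> B)) \<in> borel_measurable M"
      using P K that by (auto simp: poisson_measure_def)
    then show ?thesis using eR[OF that] by (simp cong: measurable_cong)
  qed
  have E1: "(\<integral>\<^sup>+\<omega>. emeasure (R \<omega>) B * 1 \<partial>M) = (\<integral>\<^sup>+x. indicator B x * 1 \<partial>L)" if B: "B \<in> sets borel" for B
  proof -
    have "(\<integral>\<^sup>+\<omega>. emeasure (R \<omega>) B \<partial>M) = (\<integral>\<^sup>+\<omega>. emeasure (Q \<omega>) (K \<inter> B) \<partial>M)"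
      using eR[OF B] by (intro nn_integral_cong) simp
    also have "\<dots> = emeasure L B"
      unfolding eL[OF B]
      by (rule poisson_measure_second_moment(1)[OF P \<rho> _ fin[OF B] _ fin[OF B]]) (use K B in auto)
    finally show ?thesis using B sL by simp
  qed
  have E2: "(\<integral>\<^sup>+\<omega>. emeasure (R \<omega>) B * emeasure (R \<omega>) C \<partial>M)
     = emeasure L B * emeasure L C + emeasure L (B \<inter> C)" if B: "B \<in> sets borel" and C: "C \<in> sets borel" for B C
  proof -
    have "(\<integral>\<^sup>+\<omega>. emeasure (R \<omega>) B * emeasure (R \<omega>) C \<partial>M)
      = (\<integral>\<^sup>+\<omega>. emeasure (Q \<omega>) (K \<inter> B) * emeasure (Q \<omega>) (K \<inter> C) \<partial>M)"
      using eR[OF B] eR[OF C] by (intro nn_integral_cong) simp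
    also have "\<dots> = emeasure (intensity \<rho>) (K \<inter> B) * emeasure (intensity \<rho>) (K \<inter> C)
        + emeasure (intensity \<rho>) ((K \<inter> B) \<inter> (K \<inter> C))"
      by (rule poisson_measure_second_moment(2)[OF P \<rho> _ fin[OF B] _ fin[OF C]]) (use K B C in auto)
    also have "(K \<inter> B) \<inter> (K \<inter> C) = K \<inter> (B \<inter> C)" by auto
    finally show ?thesis using B C by (simp add: eL)
  qed
  have fg: "(\<lambda>x. f x * g x) \<in> borel_measurable borel" using f g by measurable
  have "(\<integral>\<^sup>+\<omega>. (\<integral>\<^sup>+x. f x \<partial>R \<omega>) * 1 \<partial>M) = (\<integral>\<^sup>+x. f x * 1 \<partial>L)"
    by (rule campbell_first[OF sR sL mR _ E1 _ f]) auto
  moreover have "(\<integral>\<^sup>+\<omega>. (\<integral>\<^sup>+x. f x \<partial>R \<omega>) \<partial>M) = (\<integral>\<^sup>+\<omega>. (\<integral>\<^sup>+x. indicator K x * f x \<partial>Q \<omega>) \<partial>M)"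
    by (intro nn_integral_cong nR[OF f])
  ultimately show "(\<integral>\<^sup>+\<omega>. (\<integral>\<^sup>+x. indicator K x * f x \<partial>Q \<omega>) \<partial>M) = (\<integral>\<^sup>+x. indicator K x * f x \<partial>intensity \<rho>)"
    by (simp add: nL[OF f])
  have "(\<integral>\<^sup>+\<omega>. (\<integral>\<^sup>+x. f x \<partial>R \<omega>) * (\<integral>\<^sup>+x. g x \<partial>R \<omega>) \<partial>M)
    = (\<integral>\<^sup>+x. f x \<partial>L) * (\<integral>\<^sup>+x. g x \<partial>L) + (\<integral>\<^sup>+x. f x * g x \<partial>L)"
    by (rule campbell_second[OF sR sL mR E2 f g])
  moreover have "(\<integral>\<^sup>+\<omega>. (\<integral>\<^sup>+x. f x \<partial>R \<omega>) * (\<integral>\<^sup>+x. g x \<partial>R \<omega>) \<partial>M)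
     = (\<integral>\<^sup>+\<omega>. (\<integral>\<^sup>+x. indicator K x * f x \<partial>Q \<omega>) * (\<integral>\<^sup>+x. indicator K x * g x \<partial>Q \<omega>) \<partial>M)"
    by (intro nn_integral_cong) (simp add: nR[OF f] nR[OF g])
  ultimately show "(\<integral>\<^sup>+\<omega>. (\<integral>\<^sup>+x. indicator K x * f x \<partial>Q \<omega>) * (\<integral>\<^sup>+x. indicator K x * g x \<partial>Q \<omega>) \<partial>M)
      = (\<integral>\<^sup>+x. indicator K x * f x \<partial>intensity \<rho>) * (\<integral>\<^sup>+x. indicator K x * g x \<partial>intensity \<rho>)
        + (\<integral>\<^sup>+x. indicator K x * (f x * g x) \<partial>intensity \<rho>)"
    by (simp add: nL[OF f] nL[OF g] nL[OF fg])
qed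

text \<open>Formulated for an arbitrary sigma-algebra and for counts inside \<open>K\<close> only,
  so that it yields measurability with respect to the past and the future as well as the whole
  space.\<close>

lemma measurable_restricted_random_integral:
  fixes f :: "real \<times> real \<Rightarrow> ennreal"
  assumes sQ: "\<And>\<omega>. \<omega> \<in> space N \<Longrightarrow> sets (Q \<omega>) = sets borel"
    and m: "\<And>A. A \<in> sets borel \<Longrightarrow> A \<subseteq> K \<Longrightarrow> (\<lambda>\<omega>. emeasure (Q \<omega>) A) \<in> borel_measurable N"
    and K: "K \<in> sets borel" and f: "f \<in> borel_measurable borel"
  shows "(\<lambda>\<omega>. \<integral>\<^sup>+x. indicator K x * f x \<partial>Q \<omega>) \<in> borel_measurable N"
proof -
  define R where "R \<omega> = density (Q \<omega>) (indicator K)" for \<omega>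
  have sR: "sets (R \<omega>) = sets borel" if "\<omega> \<in> space N" for \<omega>
    using sQ[OF that] by (simp add: R_def)
  have "(\<lambda>\<omega>. \<integral>\<^sup>+x. f x \<partial>R \<omega>) \<in> borel_measurable N"
  proof (rule measurable_nn_integral_random_measure[OF sR _ f])
    fix B :: "(real \<times> real) set" assume B: "B \<in> sets borel"
    have "emeasure (R \<omega>) B = emeasure (Q \<omega>) (K \<inter> B)" if "\<omega> \<in> space N" for \<omega>
      unfolding R_def using that K B sQ by (intro emeasure_restricted) auto
    moreover have "(\<lambda>\<omega>. emeasure (Q \<omega>) (K \<inter> B)) \<in> borel_measurable N" using K B by (intro m) auto
    ultimately show "(\<lambda>\<omega>. emeasure (R \<omega>) B) \<in> borel_measurable N" by (simp cong: measurable_cong)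
  qed auto
  moreover have "(\<integral>\<^sup>+x. f x \<partial>R \<omega>) = (\<integral>\<^sup>+x. indicator K x * f x \<partial>Q \<omega>)" if "\<omega> \<in> space N" for \<omega>
    unfolding R_def using that K f sQ[OF that] by (intro nn_integral_density) (auto cong: measurable_cong_sets)
  ultimately show ?thesis by (simp cong: measurable_cong)
qed

context prob_space
begin

section \<open>Centering of extended nonnegative random variables\<close>

lemma enn2real_moments:
  fixes S :: "'a \<Rightarrow> ennreal"
  assumes S: "S \<in> borel_measurable M" and m: "(\<integral>\<^sup>+\<omega>. S \<omega> \<partial>M) = m" "m < \<top>"
  shows "AE \<omega> in M. S \<omega> < \<top>" "integrable M (\<lambda>\<omega>. enn2real (S \<omega>))" "(\<integral>\<omega>. enn2real (S \<omega>) \<partial>M) = enn2real m"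
proof -
  show AE1: "AE \<omega> in M. S \<omega> < \<top>"
    using nn_integral_PInf_AE[OF S] m by (auto simp: less_top elim: eventually_mono)
  have e: "(\<integral>\<^sup>+\<omega>. ennreal (enn2real (S \<omega>)) \<partial>M) = m"
    unfolding m(1)[symmetric] using AE1 by (intro nn_integral_cong_AE) (auto elim: eventually_mono)
  show "integrable M (\<lambda>\<omega>. enn2real (S \<omega>))"
    using S m(2) e by (intro integrableI_bounded) auto
  show "(\<integral>\<omega>. enn2real (S \<omega>) \<partial>M) = enn2real m"
    using S e by (subst integral_eq_nn_integral) auto
qed

lemma centered_square_integrable:
  fixes S :: "'a \<Rightarrow> ennreal"
  assumes S: "S \<in> borel_measurable M" and m: "(\<integral>\<^sup>+\<omega>. S \<omega> \<partial>M) = m" "m < \<top>"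
    and q: "(\<integral>\<^sup>+\<omega>. S \<omega> * S \<omega> \<partial>M) = m * m + q" "q < \<top>"
  shows "square_integrable M (\<lambda>\<omega>. enn2real (S \<omega>))"
    and "square_integrable M (\<lambda>\<omega>. enn2real (S \<omega>) - enn2real m)"
    and "(\<integral>\<omega>. enn2real (S \<omega>) - enn2real m \<partial>M) = 0"
proof -
  have "integrable M (\<lambda>\<omega>. enn2real (S \<omega> * S \<omega>))"
    using S m q by (intro enn2real_moments(2)[of _ "m * m + q"]) (auto simp: ennreal_mult_less_top)
  then show 1: "square_integrable M (\<lambda>\<omega>. enn2real (S \<omega>))"
    using S by (simp add: square_integrable_def power2_eq_square enn2real_mult)
  have "square_integrable M (\<lambda>_::'a. enn2real m)" by (simp add: square_integrable_def)
  from square_integrable_diff[OF 1 this] show "square_integrable M (\<lambda>\<omega>. enn2real (S \<omega>) - enn2real m)" .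
  show "(\<integral>\<omega>. enn2real (S \<omega>) - enn2real m \<partial>M) = 0"
    using enn2real_moments[OF S m] by (simp add: prob_space)
qed

lemma centered_covariance:
  fixes S S' :: "'a \<Rightarrow> ennreal"
  assumes S: "S \<in> borel_measurable M" and m: "(\<integral>\<^sup>+\<omega>. S \<omega> \<partial>M) = m" "m < \<top>"
    and S': "S' \<in> borel_measurable M" and m': "(\<integral>\<^sup>+\<omega>. S' \<omega> \<partial>M) = m'" "m' < \<top>"
    and r: "(\<integral>\<^sup>+\<omega>. S \<omega> * S' \<omega> \<partial>M) = m * m' + r" "r < \<top>"
  shows "(\<integral>\<omega>. (enn2real (S \<omega>) - enn2real m) * (enn2real (S' \<omega>) - enn2real m') \<partial>M) = enn2real r"
proof -
  have fin: "m * m' < \<top>" using m m' by (simp add: ennreal_mult_less_top)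
  have SS: "(\<lambda>\<omega>. S \<omega> * S' \<omega>) \<in> borel_measurable M" using S S' by measurable
  have lt: "m * m' + r < \<top>" using fin r by simp
  note p = enn2real_moments[OF SS r(1) lt]
  have "(\<integral>\<omega>. (enn2real (S \<omega>) - enn2real m) * (enn2real (S' \<omega>) - enn2real m') \<partial>M)
    = (\<integral>\<omega>. enn2real (S \<omega> * S' \<omega>) - enn2real m * enn2real (S' \<omega>) - enn2real m' * enn2real (S \<omega>) + enn2real m * enn2real m' \<partial>M)"
    by (intro Bochner_Integration.integral_cong) (auto simp: algebra_simps enn2real_mult)
  also have "\<dots> = enn2real (m * m' + r) - enn2real m * enn2real m' - enn2real m' * enn2real m + enn2real m * enn2real m'"
    using p enn2real_moments[OF S m] enn2real_moments[OF S' m'] by (simp add: prob_space)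
  also have "enn2real (m * m' + r) = enn2real m * enn2real m' + enn2real r"
    using fin r by (simp add: enn2real_plus enn2real_mult)
  finally show ?thesis by simp
qed

end

lemma sigma_finite_positive_time: "sigma_finite_measure (density lborel (indicator {0<..} :: real \<Rightarrow> ennreal))"
  by (subst sigma_finite_measure.sigma_finite_iff_density_finite[OF sigma_finite_lborel]) (auto simp: indicator_def)

text \<open>Tonelli with time integrated first, for which it suffices that the time factor is
  sigma-finite. The restriction to positive times disappears because
  \<open>0 \<le> s\<close>.\<close>

lemma nn_integral_intensity:
  assumes \<rho>: "sets \<rho> = sets borel" and h: "h \<in> borel_measurable borel" and E: "E \<in> sets borel" and s: "0 \<le> s" "s \<le> t"
  shows "(\<integral>\<^sup>+x. indicator (E \<times> {s<..t}) x * h (fst x) \<partial>intensity \<rho>)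
    = (\<integral>\<^sup>+v. indicator E v * h v \<partial>\<rho>) * ennreal (t - s)"
proof -
  interpret T: sigma_finite_measure "density lborel (indicator {0<..} :: real \<Rightarrow> ennreal)"
    by (rule sigma_finite_positive_time)
  have h\<rho> [measurable]: "h \<in> borel_measurable \<rho>" using h \<rho> by (simp cong: measurable_cong_sets)
  have E\<rho> [measurable]: "E \<in> sets \<rho>" using E \<rho> by simp
  have m: "(\<lambda>x. indicator (E \<times> {s<..t}) x * h (fst x)) \<in> borel_measurable (\<rho> \<Otimes>\<^sub>M density lborel (indicator {0<..}))"
    by measurable
  have "(\<integral>\<^sup>+x. indicator (E \<times> {s<..t}) x * h (fst x) \<partial>intensity \<rho>)
    = (\<integral>\<^sup>+v. (\<integral>\<^sup>+u. indicator (E \<times> {s<..t}) (v, u) * h v \<partial>density lborel (indicator {0<..})) \<partial>\<rho>)"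
    unfolding intensity_def using T.nn_integral_fst[OF m] by simp
  also have "\<dots> = (\<integral>\<^sup>+v. (indicator E v * h v) * ennreal (t - s) \<partial>\<rho>)"
  proof (rule nn_integral_cong)
    fix v
    have "(\<integral>\<^sup>+u. indicator (E \<times> {s<..t}) (v, u) * h v \<partial>density lborel (indicator {0<..}))
       = (\<integral>\<^sup>+u. indicator {0<..} u * (indicator (E \<times> {s<..t}) (v, u) * h v) \<partial>lborel)"
      by (rule nn_integral_density) measurable
    also have "\<dots> = (\<integral>\<^sup>+u. (indicator E v * h v) * indicator {s<..t} u \<partial>lborel)"
      using s by (intro nn_integral_cong) (auto simp: indicator_def)
    also have "\<dots> = (indicator E v * h v) * ennreal (t - s)"
      using s by (simp add: nn_integral_cmult_indicator)
    finally show "(\<integral>\<^sup>+u. indicator (E \<times> {s<..t}) (v, u) * h v \<partial>density lborel (indicator {0<..}))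
       = (indicator E v * h v) * ennreal (t - s)" .
  qed
  also have "\<dots> = (\<integral>\<^sup>+v. indicator E v * h v \<partial>\<rho>) * ennreal (t - s)"
    by (rule nn_integral_multc) measurable
  finally show ?thesis .
qed

section \<open>The increments of the driving processes\<close>

text \<open>Since \<open>ennreal\<close> sends negative numbers to 0, this is the positive part of
  \<open>v ^ p\<close> for \<open>True\<close> and the negative part for
  \<open>False\<close>.\<close>

definition signed_power :: "nat \<Rightarrow> bool \<Rightarrow> real \<Rightarrow> ennreal" where
  "signed_power p b v = ennreal (if b then v ^ p else - (v ^ p))"

lemma signed_power_measurable [measurable]: "signed_power p b \<in> borel_measurable borel"
  unfolding signed_power_def by (cases b) auto

lemma indicator_signed_power:
  "ennreal (indicat_real E y *\<^sub>R v ^ p) = indicator E y * signed_power p True v"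
  "ennreal (- (indicat_real E y *\<^sub>R v ^ p)) = indicator E y * signed_power p False v"
  by (auto simp: indicator_def signed_power_def)

definition large_jumps :: "real \<Rightarrow> real set" where
  "large_jumps \<epsilon> = {v. \<epsilon> < \<bar>v\<bar>}"

lemma large_jumps_borel [measurable]: "large_jumps \<epsilon> \<in> sets borel"
  unfolding large_jumps_def by measurable

lemma large_jumps_Times_borel: "large_jumps \<epsilon> \<times> {s<..t :: real} \<in> sets borel"
  unfolding borel_prod[symmetric] by (rule pair_measureI) auto

context levy_drivers
begin

sublocale filtered_prob_space M F
  by unfold_locales (rule subalgebra_F)

definition jump_sum :: "nat \<Rightarrow> nat \<Rightarrow> bool \<Rightarrow> real \<Rightarrow> real \<Rightarrow> real \<Rightarrow> 'a \<Rightarrow> ennreal" where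
  "jump_sum i p b \<epsilon> s t \<omega> = (\<integral>\<^sup>+x. indicator (large_jumps \<epsilon> \<times> {s<..t}) x * signed_power p b (fst x) \<partial>Q i \<omega>)"

definition jump_mean :: "nat \<Rightarrow> nat \<Rightarrow> bool \<Rightarrow> real \<Rightarrow> ennreal" where
  "jump_mean i p b \<epsilon> = (\<integral>\<^sup>+v. indicator (large_jumps \<epsilon>) v * signed_power p b v \<partial>\<rho> i)"

definition jump_cov :: "nat \<Rightarrow> nat \<Rightarrow> bool \<Rightarrow> nat \<Rightarrow> bool \<Rightarrow> real \<Rightarrow> ennreal" where
  "jump_cov i p b q b' \<epsilon> = (\<integral>\<^sup>+v. indicator (large_jumps \<epsilon>) v * (signed_power p b v * signed_power q b' v) \<partial>\<rho> i)"

text \<open>The compensated sum of the \<open>p\<close>-th powers of the jumps larger than \<open>\<epsilon>\<close> in \<open>(s, t]\<close>, split into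
  its positive and negative part, so that only nonnegative integrals occur.\<close>

definition jump_part :: "nat \<Rightarrow> nat \<Rightarrow> bool \<Rightarrow> real \<Rightarrow> real \<Rightarrow> real \<Rightarrow> 'a \<Rightarrow> real" where
  "jump_part i p b \<epsilon> s t \<omega> = enn2real (jump_sum i p b \<epsilon> s t \<omega>) - enn2real (jump_mean i p b \<epsilon> * ennreal (t - s))"

definition jump_incr :: "nat \<Rightarrow> nat \<Rightarrow> real \<Rightarrow> real \<Rightarrow> real \<Rightarrow> 'a \<Rightarrow> real" where
  "jump_incr i p \<epsilon> s t \<omega> = jump_part i p True \<epsilon> s t \<omega> - jump_part i p False \<epsilon> s t \<omega>"

definition jump_incr_cov :: "nat \<Rightarrow> nat \<Rightarrow> nat \<Rightarrow> real \<Rightarrow> real" where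
  "jump_incr_cov i p q \<epsilon> = enn2real (jump_cov i p True q True \<epsilon>) - enn2real (jump_cov i p True q False \<epsilon>)
     - enn2real (jump_cov i p False q True \<epsilon>) + enn2real (jump_cov i p False q False \<epsilon>)"

context
  fixes i :: nat and \<epsilon> :: real
  assumes i: "i \<in> {d<..l}" and \<epsilon>: "0 < \<epsilon>"
begin

section \<open>Moments of the compensated large jumps\<close>

lemma sets_rho: "sets (\<rho> i) = sets borel"
  using levy[OF i] by (simp add: levy_measure_def)

lemma sets_Q: "\<omega> \<in> space M \<Longrightarrow> sets (Q i \<omega>) = sets borel"
  using poisson[OF i] by (simp add: poisson_measure_def)

lemma power_integrable:
  assumes "1 \<le> p"
  shows "integrable (\<rho> i) (\<lambda>v. indicat_real (large_jumps \<epsilon>) v *\<^sub>R v ^ p)"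
  using jumps[OF i assms] \<epsilon> by (auto simp: compensated_integral_def set_integrable_def large_jumps_def)

lemma power_finite:
  assumes "1 \<le> p"
  shows "(\<integral>\<^sup>+v. indicator (large_jumps \<epsilon>) v * ennreal \<bar>v ^ p\<bar> \<partial>\<rho> i) < \<top>"
proof -
  have "(\<integral>\<^sup>+v. indicator (large_jumps \<epsilon>) v * ennreal \<bar>v ^ p\<bar> \<partial>\<rho> i)
     = (\<integral>\<^sup>+v. ennreal (norm (indicat_real (large_jumps \<epsilon>) v *\<^sub>R v ^ p)) \<partial>\<rho> i)"
    by (intro nn_integral_cong) (auto simp: indicator_def)
  then show ?thesis using power_integrable[OF assms] by (simp add: integrable_iff_bounded)
qed

lemma jump_mean_finite:
  assumes "1 \<le> p"
  shows "jump_mean i p b \<epsilon> < \<top>"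
proof -
  have "jump_mean i p b \<epsilon> \<le> (\<integral>\<^sup>+v. indicator (large_jumps \<epsilon>) v * ennreal \<bar>v ^ p\<bar> \<partial>\<rho> i)"
    unfolding jump_mean_def signed_power_def
    by (intro nn_integral_mono mult_left_mono ennreal_leI) auto
  then show ?thesis using power_finite[OF assms] by (rule le_less_trans)
qed

text \<open>The product of two parts is at most \<open>\<bar>v ^ (p + q)\<bar>\<close>, again a
  power that is integrable over the large jumps.\<close>

lemma jump_cov_finite:
  assumes "1 \<le> p"
  shows "jump_cov i p b q b' \<epsilon> < \<top>"
proof -
  have "signed_power p b v * signed_power q b' v \<le> ennreal \<bar>v ^ (p + q)\<bar>" for v
  proof -
    have "signed_power p b v * signed_power q b' v \<le> ennreal \<bar>v ^ p\<bar> * ennreal \<bar>v ^ q\<bar>"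
      unfolding signed_power_def by (intro mult_mono ennreal_leI) auto
    also have "\<dots> = ennreal \<bar>v ^ (p + q)\<bar>" by (simp add: ennreal_mult power_add abs_mult)
    finally show ?thesis .
  qed
  then have "jump_cov i p b q b' \<epsilon> \<le> (\<integral>\<^sup>+v. indicator (large_jumps \<epsilon>) v * ennreal \<bar>v ^ (p + q)\<bar> \<partial>\<rho> i)"
    unfolding jump_cov_def by (intro nn_integral_mono mult_left_mono) auto
  then show ?thesis using power_finite[of "p + q"] assms by (auto intro: le_less_trans)
qed

text \<open>On the large jumps \<open>1 \<le> \<bar>v\<bar> / \<epsilon>\<close>, so the first
  absolute moment over them bounds their mass.\<close>

lemma large_jumps_intensity_finite:
  assumes s: "0 \<le> s" "s \<le> t"
  shows "emeasure (intensity (\<rho> i)) (large_jumps \<epsilon> \<times> {s<..t}) < \<infinity>"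
proof -
  have B: "large_jumps \<epsilon> \<times> {s<..t} \<in> sets (intensity (\<rho> i))"
    using large_jumps_Times_borel sets_intensity[OF sets_rho] by simp
  have mp: "(\<lambda>v. indicator (large_jumps \<epsilon>) v * ennreal \<bar>v ^ 1\<bar>) \<in> borel_measurable (\<rho> i)"
    using sets_rho by (simp cong: measurable_cong_sets)
  have "(\<integral>\<^sup>+v. indicator (large_jumps \<epsilon>) v * 1 \<partial>\<rho> i)
     \<le> (\<integral>\<^sup>+v. ennreal (1 / \<epsilon>) * (indicator (large_jumps \<epsilon>) v * ennreal \<bar>v ^ 1\<bar>) \<partial>\<rho> i)"
  proof (rule nn_integral_mono)
    fix v :: real
    show "indicator (large_jumps \<epsilon>) v * 1 \<le> ennreal (1 / \<epsilon>) * (indicator (large_jumps \<epsilon>) v * ennreal \<bar>v ^ 1\<bar>)"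
    proof (cases "v \<in> large_jumps \<epsilon>")
      case True
      then have "1 \<le> 1 / \<epsilon> * \<bar>v\<bar>" using \<epsilon> by (simp add: large_jumps_def field_simps)
      then have "ennreal 1 \<le> ennreal (1 / \<epsilon> * \<bar>v\<bar>)" by (rule ennreal_leI)
      then show ?thesis using True \<epsilon> by (simp add: ennreal_mult[symmetric])
    qed simp
  qed
  also have "\<dots> = ennreal (1 / \<epsilon>) * (\<integral>\<^sup>+v. indicator (large_jumps \<epsilon>) v * ennreal \<bar>v ^ 1\<bar> \<partial>\<rho> i)"
    by (rule nn_integral_cmult[OF mp])
  also have "\<dots> < \<top>" using power_finite[of 1] by (simp add: ennreal_mult_less_top)
  finally have f: "(\<integral>\<^sup>+v. indicator (large_jumps \<epsilon>) v * 1 \<partial>\<rho> i) < \<top>" .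
  have "emeasure (intensity (\<rho> i)) (large_jumps \<epsilon> \<times> {s<..t})
     = (\<integral>\<^sup>+x. indicator (large_jumps \<epsilon> \<times> {s<..t}) x * 1 \<partial>intensity (\<rho> i))"
    using B by simp
  also have "\<dots> = (\<integral>\<^sup>+v. indicator (large_jumps \<epsilon>) v * 1 \<partial>\<rho> i) * ennreal (t - s)"
    by (rule nn_integral_intensity[OF sets_rho _ _ s]) auto
  also have "\<dots> < \<top>" using f by (simp add: ennreal_mult_less_top)
  finally show ?thesis by simp
qed

lemma jump_sum_measurable:
  assumes "\<And>A. A \<in> sets borel \<Longrightarrow> A \<subseteq> large_jumps \<epsilon> \<times> {s<..t} \<Longrightarrow> (\<lambda>\<omega>. emeasure (Q i \<omega>) A) \<in> borel_measurable N"
    and "space N = space M"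
  shows "jump_sum i p b \<epsilon> s t \<in> borel_measurable N"
  unfolding jump_sum_def
proof (rule measurable_restricted_random_integral[OF _ _ large_jumps_Times_borel])
  show "(\<lambda>x :: real \<times> real. signed_power p b (fst x)) \<in> borel_measurable borel"
    unfolding borel_prod[symmetric] by measurable
qed (use assms sets_Q in auto)

lemma jump_sum_measurable_M [measurable]: "jump_sum i p b \<epsilon> s t \<in> borel_measurable M"
  by (rule jump_sum_measurable) (use poisson[OF i] in \<open>auto simp: poisson_measure_def\<close>)

lemma jump_sum_moments:
  assumes s: "0 \<le> s" "s \<le> t"
  shows "(\<integral>\<^sup>+\<omega>. jump_sum i p b \<epsilon> s t \<omega> \<partial>M) = jump_mean i p b \<epsilon> * ennreal (t - s)"
    and "(\<integral>\<^sup>+\<omega>. jump_sum i p b \<epsilon> s t \<omega> * jump_sum i q b' \<epsilon> s t \<omega> \<partial>M)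
      = (jump_mean i p b \<epsilon> * ennreal (t - s)) * (jump_mean i q b' \<epsilon> * ennreal (t - s)) + jump_cov i p b q b' \<epsilon> * ennreal (t - s)"
proof -
  have m: "(\<lambda>x :: real \<times> real. signed_power p b (fst x)) \<in> borel_measurable borel" for p b
    unfolding borel_prod[symmetric] by measurable
  note pc = poisson_campbell[OF poisson[OF i] sets_rho large_jumps_Times_borel large_jumps_intensity_finite[OF s] m m]
  note ni = nn_integral_intensity[OF sets_rho _ large_jumps_borel s]
  show "(\<integral>\<^sup>+\<omega>. jump_sum i p b \<epsilon> s t \<omega> \<partial>M) = jump_mean i p b \<epsilon> * ennreal (t - s)"
    unfolding jump_sum_def jump_mean_def pc(1) by (rule ni) auto
  have "(\<integral>\<^sup>+x. indicator (large_jumps \<epsilon> \<times> {s<..t}) x * (signed_power p b (fst x) * signed_power q b' (fst x)) \<partial>intensity (\<rho> i))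
     = jump_cov i p b q b' \<epsilon> * ennreal (t - s)"
    unfolding jump_cov_def by (rule ni) auto
  moreover have "(\<integral>\<^sup>+x. indicator (large_jumps \<epsilon> \<times> {s<..t}) x * signed_power p b (fst x) \<partial>intensity (\<rho> i))
     = jump_mean i p b \<epsilon> * ennreal (t - s)" for p b
    unfolding jump_mean_def by (rule ni) auto
  ultimately show "(\<integral>\<^sup>+\<omega>. jump_sum i p b \<epsilon> s t \<omega> * jump_sum i q b' \<epsilon> s t \<omega> \<partial>M)
      = (jump_mean i p b \<epsilon> * ennreal (t - s)) * (jump_mean i q b' \<epsilon> * ennreal (t - s)) + jump_cov i p b q b' \<epsilon> * ennreal (t - s)"
    unfolding jump_sum_def pc(2) by simp
qed

lemma jump_part_moments:
  assumes p: "1 \<le> p" and q: "1 \<le> q" and s: "0 \<le> s" "s \<le> t"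
  shows "square_integrable M (jump_part i p b \<epsilon> s t)" "(\<integral>\<omega>. jump_part i p b \<epsilon> s t \<omega> \<partial>M) = 0"
    "(\<integral>\<omega>. jump_part i p b \<epsilon> s t \<omega> * jump_part i q b' \<epsilon> s t \<omega> \<partial>M) = enn2real (jump_cov i p b q b' \<epsilon>) * (t - s)"
proof -
  have f: "jump_mean i p b \<epsilon> * ennreal (t - s) < \<top>" "jump_mean i q b' \<epsilon> * ennreal (t - s) < \<top>"
    "jump_cov i p b p b \<epsilon> * ennreal (t - s) < \<top>" "jump_cov i p b q b' \<epsilon> * ennreal (t - s) < \<top>"
    using jump_mean_finite[OF p] jump_mean_finite[OF q] jump_cov_finite[OF p] by (simp_all add: ennreal_mult_less_top)
  note c = centered_square_integrable[OF jump_sum_measurable_M jump_sum_moments(1)[OF s] f(1) jump_sum_moments(2)[OF s] f(3)]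
  show "square_integrable M (jump_part i p b \<epsilon> s t)" using c(2) unfolding jump_part_def .
  show "(\<integral>\<omega>. jump_part i p b \<epsilon> s t \<omega> \<partial>M) = 0" using c(3) unfolding jump_part_def .
  show "(\<integral>\<omega>. jump_part i p b \<epsilon> s t \<omega> * jump_part i q b' \<epsilon> s t \<omega> \<partial>M) = enn2real (jump_cov i p b q b' \<epsilon>) * (t - s)"
    unfolding jump_part_def
    using centered_covariance[OF jump_sum_measurable_M jump_sum_moments(1)[OF s] f(1)
      jump_sum_measurable_M jump_sum_moments(1)[OF s] f(2) jump_sum_moments(2)[OF s] f(4)] s
    by (simp add: enn2real_mult)
qed

lemma jump_incr_moments:
  assumes p: "1 \<le> p" and q: "1 \<le> q" and s: "0 \<le> s" "s \<le> t"
  shows "square_integrable M (jump_incr i p \<epsilon> s t)" "(\<integral>\<omega>. jump_incr i p \<epsilon> s t \<omega> \<partial>M) = 0"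
    "(\<integral>\<omega>. jump_incr i p \<epsilon> s t \<omega> * jump_incr i q \<epsilon> s t \<omega> \<partial>M) = jump_incr_cov i p q \<epsilon> * (t - s)"
proof -
  let ?P = "\<lambda>b. jump_part i p b \<epsilon> s t" and ?Q = "\<lambda>b. jump_part i q b \<epsilon> s t"
  note mp = jump_part_moments[OF p q s] and mq = jump_part_moments[OF q p s]
  show "square_integrable M (jump_incr i p \<epsilon> s t)"
    unfolding jump_incr_def by (rule square_integrable_diff[OF mp(1) mp(1)])
  have "integrable M (?P b)" for b by (rule square_integrable_integrable[OF finite_measure_axioms mp(1)])
  then show "(\<integral>\<omega>. jump_incr i p \<epsilon> s t \<omega> \<partial>M) = 0" unfolding jump_incr_def using mp(2) by simp
  have PQ: "integrable M (\<lambda>\<omega>. ?P b \<omega> * ?Q b' \<omega>)" for b b' by (rule square_integrable_mult[OF mp(1) mq(1)])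
  have "(\<integral>\<omega>. jump_incr i p \<epsilon> s t \<omega> * jump_incr i q \<epsilon> s t \<omega> \<partial>M)
    = (\<integral>\<omega>. ?P True \<omega> * ?Q True \<omega> - ?P True \<omega> * ?Q False \<omega> - ?P False \<omega> * ?Q True \<omega> + ?P False \<omega> * ?Q False \<omega> \<partial>M)"
    by (intro Bochner_Integration.integral_cong) (auto simp: jump_incr_def algebra_simps)
  also have "\<dots> = jump_incr_cov i p q \<epsilon> * (t - s)"
    by (simp add: PQ mp(3) jump_incr_cov_def left_diff_distrib distrib_right)
  finally show "(\<integral>\<omega>. jump_incr i p \<epsilon> s t \<omega> * jump_incr i q \<epsilon> s t \<omega> \<partial>M) = jump_incr_cov i p q \<epsilon> * (t - s)" .
qed

lemma jump_sum_finite: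
  assumes "1 \<le> p" "0 \<le> s" "s \<le> t"
  shows "AE \<omega> in M. jump_sum i p b \<epsilon> s t \<omega> < \<top>"
  by (rule enn2real_moments(1)[OF jump_sum_measurable_M jump_sum_moments(1)[OF assms(2,3)]])
     (use jump_mean_finite[OF assms(1)] in \<open>simp add: ennreal_mult_less_top\<close>)

text \<open>The extended sums are additive over adjacent intervals on every path;
  \<open>enn2real\<close> preserves this where they are finite, which is almost everywhere.\<close>

lemma jump_incr_additive:
  assumes p: "1 \<le> p" and s: "0 \<le> s" "s \<le> t"
  shows "AE \<omega> in M. jump_incr i p \<epsilon> 0 t \<omega> - jump_incr i p \<epsilon> 0 s \<omega> = jump_incr i p \<epsilon> s t \<omega>"
proof -
  have split: "jump_sum i p b \<epsilon> 0 t \<omega> = jump_sum i p b \<epsilon> 0 s \<omega> + jump_sum i p b \<epsilon> s t \<omega>" if \<omega>: "\<omega> \<in> space M" for b \<omega>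
  proof -
    have m: "(\<lambda>x. indicator (large_jumps \<epsilon> \<times> {u<..v}) x * signed_power p b (fst x)) \<in> borel_measurable (Q i \<omega>)" for u v
    proof -
      have "(\<lambda>x. indicator (large_jumps \<epsilon> \<times> {u<..v}) x * signed_power p b (fst x)) \<in> borel_measurable borel"
        unfolding borel_prod[symmetric] by measurable
      then show ?thesis using sets_Q[OF \<omega>] by (simp cong: measurable_cong_sets)
    qed
    show ?thesis
      unfolding jump_sum_def nn_integral_add[OF m m, symmetric]
      using s by (intro nn_integral_cong) (auto simp: indicator_def)
  qed
  have "AE \<omega> in M. (\<forall>b. jump_sum i p b \<epsilon> 0 s \<omega> < \<top>) \<and> (\<forall>b. jump_sum i p b \<epsilon> s t \<omega> < \<top>)"
    using jump_sum_finite[OF p, where s=0 and t=s] jump_sum_finite[OF p s] s by (simp add: AE_all_countable)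
  then show ?thesis using AE_space
  proof eventually_elim
    fix \<omega> assume f: "(\<forall>b. jump_sum i p b \<epsilon> 0 s \<omega> < \<top>) \<and> (\<forall>b. jump_sum i p b \<epsilon> s t \<omega> < \<top>)" and \<omega>: "\<omega> \<in> space M"
    have e: "enn2real (jump_sum i p b \<epsilon> 0 t \<omega>) = enn2real (jump_sum i p b \<epsilon> 0 s \<omega>) + enn2real (jump_sum i p b \<epsilon> s t \<omega>)" for b
      unfolding split[OF \<omega>] using f by (intro enn2real_plus) auto
    show "jump_incr i p \<epsilon> 0 t \<omega> - jump_incr i p \<epsilon> 0 s \<omega> = jump_incr i p \<epsilon> s t \<omega>"
      using s by (simp add: jump_incr_def jump_part_def e enn2real_mult algebra_simps)
  qed
qed

text \<open>Connects the compensated sum in \<open>compensated_integral\<close> with the nonnegative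
  parts. The integral over a path of \<open>Q\<close> is a difference of parts once both are finite,
  hence almost surely.\<close>

lemma jump_incr_compensated:
  assumes p: "1 \<le> p" and t: "0 \<le> t"
  shows "AE \<omega> in M. (LINT x:{v. \<epsilon> < \<bar>v\<bar>} \<times> {0<..t}|Q i \<omega>. fst x ^ p) - t * (LINT v:{v. \<epsilon> < \<bar>v\<bar>}|\<rho> i. v ^ p)
     = jump_incr i p \<epsilon> 0 t \<omega>"
proof -
  have r: "(LINT v:{v. \<epsilon> < \<bar>v\<bar>}|\<rho> i. v ^ p) = enn2real (jump_mean i p True \<epsilon>) - enn2real (jump_mean i p False \<epsilon>)"
    unfolding set_lebesgue_integral_def large_jumps_def[symmetric] real_lebesgue_integral_def[OF power_integrable[OF p]]
      jump_mean_def indicator_signed_power by simp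
  have "AE \<omega> in M. \<forall>b. jump_sum i p b \<epsilon> 0 t \<omega> < \<top>"
    using jump_sum_finite[OF p _ t] by (simp add: AE_all_countable)
  then show ?thesis using AE_space
  proof eventually_elim
    fix \<omega> assume f: "\<forall>b. jump_sum i p b \<epsilon> 0 t \<omega> < \<top>" and \<omega>: "\<omega> \<in> space M"
    let ?g = "\<lambda>x. indicat_real (large_jumps \<epsilon> \<times> {0<..t}) x *\<^sub>R fst x ^ p"
    have "?g \<in> borel_measurable borel"
      unfolding borel_prod[symmetric] by measurable
    then have "?g \<in> borel_measurable (Q i \<omega>)" using sets_Q[OF \<omega>] by (simp cong: measurable_cong_sets)
    then have int: "integrable (Q i \<omega>) ?g"
      unfolding real_integrable_def indicator_signed_power using f by (auto simp: jump_sum_def less_top)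
    have "(LINT x:{v. \<epsilon> < \<bar>v\<bar>} \<times> {0<..t}|Q i \<omega>. fst x ^ p)
        = enn2real (jump_sum i p True \<epsilon> 0 t \<omega>) - enn2real (jump_sum i p False \<epsilon> 0 t \<omega>)"
      unfolding set_lebesgue_integral_def large_jumps_def[symmetric] real_lebesgue_integral_def[OF int]
        jump_sum_def indicator_signed_power by simp
    then show "(LINT x:{v. \<epsilon> < \<bar>v\<bar>} \<times> {0<..t}|Q i \<omega>. fst x ^ p) - t * (LINT v:{v. \<epsilon> < \<bar>v\<bar>}|\<rho> i. v ^ p)
       = jump_incr i p \<epsilon> 0 t \<omega>"
      unfolding r using t by (simp add: jump_incr_def jump_part_def enn2real_mult algebra_simps)
  qed
qed

end

end

section \<open>Increments of the drivers and their independence of the past\<close>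

lemma L2_lim_cong_AE:
  fixes f g :: "nat \<Rightarrow> 'a \<Rightarrow> real"
  assumes f: "L2_lim M f X" and g: "\<And>n. g n \<in> borel_measurable M" and e: "\<And>n. AE \<omega> in M. g n \<omega> = f n \<omega>"
  shows "L2_lim M g X"
proof -
  have "square_integrable M (g n)" for n
    by (rule square_integrable_cong_AE(1)[OF g L2_limD(1)[OF f] e])
  moreover have "L2_norm M (\<lambda>\<omega>. g n \<omega> - X \<omega>) = L2_norm M (\<lambda>\<omega>. f n \<omega> - X \<omega>)" for n
  proof -
    note [measurable] = g square_integrable_measurable[OF L2_limD(1)[OF f]] square_integrable_measurable[OF L2_limD(2)[OF f]]
    have "(\<integral>\<omega>. (norm (g n \<omega> - X \<omega>))\<^sup>2 \<partial>M) = (\<integral>\<omega>. (norm (f n \<omega> - X \<omega>))\<^sup>2 \<partial>M)"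
      using e[of n] by (intro integral_cong_AE) auto
    then show ?thesis by (simp add: L2_norm_def)
  qed
  ultimately show ?thesis using L2_limD[OF f] by (simp add: L2_lim_def)
qed

lemma L2_dist2_cong_AE:
  assumes "AE \<omega> in M. Y \<omega> = Y' \<omega>"
  shows "L2_dist2 M X Y = L2_dist2 M X Y'"
  unfolding L2_dist2_def using assms by (intro nn_integral_cong_AE) (auto elim: eventually_mono)

fun letter_index :: "letter \<Rightarrow> nat" where
  "letter_index (Base i) = i"
| "letter_index (Power i p) = i"

fun letter_power :: "letter \<Rightarrow> nat" where
  "letter_power (Base i) = 1"
| "letter_power (Power i p) = p"

context levy_drivers
begin

text \<open>The sigma-algebras of the independence assumption as measure spaces, to which the
  measurability calculus applies; index 0 is the past.\<close>

definition future :: "real \<Rightarrow> nat \<Rightarrow> 'a measure" where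
  "future s k = (if k = 0 then F s else sigma (space M)
     (if k \<le> d then {(\<lambda>\<omega>. W k t \<omega> - W k s \<omega>) -` B \<inter> space M | t B. s \<le> t \<and> B \<in> sets borel}
      else {(\<lambda>\<omega>. emeasure (Q k \<omega>) A) -` B \<inter> space M | A B. A \<in> sets borel \<and> A \<subseteq> UNIV \<times> {s<..} \<and> B \<in> sets borel}))"

lemma space_future [simp]: "space (future s k) = space M"
proof -
  have "{(\<lambda>\<omega>. W k t \<omega> - W k s \<omega>) -` B \<inter> space M | t B. s \<le> t \<and> B \<in> sets borel} \<subseteq> Pow (space M)" by auto
  moreover have "{(\<lambda>\<omega>. emeasure (Q k \<omega>) A) -` B \<inter> space M | A B. A \<in> sets borel \<and> A \<subseteq> UNIV \<times> {s<..} \<and> B \<in> sets borel} \<subseteq> Pow (space M)"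
    by auto
  ultimately show ?thesis by (simp add: future_def space_F space_measure_of)
qed

lemma sets_future:
  "sets (future s k) = (if k = 0 then sets (F s) else if k \<le> d then wiener_future M (W k) s else poisson_future M (Q k) s)"
proof -
  have "{(\<lambda>\<omega>. W k t \<omega> - W k s \<omega>) -` B \<inter> space M | t B. s \<le> t \<and> B \<in> sets borel} \<subseteq> Pow (space M)" by auto
  moreover have "{(\<lambda>\<omega>. emeasure (Q k \<omega>) A) -` B \<inter> space M | A B. A \<in> sets borel \<and> A \<subseteq> UNIV \<times> {s<..} \<and> B \<in> sets borel} \<subseteq> Pow (space M)"
    by auto
  ultimately show ?thesis by (auto simp: future_def wiener_future_def poisson_future_def)
qed

lemma indep_future: "0 \<le> s \<Longrightarrow> indep_sets (\<lambda>k. sets (future s k)) {0..l}"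
  unfolding sets_future by (rule independence)

text \<open>Independence of the sigma-algebras becomes a product rule for any choice of one
  integrable variable from each.\<close>

lemma integral_prod_future:
  fixes X :: "nat \<Rightarrow> 'a \<Rightarrow> real"
  assumes s: "0 \<le> s" and K: "K \<subseteq> {0..l}" and X: "\<And>k. k \<in> K \<Longrightarrow> X k \<in> borel_measurable (future s k)"
    and i: "\<And>k. k \<in> K \<Longrightarrow> integrable M (X k)"
  shows "(\<integral>\<omega>. (\<Prod>k\<in>K. X k \<omega>) \<partial>M) = (\<Prod>k\<in>K. \<integral>\<omega>. X k \<omega> \<partial>M)"
proof (rule indep_vars_lebesgue_integral)
  show "finite K" using K finite_subset by blast
  have "indep_sets (\<lambda>k. {X k -` A \<inter> space M | A. A \<in> sets borel}) K"
    by (rule indep_sets_mono[OF indep_future[OF s] K]) (use measurable_sets[OF X] in auto)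
  then show "indep_vars (\<lambda>_. borel) X K"
    unfolding indep_vars_def2 using i by auto
qed (rule i)

lemma jump_incr_future:
  assumes i: "i \<in> {d<..l}" and \<epsilon>: "0 < \<epsilon>" and s: "0 \<le> s"
  shows "jump_incr i p \<epsilon> s t \<in> borel_measurable (future s i)"
proof -
  have [measurable]: "jump_sum i p b \<epsilon> s t \<in> borel_measurable (future s i)" for b
  proof (rule jump_sum_measurable[OF i \<epsilon>])
    fix A :: "(real \<times> real) set" assume A: "A \<in> sets borel" "A \<subseteq> large_jumps \<epsilon> \<times> {s<..t}"
    show "(\<lambda>\<omega>. emeasure (Q i \<omega>) A) \<in> borel_measurable (future s i)"
    proof (rule measurableI)
      fix B :: "ennreal set" assume "B \<in> sets borel"
      then show "(\<lambda>\<omega>. emeasure (Q i \<omega>) A) -` B \<inter> space (future s i) \<in> sets (future s i)"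
        unfolding sets_future space_future using A i
        by (auto simp: poisson_future_def intro!: sigma_sets.Basic exI[of _ A] exI[of _ B])
    qed simp
  qed simp
  show ?thesis unfolding jump_incr_def jump_part_def by measurable
qed

lemma jump_incr_adapted:
  assumes i: "i \<in> {d<..l}" and \<epsilon>: "0 < \<epsilon>" and t: "0 \<le> t"
  shows "jump_incr i p \<epsilon> 0 t \<in> borel_measurable (F t)"
proof -
  have [measurable]: "jump_sum i p b \<epsilon> 0 t \<in> borel_measurable (F t)" for b
  proof (rule jump_sum_measurable[OF i \<epsilon>])
    fix A :: "(real \<times> real) set" assume A: "A \<in> sets borel" "A \<subseteq> large_jumps \<epsilon> \<times> {0<..t}"
    then show "(\<lambda>\<omega>. emeasure (Q i \<omega>) A) \<in> borel_measurable (F t)"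
      using t by (intro poisson_adapted[OF i]) auto
  qed (simp add: space_F)
  show ?thesis unfolding jump_incr_def jump_part_def by measurable
qed

lemma jump_incr_lim:
  assumes i: "i \<in> {d<..l}" and p: "1 \<le> p" and t: "0 \<le> t"
  shows "L2_lim M (\<lambda>m. jump_incr i p (inverse (real (Suc m))) 0 t) (J i p t)"
proof (rule L2_limI_dist2)
  note ji = jumps[OF i p]
  show "J i p t \<in> borel_measurable M" using ji t by (auto simp: compensated_integral_def)
  show "square_integrable M (jump_incr i p (inverse (real (Suc m))) 0 t)" for m
    using t by (intro jump_incr_moments(1)[OF i _ p p]) auto
  have "filterlim (\<lambda>m. inverse (real (Suc m))) (at_right 0) sequentially"
    unfolding filterlim_at using LIMSEQ_inverse_real_of_nat by auto
  moreover have "((\<lambda>\<epsilon>. L2_dist2 M (J i p t)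
                (\<lambda>\<omega>. (LINT x:{v. \<epsilon> < \<bar>v\<bar>} \<times> {0<..t}|Q i \<omega>. fst x ^ p)
                     - t * (LINT v:{v. \<epsilon> < \<bar>v\<bar>}|\<rho> i. v ^ p))) \<longlongrightarrow> 0) (at_right 0)"
    using ji t by (auto simp: compensated_integral_def)
  ultimately have "(\<lambda>m. L2_dist2 M (J i p t)
                (\<lambda>\<omega>. (LINT x:{v. inverse (real (Suc m)) < \<bar>v\<bar>} \<times> {0<..t}|Q i \<omega>. fst x ^ p)
                     - t * (LINT v:{v. inverse (real (Suc m)) < \<bar>v\<bar>}|\<rho> i. v ^ p))) \<longlonglongrightarrow> 0"
    by (rule filterlim_compose[rotated])
  moreover have "L2_dist2 M (J i p t)
                (\<lambda>\<omega>. (LINT x:{v. inverse (real (Suc m)) < \<bar>v\<bar>} \<times> {0<..t}|Q i \<omega>. fst x ^ p)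
                     - t * (LINT v:{v. inverse (real (Suc m)) < \<bar>v\<bar>}|\<rho> i. v ^ p))
     = L2_dist2 M (J i p t) (jump_incr i p (inverse (real (Suc m))) 0 t)" for m
    by (rule L2_dist2_cong_AE[OF jump_incr_compensated[OF i _ p t]]) simp
  ultimately show "(\<lambda>m. L2_dist2 M (J i p t) (jump_incr i p (inverse (real (Suc m))) 0 t)) \<longlonglongrightarrow> 0"
    by simp
qed

lemma wiener_incr_moments:
  assumes i: "i \<in> {1..d}" and s: "0 \<le> s" "s \<le> t"
  shows "square_integrable M (\<lambda>\<omega>. W i t \<omega> - W i s \<omega>)" "(\<integral>\<omega>. W i t \<omega> - W i s \<omega> \<partial>M) = 0"
    "(\<integral>\<omega>. (W i t \<omega> - W i s \<omega>) * (W i t \<omega> - W i s \<omega>) \<partial>M) = t - s"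
proof -
  have "square_integrable M (\<lambda>\<omega>. W i t \<omega> - W i s \<omega>) \<and> (\<integral>\<omega>. W i t \<omega> - W i s \<omega> \<partial>M) = 0 \<and>
    (\<integral>\<omega>. (W i t \<omega> - W i s \<omega>) * (W i t \<omega> - W i s \<omega>) \<partial>M) = t - s"
  proof (cases "s = t")
    \<comment> \<open>The normal law is given for \<open>s < t\<close> only; for
      \<open>s = t\<close> the increment is 0.\<close>
    case False
    then have st: "s < t" using s by simp
    define \<sigma> where "\<sigma> = sqrt (t - s)"
    have \<sigma>: "0 < \<sigma>" "\<sigma>\<^sup>2 = t - s" using st by (auto simp: \<sigma>_def)
    have D: "distributed M lborel (\<lambda>\<omega>. W i t \<omega> - W i s \<omega>) (normal_density 0 \<sigma>)"
      using wiener[OF i] s st unfolding wiener_process_def \<sigma>_def by blast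
    have m: "(\<lambda>\<omega>. W i t \<omega> - W i s \<omega>) \<in> borel_measurable M" using distributed_measurable[OF D] by simp
    have "integrable lborel (\<lambda>x. normal_density 0 \<sigma> x * x\<^sup>2)"
      using normal_moment_even[OF \<sigma>(1), of 0 1] by (auto dest: integrable.intros)
    then have "integrable M (\<lambda>\<omega>. (W i t \<omega> - W i s \<omega>)\<^sup>2)"
      by (subst (asm) distributed_integrable[OF D]) auto
    then have "square_integrable M (\<lambda>\<omega>. W i t \<omega> - W i s \<omega>)" using m by (simp add: square_integrable_def)
    moreover have e: "(\<integral>\<omega>. W i t \<omega> - W i s \<omega> \<partial>M) = 0"
      by (rule normal_distributed_expectation[OF \<sigma>(1) D])
    moreover have "(\<integral>\<omega>. (W i t \<omega> - W i s \<omega>) * (W i t \<omega> - W i s \<omega>) \<partial>M) = t - s"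
      using normal_distributed_variance[OF \<sigma>(1) D] \<sigma>(2) unfolding e by (simp add: power2_eq_square)
    ultimately show ?thesis by blast
  qed simp
  then show "square_integrable M (\<lambda>\<omega>. W i t \<omega> - W i s \<omega>)" "(\<integral>\<omega>. W i t \<omega> - W i s \<omega> \<partial>M) = 0"
    "(\<integral>\<omega>. (W i t \<omega> - W i s \<omega>) * (W i t \<omega> - W i s \<omega>) \<partial>M) = t - s" by auto
qed

text \<open>\<open>W i t\<close> is an increment from time 0 up to a null set, as
  \<open>W i 0 = 0\<close> holds almost surely.\<close>

lemma wiener_square_integrable:
  assumes i: "i \<in> {1..d}" and t: "0 \<le> t"
  shows "square_integrable M (W i t)"
proof (rule square_integrable_cong_AE(1)[OF _ wiener_incr_moments(1)[OF i _ t]])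
  show "W i t \<in> borel_measurable M" using wiener[OF i] t by (auto simp: wiener_process_def)
  have "AE \<omega> in M. W i 0 \<omega> = 0" using wiener[OF i] by (auto simp: wiener_process_def)
  then show "AE \<omega> in M. W i t \<omega> = W i t \<omega> - W i 0 \<omega>" by eventually_elim simp
qed simp

lemma wiener_incr_future:
  assumes i: "i \<in> {1..d}" and s: "s \<le> t"
  shows "(\<lambda>\<omega>. W i t \<omega> - W i s \<omega>) \<in> borel_measurable (future s i)"
proof (rule measurableI)
  fix B :: "real set" assume "B \<in> sets borel"
  then show "(\<lambda>\<omega>. W i t \<omega> - W i s \<omega>) -` B \<inter> space (future s i) \<in> sets (future s i)"
    unfolding sets_future space_future using i s
    by (auto simp: wiener_future_def intro!: sigma_sets.Basic exI[of _ t] exI[of _ B])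
qed simp

text \<open>Exact for Wiener letters; for jump letters only jumps larger than
  \<open>1 / (m + 1)\<close> are kept. Unlike the limit, which is fixed only up to null sets, it is
  literally measurable with respect to \<open>future s\<close>.\<close>

definition incr :: "letter \<Rightarrow> nat \<Rightarrow> real \<Rightarrow> real \<Rightarrow> 'a \<Rightarrow> real" where
  "incr a m s t = (if letter_index a \<le> d then (\<lambda>\<omega>. W (letter_index a) t \<omega> - W (letter_index a) s \<omega>)
     else jump_incr (letter_index a) (letter_power a) (inverse (real (Suc m))) s t)"

definition incr_cov :: "letter \<Rightarrow> letter \<Rightarrow> nat \<Rightarrow> real" where
  "incr_cov a b m = (if letter_index a \<noteq> letter_index b then 0 else if letter_index a \<le> d then 1
     else jump_incr_cov (letter_index a) (letter_power a) (letter_power b) (inverse (real (Suc m))))"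

lemma noise_letter_cases:
  assumes "a \<in> alphabet M d l J - {Base 0}"
  obtains "letter_index a \<in> {1..d}" "driver d W J a = W (letter_index a)"
  | "letter_index a \<in> {d<..l}" "1 \<le> letter_power a" "driver d W J a = J (letter_index a) (letter_power a)"
proof (cases a)
  case (Base i)
  then have "i \<in> {0..l}" "i \<noteq> 0" using assms by (auto simp: alphabet_def)
  then show ?thesis using that Base by (cases "i \<le> d") auto
next
  case (Power i p)
  then have "i \<in> {d<..l}" "2 \<le> p" using assms by (auto simp: alphabet_def)
  then show ?thesis using that Power by auto
qed

context
  fixes A defines "A \<equiv> alphabet M d l J - {Base 0}"
begin

lemma letter_index_bounds: "a \<in> A \<Longrightarrow> letter_index a \<noteq> 0 \<and> letter_index a \<le> l"
  unfolding A_def using d_le_l by (elim noise_letter_cases) auto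

lemma incr_future:
  assumes "a \<in> A" "0 \<le> s" "s \<le> t"
  shows "incr a m s t \<in> borel_measurable (future s (letter_index a))"
  using assms unfolding A_def
  by (elim noise_letter_cases) (auto simp: incr_def intro!: wiener_incr_future jump_incr_future)

lemma incr_moments:
  assumes a: "a \<in> A" and s: "0 \<le> s" "s \<le> t"
  shows "square_integrable M (incr a m s t)" "(\<integral>\<omega>. incr a m s t \<omega> \<partial>M) = 0"
proof -
  have "square_integrable M (incr a m s t) \<and> (\<integral>\<omega>. incr a m s t \<omega> \<partial>M) = 0"
    using a unfolding A_def
  proof (cases rule: noise_letter_cases)
    case 1
    then show ?thesis using wiener_incr_moments[OF 1(1) s] by (simp add: incr_def)
  next
    case 2
    then show ?thesis using jump_incr_moments[OF 2(1) _ 2(2) 2(2) s] by (simp add: incr_def)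
  qed
  then show "square_integrable M (incr a m s t)" "(\<integral>\<omega>. incr a m s t \<omega> \<partial>M) = 0" by auto
qed

lemma incr_covariance:
  assumes a: "a \<in> A" and b: "b \<in> A" and ab: "letter_index a = letter_index b" and s: "0 \<le> s" "s \<le> t"
  shows "(\<integral>\<omega>. incr a m s t \<omega> * incr b m s t \<omega> \<partial>M) = incr_cov a b m * (t - s)"
  using a unfolding A_def
proof (cases rule: noise_letter_cases)
  case 1
  then show ?thesis using wiener_incr_moments[OF 1(1) s] ab by (simp add: incr_def incr_cov_def)
next
  case 2
  have "1 \<le> letter_power b" using b 2(1) ab unfolding A_def by (elim noise_letter_cases) auto
  then show ?thesis using jump_incr_moments(3)[OF 2(1) _ 2(2) _ s] 2 ab by (simp add: incr_def incr_cov_def)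
qed

lemma incr_lim:
  assumes a: "a \<in> A" and s: "0 \<le> s" "s \<le> t"
  shows "L2_lim M (\<lambda>m. incr a m s t) (\<lambda>\<omega>. driver d W J a t \<omega> - driver d W J a s \<omega>)"
  using a unfolding A_def
proof (cases rule: noise_letter_cases)
  case 1
  then show ?thesis using L2_lim_const[OF wiener_incr_moments(1)[OF 1(1) s]] by (simp add: incr_def)
next
  case 2
  let ?j = "\<lambda>m. jump_incr (letter_index a) (letter_power a) (inverse (real (Suc m)))"
  have t: "0 \<le> t" using s by simp
  have "L2_lim M (\<lambda>m \<omega>. ?j m 0 t \<omega> - ?j m 0 s \<omega>) (\<lambda>\<omega>. driver d W J a t \<omega> - driver d W J a s \<omega>)"
    unfolding 2(3) by (rule L2_lim_diff[OF jump_incr_lim[OF 2(1,2) t] jump_incr_lim[OF 2(1,2) s(1)]])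
  then have "L2_lim M (\<lambda>m. ?j m s t) (\<lambda>\<omega>. driver d W J a t \<omega> - driver d W J a s \<omega>)"
  proof (rule L2_lim_cong_AE)
    fix m
    show "?j m s t \<in> borel_measurable M"
      by (rule square_integrable_measurable[OF jump_incr_moments(1)[OF 2(1) _ 2(2) 2(2) s]]) simp
    have "AE \<omega> in M. ?j m 0 t \<omega> - ?j m 0 s \<omega> = ?j m s t \<omega>"
      by (rule jump_incr_additive[OF 2(1) _ 2(2) s]) simp
    then show "AE \<omega> in M. ?j m s t \<omega> = ?j m 0 t \<omega> - ?j m 0 s \<omega>" by eventually_elim simp
  qed
  then show ?thesis using 2(1) by (simp add: incr_def)
qed

lemma driver_known:
  assumes a: "a \<in> A" and t: "0 \<le> t"
  shows "known_at t (driver d W J a t)"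
  using a unfolding A_def
proof (cases rule: noise_letter_cases)
  case 1
  then show ?thesis
    using wiener_adapted[OF 1(1) t] wiener_square_integrable[OF 1(1) t] by (simp add: known_at_measurable)
next
  case 2
  show ?thesis unfolding 2(3)
  proof (rule known_at_lim[OF jump_incr_lim[OF 2(1,2) t]])
    fix m
    show "known_at t (jump_incr (letter_index a) (letter_power a) (inverse (real (Suc m))) 0 t)"
      by (intro known_at_measurable jump_incr_adapted[OF 2(1) _ t] jump_incr_moments(1)[OF 2(1) _ 2(2) 2(2) _ t]) auto
  qed
qed

lemma future_past: "bounded_past s g \<Longrightarrow> g \<in> borel_measurable (future s 0)"
  by (simp add: bounded_past_def future_def)

text \<open>The approximating increments are centred and independent of \<open>F s\<close>, and the
  resulting orthogonality is stable under L2 limits.\<close>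

lemma driver_orth:
  assumes a: "a \<in> A" and s: "0 \<le> s" "s \<le> t"
  shows "orth_past s (\<lambda>\<omega>. driver d W J a t \<omega> - driver d W J a s \<omega>)"
proof (rule orth_past_lim[OF incr_lim[OF a s]])
  fix m
  define k where "k = letter_index a"
  have k: "k \<noteq> 0" "k \<le> l" using letter_index_bounds[OF a] by (auto simp: k_def)
  note im = incr_moments[OF a s]
  have "(\<integral>\<omega>. g \<omega> * incr a m s t \<omega> \<partial>M) = 0" if g: "bounded_past s g" for g
  proof -
    have "(\<integral>\<omega>. (\<Prod>j\<in>{0, k}. (if j = 0 then g else incr a m s t) \<omega>) \<partial>M)
       = (\<Prod>j\<in>{0, k}. \<integral>\<omega>. (if j = 0 then g else incr a m s t) \<omega> \<partial>M)"
    proof (rule integral_prod_future[OF s(1)])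
      fix j assume j: "j \<in> {0, k}"
      show "(if j = 0 then g else incr a m s t) \<in> borel_measurable (future s j)"
        using j k future_past[OF g] incr_future[OF a s] by (auto simp: k_def)
      show "integrable M (if j = 0 then g else incr a m s t)"
        using bounded_past_integrable[OF g] square_integrable_integrable[OF finite_measure_axioms im(1)] by simp
    qed (use k in auto)
    then show ?thesis using k im(2) by simp
  qed
  then show "orth_past s (incr a m s t)" using im(1) by (simp add: orth_past_def)
qed

text \<open>Letters of equal index are driven by the same noise, so the product of their increments
  counts as a single variable next to \<open>g\<close>. Different indices give three independent
  factors, two of which are centred.\<close>

lemma incr_cov_past:
  assumes a: "a \<in> A" and b: "b \<in> A" and s: "0 \<le> s" "s \<le> t" and g: "bounded_past s g"
  shows "(\<integral>\<omega>. g \<omega> * (incr a m s t \<omega> * incr b m s t \<omega>) \<partial>M) = incr_cov a b m * (t - s) * (\<integral>\<omega>. g \<omega> \<partial>M)"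
proof -
  define i j where "i = letter_index a" and "j = letter_index b"
  have ij: "i \<noteq> 0" "i \<le> l" "j \<noteq> 0" "j \<le> l" using letter_index_bounds[OF a] letter_index_bounds[OF b] by (auto simp: i_def j_def)
  note ia = incr_moments[OF a s] and ib = incr_moments[OF b s]
  have fa: "incr a m s t \<in> borel_measurable (future s i)" and fb: "incr b m s t \<in> borel_measurable (future s j)"
    using incr_future[OF a s] incr_future[OF b s] by (auto simp: i_def j_def)
  show ?thesis
  proof (cases "i = j")
    case True
    define X where "X k = (if k = 0 then g else (\<lambda>\<omega>. incr a m s t \<omega> * incr b m s t \<omega>))" for k :: nat
    have "(\<integral>\<omega>. (\<Prod>k\<in>{0, i}. X k \<omega>) \<partial>M) = (\<Prod>k\<in>{0, i}. \<integral>\<omega>. X k \<omega> \<partial>M)"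
    proof (rule integral_prod_future[OF s(1)])
      fix k assume k: "k \<in> {0, i}"
      show "X k \<in> borel_measurable (future s k)"
        using k ij future_past[OF g] fa fb True by (auto simp: X_def)
      show "integrable M (X k)"
        using bounded_past_integrable[OF g] square_integrable_mult[OF ia(1) ib(1)] by (simp add: X_def)
    qed (use ij in auto)
    then show ?thesis using ij incr_covariance[OF a b _ s] True by (simp add: X_def i_def j_def)
  next
    case False
    define X where "X k = (if k = 0 then g else if k = i then incr a m s t else incr b m s t)" for k :: nat
    have "(\<integral>\<omega>. (\<Prod>k\<in>{0, i, j}. X k \<omega>) \<partial>M) = (\<Prod>k\<in>{0, i, j}. \<integral>\<omega>. X k \<omega> \<partial>M)"
    proof (rule integral_prod_future[OF s(1)])
      fix k assume k: "k \<in> {0, i, j}"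
      show "X k \<in> borel_measurable (future s k)"
        using k ij future_past[OF g] fa fb False by (auto simp: X_def)
      show "integrable M (X k)"
        using bounded_past_integrable[OF g] square_integrable_integrable[OF finite_measure_axioms ia(1)]
          square_integrable_integrable[OF finite_measure_axioms ib(1)] by (simp add: X_def)
    qed (use ij in auto)
    then show ?thesis using ij ia(2) False by (simp add: X_def incr_cov_def i_def j_def)
  qed
qed

lemma incr_cov_lim:
  assumes a: "a \<in> A" and b: "b \<in> A" and s: "0 \<le> s" "s \<le> t" and g: "bounded_past s g"
  shows "(\<lambda>m. incr_cov a b m * (t - s) * (\<integral>\<omega>. g \<omega> \<partial>M)) \<longlonglongrightarrow>
    (\<integral>\<omega>. g \<omega> * ((driver d W J a t \<omega> - driver d W J a s \<omega>) * (driver d W J b t \<omega> - driver d W J b s \<omega>)) \<partial>M)"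
  using L2_lim_mult[OF L2_lim_bounded_past_mult[OF g incr_lim[OF a s]] incr_lim[OF b s]]
  by (simp add: mult.assoc incr_cov_past[OF a b s g])

definition driver_cov :: "letter \<Rightarrow> letter \<Rightarrow> real" where
  "driver_cov a b = (\<integral>\<omega>. (driver d W J a 1 \<omega> - driver d W J a 0 \<omega>) * (driver d W J b 1 \<omega> - driver d W J b 0 \<omega>) \<partial>M)"

text \<open>The limit of the approximate covariance rates is identified on the unit interval with
  weight 1; uniqueness of limits carries it over to all intervals and weights.\<close>

lemma driver_covariance:
  assumes a: "a \<in> A" and b: "b \<in> A" and s: "0 \<le> s" "s \<le> t" and g: "bounded_past s g"
  shows "(\<integral>\<omega>. g \<omega> * ((driver d W J a t \<omega> - driver d W J a s \<omega>) * (driver d W J b t \<omega> - driver d W J b s \<omega>)) \<partial>M)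
    = driver_cov a b * (t - s) * (\<integral>\<omega>. g \<omega> \<partial>M)"
proof -
  have "(\<lambda>m. incr_cov a b m) \<longlonglongrightarrow> driver_cov a b"
    using incr_cov_lim[OF a b, of 0 1 "\<lambda>_. 1"] by (simp add: driver_cov_def prob_space)
  then have "(\<lambda>m. incr_cov a b m * (t - s) * (\<integral>\<omega>. g \<omega> \<partial>M)) \<longlonglongrightarrow> driver_cov a b * (t - s) * (\<integral>\<omega>. g \<omega> \<partial>M)"
    by (intro tendsto_intros)
  with incr_cov_lim[OF a b s g] show ?thesis by (rule LIMSEQ_unique)
qed

end

theorem driven_space_drivers:
  "driven_space M F (alphabet M d l J - {Base 0}) (driver d W J) driver_cov"
  by unfold_locales (rule driver_known driver_orth driver_covariance; assumption)+

end

section \<open>Families with homogeneous covariances\<close>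

text \<open>\<open>(n + 1)\<^sup>2 \<le> (n + 1) * (n + 2)\<close>, and the right-hand sides are the
  coefficients of the second derivative of the geometric series.\<close>

lemma summable_square_geometric:
  fixes r :: real
  assumes r: "0 \<le> r" "r < 1"
  shows "summable (\<lambda>k. (real (Suc k))\<^sup>2 * r ^ k)"
proof (rule summable_comparison_test')
  have 1: "summable (\<lambda>n. 1 * y ^ n)" if "norm y < 1" for y :: real using that by (simp add: summable_geometric)
  have 2: "summable (\<lambda>n. diffs (\<lambda>_. 1) n * y ^ n)" if "norm y < 1" for y :: real
    by (rule termdiff_converges[OF that 1])
  show "summable (\<lambda>n. diffs (diffs (\<lambda>_. 1)) n * r ^ n)"
    by (rule termdiff_converges[OF _ 2]) (use r in auto)
  fix n :: nat
  have "(real (Suc n))\<^sup>2 \<le> diffs (diffs (\<lambda>_. 1)) n" by (simp add: diffs_def power2_eq_square algebra_simps)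
  then show "norm ((real (Suc n))\<^sup>2 * r ^ n) \<le> diffs (diffs (\<lambda>_. 1)) n * r ^ n"
    using r by (simp add: mult_right_mono)
qed

text \<open>All that is retained of the stochastic integrals is the homogeneity of their covariances
  in time; \<open>z\<close> and \<open>x\<close> stand for the numbers of zero and nonzero
  letters.\<close>

locale graded_family =
  fixes M :: "'a measure" and T :: real and W :: "'w set"
    and X :: "real \<Rightarrow> 'w \<Rightarrow> 'a \<Rightarrow> 'b::euclidean_space"
    and z x :: "'w \<Rightarrow> nat" and \<gamma> :: "'w \<Rightarrow> 'w \<Rightarrow> real"
  assumes T_pos: "0 < T"
    and sq: "\<And>t w. t \<in> {0..<T} \<Longrightarrow> w \<in> W \<Longrightarrow> square_integrable M (X t w)"
    and homogeneous: "\<And>t u v. t \<in> {0..<T} \<Longrightarrow> u \<in> W \<Longrightarrow> v \<in> W \<Longrightarrow>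
      (\<integral>\<omega>. X t u \<omega> \<bullet> X t v \<omega> \<partial>M) = \<gamma> u v * t ^ (z u + z v + x u)"
    and orthogonal: "\<And>u v. u \<in> W \<Longrightarrow> v \<in> W \<Longrightarrow> x u \<noteq> x v \<Longrightarrow> \<gamma> u v = 0"
begin

section \<open>Partial sums and the coefficients of their squared norms\<close>

definition partial :: "real \<Rightarrow> 'w set \<Rightarrow> 'a \<Rightarrow> 'b" where
  "partial t S \<omega> = (\<Sum>w\<in>S. X t w \<omega>)"

definition ip :: "real \<Rightarrow> 'w set \<Rightarrow> 'w set \<Rightarrow> real" where
  "ip t S S' = (\<integral>\<omega>. partial t S \<omega> \<bullet> partial t S' \<omega> \<partial>M)"

text \<open>The condition \<open>x v = x u\<close> records where \<gamma> can be nonzero. Together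
  with \<open>k\<close> it lets the two counts of \<open>u\<close> determine those of
  \<open>v\<close>.\<close>

definition grade_coeff :: "'w set \<Rightarrow> nat \<Rightarrow> real" where
  "grade_coeff S k = (\<Sum>u\<in>S. \<Sum>v\<in>S. if z u + z v + x u = k \<and> x v = x u then \<gamma> u v else 0)"

lemma sq_partial: "t \<in> {0..<T} \<Longrightarrow> S \<subseteq> W \<Longrightarrow> square_integrable M (partial t S)"
  unfolding partial_def by (intro square_integrable_sum sq) auto

lemma ip_sum:
  assumes t: "t \<in> {0..<T}" and S: "S \<subseteq> W" "S' \<subseteq> W"
  shows "ip t S S' = (\<Sum>u\<in>S. \<Sum>v\<in>S'. \<gamma> u v * t ^ (z u + z v + x u))"
proof -
  have i: "integrable M (\<lambda>\<omega>. X t u \<omega> \<bullet> X t v \<omega>)" if "u \<in> S" "v \<in> S'" for u v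
    using that S by (intro square_integrable_inner sq[OF t]) auto
  have "ip t S S' = (\<integral>\<omega>. (\<Sum>u\<in>S. \<Sum>v\<in>S'. X t u \<omega> \<bullet> X t v \<omega>) \<partial>M)"
    unfolding ip_def partial_def
    by (intro Bochner_Integration.integral_cong refl) (simp only: inner_sum_left inner_sum_right, rule sum.swap)
  also have "\<dots> = (\<Sum>u\<in>S. \<integral>\<omega>. (\<Sum>v\<in>S'. X t u \<omega> \<bullet> X t v \<omega>) \<partial>M)"
    by (intro Bochner_Integration.integral_sum Bochner_Integration.integrable_sum i)
  also have "\<dots> = (\<Sum>u\<in>S. \<Sum>v\<in>S'. \<integral>\<omega>. X t u \<omega> \<bullet> X t v \<omega> \<partial>M)"
    by (intro sum.cong refl Bochner_Integration.integral_sum i)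
  also have "\<dots> = (\<Sum>u\<in>S. \<Sum>v\<in>S'. \<gamma> u v * t ^ (z u + z v + x u))"
    using S by (intro sum.cong refl homogeneous[OF t]) auto
  finally show ?thesis .
qed

lemma ip_self: "ip t S S = (L2_norm M (partial t S))\<^sup>2"
  by (simp add: ip_def L2_norm_sq power2_norm_eq_inner)

lemma ip_empty [simp]: "ip t {} S = 0" "ip t S {} = 0"
  by (simp_all add: ip_def partial_def)

lemma grade_coeff_sums:
  assumes t: "t \<in> {0..<T}" and S: "S \<subseteq> W"
  shows "(\<lambda>k. grade_coeff S k * t ^ k) sums (L2_norm M (partial t S))\<^sup>2"
proof -
  have "(\<lambda>k. \<Sum>u\<in>S. \<Sum>v\<in>S. (if z u + z v + x u = k \<and> x v = x u then \<gamma> u v else 0) * t ^ k)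
     sums (\<Sum>u\<in>S. \<Sum>v\<in>S. \<gamma> u v * t ^ (z u + z v + x u))"
  proof (intro sums_sum)
    fix u v assume uv: "u \<in> S" "v \<in> S"
    show "(\<lambda>k. (if z u + z v + x u = k \<and> x v = x u then \<gamma> u v else 0) * t ^ k) sums (\<gamma> u v * t ^ (z u + z v + x u))"
    proof (cases "x v = x u")
      case True
      then have "(\<lambda>k. (if z u + z v + x u = k \<and> x v = x u then \<gamma> u v else 0) * t ^ k)
         = (\<lambda>k. if k = z u + z v + x u then \<gamma> u v * t ^ k else 0)" by auto
      then show ?thesis using sums_single[of "z u + z v + x u" "\<lambda>k. \<gamma> u v * t ^ k"] by simp
    next
      case False
      then have "\<gamma> u v = 0" using orthogonal[of u v] uv S by auto
      then show ?thesis using False by simp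
    qed
  qed
  then show ?thesis
    unfolding ip_self[symmetric] ip_sum[OF t S S] grade_coeff_def sum_distrib_right .
qed

text \<open>Summing over whole classes of words keeps the cancellations within a class: each summand
  can be estimated by norms of partial sums, whereas the sum of the absolute values of \<gamma> is
  out of control.\<close>

lemma grade_coeff_grouped:
  assumes t: "t \<in> {0..<T}" and S: "S \<subseteq> W" "finite S"
  shows "grade_coeff S k * t ^ k = (\<Sum>p\<le>k. \<Sum>q\<le>k.
    ip t {u \<in> S. z u = p \<and> x u = q} {v \<in> S. z v + p + q = k \<and> x v = q})"
proof -
  have "(\<Sum>p\<le>k. \<Sum>q\<le>k. ip t {u \<in> S. z u = p \<and> x u = q} {v \<in> S. z v + p + q = k \<and> x v = q})
     = (\<Sum>p\<le>k. \<Sum>q\<le>k. \<Sum>u\<in>S. \<Sum>v\<in>S. if z u = p \<and> x u = q \<and> z v + p + q = k \<and> x v = q then \<gamma> u v * t ^ k else 0)"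
  proof (intro sum.cong refl)
    fix p q
    have "ip t {u \<in> S. z u = p \<and> x u = q} {v \<in> S. z v + p + q = k \<and> x v = q}
      = (\<Sum>u\<in>{u \<in> S. z u = p \<and> x u = q}. \<Sum>v\<in>{v \<in> S. z v + p + q = k \<and> x v = q}. \<gamma> u v * t ^ (z u + z v + x u))"
      using S by (intro ip_sum[OF t]) auto
    also have "\<dots> = (\<Sum>u\<in>{u \<in> S. z u = p \<and> x u = q}. \<Sum>v\<in>{v \<in> S. z v + p + q = k \<and> x v = q}. \<gamma> u v * t ^ k)"
    proof (intro sum.cong refl)
      fix u v assume "u \<in> {u \<in> S. z u = p \<and> x u = q}" "v \<in> {v \<in> S. z v + p + q = k \<and> x v = q}"
      then have "z u + z v + x u = k" by auto
      then show "\<gamma> u v * t ^ (z u + z v + x u) = \<gamma> u v * t ^ k" by simp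
    qed
    also have "\<dots> = (\<Sum>u\<in>S. \<Sum>v\<in>S. if z u = p \<and> x u = q \<and> z v + p + q = k \<and> x v = q then \<gamma> u v * t ^ k else 0)"
      using S(2) by (simp add: sum.inter_filter) (auto intro!: sum.cong sum.neutral)
    finally show "ip t {u \<in> S. z u = p \<and> x u = q} {v \<in> S. z v + p + q = k \<and> x v = q}
      = (\<Sum>u\<in>S. \<Sum>v\<in>S. if z u = p \<and> x u = q \<and> z v + p + q = k \<and> x v = q then \<gamma> u v * t ^ k else 0)" .
  qed
  also have "\<dots> = (\<Sum>u\<in>S. \<Sum>v\<in>S. \<Sum>p\<le>k. \<Sum>q\<le>k. if z u = p \<and> x u = q \<and> z v + p + q = k \<and> x v = q then \<gamma> u v * t ^ k else 0)"
    unfolding sum.swap[of _ S "{..k}"] ..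
  also have "\<dots> = (\<Sum>u\<in>S. \<Sum>v\<in>S. (if z u + z v + x u = k \<and> x v = x u then \<gamma> u v else 0) * t ^ k)"
  proof (intro sum.cong refl)
    fix u v
    \<comment> \<open>For a fixed pair of words at most one \<open>(p, q)\<close> contributes,
      namely the two counts of \<open>u\<close>.\<close>
    have "(\<Sum>p\<le>k. \<Sum>q\<le>k. if z u = p \<and> x u = q \<and> z v + p + q = k \<and> x v = q then \<gamma> u v * t ^ k else 0)
       = (\<Sum>p\<le>k. if p = z u then (\<Sum>q\<le>k. if q = x u then (if z v + z u + x u = k \<and> x v = x u then \<gamma> u v * t ^ k else 0) else 0) else 0)"
    proof (intro sum.cong refl)
      fix p
      show "(\<Sum>q\<le>k. if z u = p \<and> x u = q \<and> z v + p + q = k \<and> x v = q then \<gamma> u v * t ^ k else 0)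
        = (if p = z u then (\<Sum>q\<le>k. if q = x u then (if z v + z u + x u = k \<and> x v = x u then \<gamma> u v * t ^ k else 0) else 0) else 0)"
      proof (cases "p = z u")
        case True
        show ?thesis unfolding if_P[OF True] by (intro sum.cong refl) (auto simp: True)
      next
        case False
        then show ?thesis by auto
      qed
    qed
    also have "\<dots> = (if z u + z v + x u = k \<and> x v = x u then \<gamma> u v else 0) * t ^ k"
      by (auto simp: add_ac)
    finally show "(\<Sum>p\<le>k. \<Sum>q\<le>k. if z u = p \<and> x u = q \<and> z v + p + q = k \<and> x v = q then \<gamma> u v * t ^ k else 0)
      = (if z u + z v + x u = k \<and> x v = x u then \<gamma> u v else 0) * t ^ k" .
  qed
  finally show ?thesis by (simp add: grade_coeff_def sum_distrib_right)
qed

text \<open>Partial sums over sets containing some finite \<open>S0\<close> are within distance 1 of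
  the limit. An arbitrary partial sum differs from such a one by terms from \<open>S0\<close>, which
  gives the bound \<open>C\<close>.\<close>

lemma partial_bounded:
  assumes t: "t \<in> {0..<T}" and B: "B \<subseteq> W" and R: "L2_has_sum M (X t) B R"
  obtains C where "0 \<le> C" "\<And>S. finite S \<Longrightarrow> S \<subseteq> B \<Longrightarrow> L2_norm M (partial t S) \<le> C"
proof -
  have lim: "((\<lambda>S. L2_dist2 M R (partial t S)) \<longlongrightarrow> 0) (finite_subsets_at_top B)"
    using R by (simp add: L2_has_sum_def partial_def[abs_def])
  have RM: "R \<in> borel_measurable M" using R by (simp add: L2_has_sum_def)
  have "eventually (\<lambda>S. L2_dist2 M R (partial t S) < 1) (finite_subsets_at_top B)"
    using lim by (rule order_tendstoD) simp
  then have "\<exists>S0. finite S0 \<and> S0 \<subseteq> B \<and> (\<forall>S. finite S \<and> S0 \<subseteq> S \<and> S \<subseteq> B \<longrightarrow> L2_dist2 M R (partial t S) < 1)"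
    by (simp only: eventually_finite_subsets_at_top)
  then obtain S0 where S0: "finite S0" "S0 \<subseteq> B"
    and d: "\<forall>S. finite S \<and> S0 \<subseteq> S \<and> S \<subseteq> B \<longrightarrow> L2_dist2 M R (partial t S) < 1"
    by (elim exE conjE)
  have sqp: "square_integrable M (partial t S)" if "S \<subseteq> B" for S using sq_partial[OF t] that B by blast
  have "L2_dist2 M R (partial t S0) < 1" using d S0 by simp
  then have "L2_dist2 M R (partial t S0) < \<infinity>" by (rule less_trans) simp
  then have sqR: "square_integrable M R" using square_integrable_finite_dist[OF RM sqp[OF S0(2)]] by blast
  define C where "C = L2_norm M R + 1 + (\<Sum>w\<in>S0. L2_norm M (X t w))"
  have sumn: "0 \<le> (\<Sum>w\<in>S0. L2_norm M (X t w))" by (intro sum_nonneg) simp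
  have "L2_norm M (partial t S) \<le> C" if S: "finite S" "S \<subseteq> B" for S
  proof -
    \<comment> \<open>The sum over \<open>S\<close> is the sum over \<open>?U\<close>, which is
      close to \<open>R\<close>, minus the sum over the missing part \<open>?D\<close> of
      \<open>S0\<close>.\<close>
    let ?U = "S \<union> S0" and ?D = "S0 - S"
    have U: "?U \<subseteq> B" "finite ?U" "?D \<subseteq> B" using S S0 by auto
    have "ennreal ((L2_norm M (\<lambda>\<omega>. R \<omega> - partial t ?U \<omega>))\<^sup>2) < 1"
      using d[rule_format, of ?U] U S0 by (simp add: L2_dist2_eq_L2_norm[OF sqR sqp[OF U(1)]])
    then have "(L2_norm M (\<lambda>\<omega>. R \<omega> - partial t ?U \<omega>))\<^sup>2 < 1" by simp
    then have n1: "L2_norm M (\<lambda>\<omega>. R \<omega> - partial t ?U \<omega>) < 1"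
      by (metis L2_norm_nonneg one_power2 power_less_imp_less_base zero_le_one)
    have split: "partial t ?U \<omega> = partial t S \<omega> + partial t ?D \<omega>" for \<omega>
    proof -
      have "?U = S \<union> ?D" by auto
      then show ?thesis unfolding partial_def using S S0 by (metis Diff_disjoint finite_Diff sum.union_disjoint)
    qed
    have "partial t S = (\<lambda>\<omega>. (partial t ?U \<omega> - R \<omega>) + (R \<omega> - partial t ?D \<omega>))" by (auto simp: split)
    then have "L2_norm M (partial t S) = L2_norm M (\<lambda>\<omega>. (partial t ?U \<omega> - R \<omega>) + (R \<omega> - partial t ?D \<omega>))" by simp
    also have "\<dots> \<le> L2_norm M (\<lambda>\<omega>. partial t ?U \<omega> - R \<omega>) + L2_norm M (\<lambda>\<omega>. R \<omega> - partial t ?D \<omega>)"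
      by (intro L2_norm_triangle square_integrable_diff sqp U sqR)
    also have "L2_norm M (\<lambda>\<omega>. R \<omega> - partial t ?D \<omega>) \<le> L2_norm M R + L2_norm M (partial t ?D)"
      using L2_norm_triangle_diff[OF sqR square_integrable_zero sqp[OF U(3)]] by (simp add: L2_norm_def)
    also have "L2_norm M (partial t ?D) \<le> (\<Sum>w\<in>?D. L2_norm M (X t w))"
      unfolding partial_def[abs_def] using U B by (intro L2_norm_le_sum sq[OF t]) auto
    also have "\<dots> \<le> (\<Sum>w\<in>S0. L2_norm M (X t w))"
      using S0 by (intro sum_mono2) auto
    finally show ?thesis using n1 unfolding C_def L2_norm_minus[of M "partial t ?U"] by linarith
  qed
  moreover have "0 \<le> C" unfolding C_def using sumn L2_norm_nonneg[of M R] by linarith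
  ultimately show ?thesis using that by blast
qed

lemma grade_coeff_bound:
  assumes t: "t \<in> {0..<T}" and S: "finite S" "S \<subseteq> B" and B: "B \<subseteq> W"
    and C: "\<And>S. finite S \<Longrightarrow> S \<subseteq> B \<Longrightarrow> L2_norm M (partial t S) \<le> C"
  shows "\<bar>grade_coeff S k * t ^ k\<bar> \<le> (real (Suc k))\<^sup>2 * C\<^sup>2"
proof -
  have b: "\<bar>ip t {u \<in> S. P u} {v \<in> S. P' v}\<bar> \<le> C\<^sup>2" for P P'
  proof -
    have s: "finite {u \<in> S. P u}" "{u \<in> S. P u} \<subseteq> B" for P using S by auto
    have "\<bar>ip t {u \<in> S. P u} {v \<in> S. P' v}\<bar> \<le> L2_norm M (partial t {u \<in> S. P u}) * L2_norm M (partial t {v \<in> S. P' v})"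
      unfolding ip_def using s B by (intro L2_norm_Cauchy_Schwarz sq_partial[OF t]) blast+
    also have "\<dots> \<le> C * C"
      using C[OF s] by (intro mult_mono) (auto intro: order_trans[OF L2_norm_nonneg])
    finally show ?thesis by (simp add: power2_eq_square)
  qed
  have "\<bar>grade_coeff S k * t ^ k\<bar> \<le> (\<Sum>p\<le>k. \<Sum>q\<le>k. \<bar>ip t {u \<in> S. z u = p \<and> x u = q} {v \<in> S. z v + p + q = k \<and> x v = q}\<bar>)"
    using S B unfolding grade_coeff_grouped[OF t order_trans[OF S(2) B] S(1)]
    by (intro order_trans[OF sum_abs] sum_mono order_trans[OF sum_abs] order_refl)
  also have "\<dots> \<le> (\<Sum>p\<le>k. \<Sum>q\<le>k. C\<^sup>2)" by (intro sum_mono b)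
  also have "\<dots> = (real (Suc k))\<^sup>2 * C\<^sup>2" by (simp add: power2_eq_square)
  finally show ?thesis .
qed

lemma norm_partial_tendsto:
  assumes t: "t \<in> {0..<T}" and B: "B \<subseteq> W" and R: "L2_has_sum M (X t) B R"
    and E: "filterlim E (finite_subsets_at_top B) sequentially" "\<And>j. E j \<subseteq> B"
  shows "(\<lambda>j. (L2_norm M (partial t (E j)))\<^sup>2) \<longlonglongrightarrow> (L2_norm M R)\<^sup>2"
proof -
  have "((\<lambda>S. L2_dist2 M R (partial t S)) \<longlongrightarrow> 0) (finite_subsets_at_top B)"
    using R by (simp add: L2_has_sum_def partial_def[abs_def])
  from filterlim_compose[OF this E(1)]
  have "(\<lambda>j. L2_dist2 M R (partial t (E j))) \<longlonglongrightarrow> 0" .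
  then have "L2_lim M (\<lambda>j. partial t (E j)) R"
    using R E(2) B by (intro L2_limI_dist2 sq_partial[OF t]) (auto simp: L2_has_sum_def)
  from L2_lim_inner[OF this this] show ?thesis by (simp add: L2_norm_sq power2_norm_eq_inner)
qed

lemma norm_power_series:
  assumes B: "B \<subseteq> W" and R: "\<And>t. t \<in> {0..<T} \<Longrightarrow> L2_has_sum M (X t) B (R t)"
    and E: "filterlim E (finite_subsets_at_top B) sequentially" "\<And>j. finite (E j)" "\<And>j. E j \<subseteq> B"
    and a: "\<And>k. (\<lambda>j. grade_coeff (E j) k) \<longlonglongrightarrow> a k" and t: "t \<in> {0..<T}"
  shows "(\<lambda>k. a k * t ^ k) sums (L2_norm M (R t))\<^sup>2"
proof -
  \<comment> \<open>The midpoint of \<open>t\<close> and \<open>T\<close>: the coefficient bound at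
    \<open>u\<close> makes the terms at \<open>t\<close> decay like powers of
    \<open>t / u < 1\<close>.\<close>
  define u where "u = (t + T) / 2"
  have u: "u \<in> {0..<T}" "0 < u" "t < u" using t by (auto simp: u_def)
  obtain C where C: "0 \<le> C" "\<And>S. finite S \<Longrightarrow> S \<subseteq> B \<Longrightarrow> L2_norm M (partial u S) \<le> C"
    using partial_bounded[OF u(1) B R[OF u(1)]] by blast
  have bound: "norm (grade_coeff (E j) k * t ^ k) \<le> C\<^sup>2 * ((real (Suc k))\<^sup>2 * (t / u) ^ k)" for j k
  proof -
    have "\<bar>grade_coeff (E j) k * t ^ k\<bar> = \<bar>grade_coeff (E j) k * u ^ k\<bar> * (t / u) ^ k"
      using t u by (simp add: abs_mult power_divide)
    also have "\<dots> \<le> ((real (Suc k))\<^sup>2 * C\<^sup>2) * (t / u) ^ k"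
      using t u by (intro mult_right_mono grade_coeff_bound[OF u(1) E(2,3) B C(2)]) auto
    finally show ?thesis by (simp add: mult_ac)
  qed
  have "summable (\<lambda>k. C\<^sup>2 * ((real (Suc k))\<^sup>2 * (t / u) ^ k))"
    using t u by (intro summable_mult summable_square_geometric) auto
  note sm = this
  \<comment> \<open>A majorant summable in \<open>k\<close> and independent of \<open>j\<close>;
    Tannery's theorem then exchanges the limit in \<open>j\<close> with the sum over
    \<open>k\<close>.\<close>
  have "eventually (\<lambda>(k, j). norm (grade_coeff (E j) k * t ^ k) \<le> C\<^sup>2 * ((real (Suc k))\<^sup>2 * (t / u) ^ k)) (at_top \<times>\<^sub>F sequentially)"
    using bound by (intro always_eventually) auto
  from tannerys_theorem[OF tendsto_mult[OF a tendsto_const] this sm]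
  have tan: "summable (\<lambda>k. norm (a k * t ^ k))" "(\<lambda>j. \<Sum>k. grade_coeff (E j) k * t ^ k) \<longlonglongrightarrow> (\<Sum>k. a k * t ^ k)"
    by simp_all
  have "(\<Sum>k. grade_coeff (E j) k * t ^ k) = (L2_norm M (partial t (E j)))\<^sup>2" for j
    using grade_coeff_sums[OF t order_trans[OF E(3) B]] by (simp add: sums_iff)
  then have "(\<Sum>k. a k * t ^ k) = (L2_norm M (R t))\<^sup>2"
    using LIMSEQ_unique[OF tan(2)] norm_partial_tendsto[OF t B R[OF t] E(1,3)] by simp
  then show ?thesis using summable_norm_cancel[OF tan(1)] by (simp add: sums_iff)
qed

text \<open>The exponent \<open>z u + z v + x u\<close> is at least the word length of
  \<open>u\<close>, hence at least \<open>n + 1\<close>. Equality forces \<open>z v = 0\<close>;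
  then \<open>x u = x v\<close> is at least \<open>n + 1\<close>, and so
  \<open>z u = 0\<close>.\<close>

lemma word_length_coeff:
  assumes S: "finite S" "S \<subseteq> W" and g: "\<And>w. w \<in> S \<Longrightarrow> n + 1 \<le> z w + x w"
  shows "k \<le> n \<Longrightarrow> grade_coeff S k = 0"
    and "t \<in> {0..<T} \<Longrightarrow> grade_coeff S (n + 1) * t ^ (n + 1)
      = ip t {w \<in> S. z w = 0 \<and> x w = n + 1} {w \<in> S. z w = 0 \<and> x w = n + 1}"
proof -
  assume "k \<le> n"
  show "grade_coeff S k = 0" unfolding grade_coeff_def
  proof (intro sum.neutral ballI)
    fix u v assume "u \<in> S" "v \<in> S"
    then show "(if z u + z v + x u = k \<and> x v = x u then \<gamma> u v else 0) = 0"
      using g[of u] \<open>k \<le> n\<close> by auto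
  qed
next
  assume t: "t \<in> {0..<T}"
  let ?c = "{w \<in> S. z w = 0 \<and> x w = n + 1}"
  have "grade_coeff S (n + 1) = (\<Sum>u\<in>S. \<Sum>v\<in>S. if (z u = 0 \<and> x u = n + 1) \<and> z v = 0 \<and> x v = n + 1 then \<gamma> u v else 0)"
    unfolding grade_coeff_def
  proof (intro sum.cong refl)
    fix u v assume "u \<in> S" "v \<in> S"
    then have "z u + z v + x u = n + 1 \<and> x v = x u \<longleftrightarrow> (z u = 0 \<and> x u = n + 1) \<and> z v = 0 \<and> x v = n + 1"
      using g[of u] g[of v] by auto
    then show "(if z u + z v + x u = n + 1 \<and> x v = x u then \<gamma> u v else 0)
      = (if (z u = 0 \<and> x u = n + 1) \<and> z v = 0 \<and> x v = n + 1 then \<gamma> u v else 0)" by simp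
  qed
  also have "\<dots> = (\<Sum>u\<in>?c. \<Sum>v\<in>?c. \<gamma> u v)"
    using S(1) by (simp add: sum.inter_filter) (auto intro!: sum.cong sum.neutral)
  finally have "grade_coeff S (n + 1) * t ^ (n + 1) = (\<Sum>u\<in>?c. \<Sum>v\<in>?c. \<gamma> u v * t ^ (n + 1))"
    by (simp add: sum_distrib_right)
  also have "\<dots> = (\<Sum>u\<in>?c. \<Sum>v\<in>?c. \<gamma> u v * t ^ (z u + z v + x u))"
    by (intro sum.cong refl) auto
  also have "\<dots> = ip t ?c ?c" using S by (intro ip_sum[OF t, symmetric]) auto
  finally show "grade_coeff S (n + 1) * t ^ (n + 1) = ip t ?c ?c" .
qed

text \<open>For \<open>x u = x v\<close> the exponent \<open>z u + z v + x u\<close> is the mean of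
  the two mean-square grades. At the value \<open>n + 1\<close> both grades equal
  \<open>n + 1\<close>, so \<open>z u = z v\<close>: classes are paired only with themselves, and
  every contribution is a squared norm.\<close>

lemma mean_square_coeff:
  assumes S: "finite S" "S \<subseteq> W" and g: "\<And>w. w \<in> S \<Longrightarrow> n + 1 \<le> 2 * z w + x w"
  shows "k \<le> n \<Longrightarrow> grade_coeff S k = 0"
    and "t \<in> {0..<T} \<Longrightarrow> ip t {w \<in> S. z w = 0 \<and> x w = n + 1} {w \<in> S. z w = 0 \<and> x w = n + 1}
      \<le> grade_coeff S (n + 1) * t ^ (n + 1)"
proof -
  assume "k \<le> n"
  show "grade_coeff S k = 0" unfolding grade_coeff_def
  proof (intro sum.neutral ballI)
    fix u v assume "u \<in> S" "v \<in> S"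
    then show "(if z u + z v + x u = k \<and> x v = x u then \<gamma> u v else 0) = 0"
      using g[of u] g[of v] \<open>k \<le> n\<close> by auto
  qed
next
  assume t: "t \<in> {0..<T}"
  define k where "k = n + 1"
  define h where "h p q = ip t {u \<in> S. z u = p \<and> x u = q} {v \<in> S. z v + p + q = k \<and> x v = q}" for p q
  have h_nonneg: "0 \<le> h p q" for p q
  proof (cases "{u \<in> S. z u = p \<and> x u = q} = {} \<or> {v \<in> S. z v + p + q = k \<and> x v = q} = {}")
    case True
    then show ?thesis unfolding h_def by (elim disjE) (simp_all only: ip_empty order_refl)
  next
    case False
    then obtain u v where "u \<in> S" "z u = p" "x u = q" "v \<in> S" "z v + p + q = k" "x v = q" by blast
    then have "2 * p + q = k" using g[of u] g[of v] by (simp add: k_def)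
    then have "{v \<in> S. z v + p + q = k \<and> x v = q} = {u \<in> S. z u = p \<and> x u = q}" by auto
    then show ?thesis by (simp add: h_def ip_self)
  qed
  \<comment> \<open>Of the nonnegative contributions only the class without zero letters is
    kept.\<close>
  have "h 0 k \<le> (\<Sum>q\<le>k. h 0 q)" using h_nonneg by (intro member_le_sum) auto
  also have "\<dots> \<le> (\<Sum>p\<le>k. \<Sum>q\<le>k. h p q)"
    using h_nonneg by (intro member_le_sum[of 0 "{..k}" "\<lambda>p. \<Sum>q\<le>k. h p q"]) (auto intro: sum_nonneg)
  also have "\<dots> = grade_coeff S k * t ^ k" unfolding h_def by (rule grade_coeff_grouped[OF t S(2,1), symmetric])
  finally show "ip t {w \<in> S. z w = 0 \<and> x w = n + 1} {w \<in> S. z w = 0 \<and> x w = n + 1}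
      \<le> grade_coeff S (n + 1) * t ^ (n + 1)"
    by (simp add: h_def k_def)
qed

text \<open>The coefficients of the partial sums are known to be bounded, so their limits are taken
  along a subsequence. It has to be the same for both remainders, since the inequality compares the
  two coefficients of one and the same stage.\<close>

theorem leading_order_comparison:
  assumes W: "countable W" "W \<noteq> {}"
    and wl: "\<And>t. t \<in> {0..<T} \<Longrightarrow> L2_has_sum M (X t) {w \<in> W. n + 1 \<le> z w + x w} (R_wl t)"
    and ms: "\<And>t. t \<in> {0..<T} \<Longrightarrow> L2_has_sum M (X t) {w \<in> W. n + 1 \<le> 2 * z w + x w} (R_ms t)"
  shows "\<exists>a b :: nat \<Rightarrow> real.
      (\<forall>t\<in>{0..<T}. (\<lambda>k. a k * t ^ k) sums (L2_norm M (R_wl t))\<^sup>2) \<and>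
      (\<forall>t\<in>{0..<T}. (\<lambda>k. b k * t ^ k) sums (L2_norm M (R_ms t))\<^sup>2) \<and>
      (\<forall>k\<le>n. a k = 0 \<and> b k = 0) \<and>
      a (n + 1) \<le> b (n + 1)"
proof -
  \<comment> \<open>The Boolean selects the grading (\<open>True\<close> for word length), so that
    one extraction of a subsequence treats both remainders.\<close>
  define B where "B c = (if c then {w \<in> W. n + 1 \<le> z w + x w} else {w \<in> W. n + 1 \<le> 2 * z w + x w})" for c
  define R where "R c = (if c then R_wl else R_ms)" for c
  \<comment> \<open>One exhaustion of all words, later intersected with both index sets, so that
    both partial sums contain the same words of the deciding class.\<close>
  define E where "E j = from_nat_into W ` {..j}" for j :: nat
  have BW: "B c \<subseteq> W" for c by (auto simp: B_def)
  have R: "L2_has_sum M (X t) (B c) (R c t)" if "t \<in> {0..<T}" for t c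
    using wl[OF that] ms[OF that] by (simp add: B_def R_def)
  have E_fin: "finite (E j \<inter> B c)" for j c by (simp add: E_def)
  have E_lim: "filterlim (\<lambda>j. E j \<inter> B c) (finite_subsets_at_top (B c)) sequentially" for c
    unfolding filterlim_finite_subsets_at_top
  proof (intro allI impI)
    fix S assume S: "finite S \<and> S \<subseteq> B c"
    have "\<forall>w\<in>S. \<exists>i. w = from_nat_into W i"
      using S BW[of c] range_from_nat_into[OF W(2,1)] by blast
    then obtain i where i: "\<And>w. w \<in> S \<Longrightarrow> w = from_nat_into W (i w)" by metis
    define N where "N = Max (insert 0 (i ` S))"
    have "S \<subseteq> E j" if "N \<le> j" for j
    proof
      fix w assume w: "w \<in> S"
      then have "i w \<le> N" using S unfolding N_def by (intro Max_ge) auto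
      then show "w \<in> E j" unfolding E_def using i[OF w] that by (intro image_eqI[of _ _ "i w"]) auto
    qed
    then show "\<forall>\<^sub>F j in sequentially. finite (E j \<inter> B c) \<and> S \<subseteq> E j \<inter> B c \<and> E j \<inter> B c \<subseteq> B c"
      unfolding eventually_sequentially using S E_fin by (intro exI[of _ N]) auto
  qed
  \<comment> \<open>The coefficients do not depend on time; any fixed time strictly between 0 and
    \<open>T\<close> serves to bound and to compare them.\<close>
  define s where "s = T / 2"
  have s: "s \<in> {0..<T}" "0 < s" using T_pos by (auto simp: s_def)
  have "\<exists>C. \<forall>S. finite S \<longrightarrow> S \<subseteq> B c \<longrightarrow> L2_norm M (partial s S) \<le> C" for c
    by (rule partial_bounded[OF s(1) BW R[OF s(1)]]) blast
  then obtain C where C: "\<And>c S. finite S \<Longrightarrow> S \<subseteq> B c \<Longrightarrow> L2_norm M (partial s S) \<le> C c" by metis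
  \<comment> \<open>Scaled to be bounded uniformly in the stage, the degree and the grading, as
    needed for a subsequence that converges at every point of a countable set.\<close>
  define f where "f j y = grade_coeff (E j \<inter> B (snd y)) (fst y) * s ^ fst y / (real (Suc (fst y)))\<^sup>2" for j and y :: "nat \<times> bool"
  have f: "norm (f j y) \<le> max ((C True)\<^sup>2) ((C False)\<^sup>2)" for j y
  proof -
    obtain k c where y: "y = (k, c)" by (cases y)
    have pos: "0 < (real (Suc k))\<^sup>2" by simp
    have "\<bar>grade_coeff (E j \<inter> B c) k * s ^ k\<bar> \<le> (real (Suc k))\<^sup>2 * (C c)\<^sup>2"
      by (rule grade_coeff_bound[OF s(1) E_fin _ BW[of c] C]) auto
    then have "\<bar>grade_coeff (E j \<inter> B c) k * s ^ k\<bar> / (real (Suc k))\<^sup>2 \<le> (C c)\<^sup>2"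
      using pos by (simp add: pos_divide_le_eq mult.commute del: of_nat_Suc)
    also have "(C c)\<^sup>2 \<le> max ((C True)\<^sup>2) ((C False)\<^sup>2)" by (cases c) auto
    finally show ?thesis by (simp add: f_def y del: of_nat_Suc)
  qed
  obtain r where r: "strict_mono r" "\<And>y. \<exists>L. (\<lambda>j. f (r j) y) \<longlonglongrightarrow> L"
    using function_convergent_subsequence[of "UNIV :: (nat \<times> bool) set" f, OF _ f] by auto
  have "\<exists>L. (\<lambda>j. grade_coeff (E (r j) \<inter> B c) k) \<longlonglongrightarrow> L" for c k
  proof -
    obtain L where "(\<lambda>j. f (r j) (k, c)) \<longlonglongrightarrow> L" using r(2) by blast
    from tendsto_mult[OF this tendsto_const, of "(real (Suc k))\<^sup>2 / s ^ k"]
    have "(\<lambda>j. grade_coeff (E (r j) \<inter> B c) k) \<longlonglongrightarrow> L * ((real (Suc k))\<^sup>2 / s ^ k)"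
      using s by (simp add: f_def del: of_nat_Suc)
    then show ?thesis ..
  qed
  then obtain a where a: "\<And>c k. (\<lambda>j. grade_coeff (E (r j) \<inter> B c) k) \<longlonglongrightarrow> a c k" by metis
  have sm: "(\<lambda>k. a c k * t ^ k) sums (L2_norm M (R c t))\<^sup>2" if t: "t \<in> {0..<T}" for c t
    by (rule norm_power_series[OF BW R _ E_fin _ a t])
       (auto intro: filterlim_compose[OF E_lim filterlim_subseq[OF r(1)]])
  have "\<forall>t\<in>{0..<T}. (\<lambda>k. a True k * t ^ k) sums (L2_norm M (R_wl t))\<^sup>2"
    using sm[of _ True] by (simp add: R_def)
  moreover have "\<forall>t\<in>{0..<T}. (\<lambda>k. a False k * t ^ k) sums (L2_norm M (R_ms t))\<^sup>2"
    using sm[of _ False] by (simp add: R_def)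
  moreover have "a c k = 0" if "k \<le> n" for c k
  proof -
    have "grade_coeff (E j \<inter> B c) k = 0" for j
    proof (cases c)
      case True
      show ?thesis by (rule word_length_coeff(1)[OF E_fin _ _ that]) (use True BW in \<open>auto simp: B_def\<close>)
    next
      case False
      show ?thesis by (rule mean_square_coeff(1)[OF E_fin _ _ that]) (use False BW in \<open>auto simp: B_def\<close>)
    qed
    then show ?thesis using a[where c=c and k=k] by (simp add: LIMSEQ_const_iff)
  qed
  moreover have "a True (n + 1) \<le> a False (n + 1)"
  proof (rule LIMSEQ_le[OF a a])
    have "grade_coeff (E j \<inter> B True) (n + 1) \<le> grade_coeff (E j \<inter> B False) (n + 1)" for j
    proof -
      \<comment> \<open>Words with \<open>n + 1\<close> nonzero letters and no zero have grade
        \<open>n + 1\<close> in both gradings.\<close>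
      have "{w \<in> E j \<inter> B True. z w = 0 \<and> x w = n + 1} = {w \<in> E j \<inter> B False. z w = 0 \<and> x w = n + 1}"
        by (auto simp: B_def)
      moreover have "grade_coeff (E j \<inter> B True) (n + 1) * s ^ (n + 1)
         = ip s {w \<in> E j \<inter> B True. z w = 0 \<and> x w = n + 1} {w \<in> E j \<inter> B True. z w = 0 \<and> x w = n + 1}"
        by (rule word_length_coeff(2)[OF E_fin _ _ s(1)]) (auto simp: B_def)
      moreover have "ip s {w \<in> E j \<inter> B False. z w = 0 \<and> x w = n + 1} {w \<in> E j \<inter> B False. z w = 0 \<and> x w = n + 1}
         \<le> grade_coeff (E j \<inter> B False) (n + 1) * s ^ (n + 1)"
        by (rule mean_square_coeff(2)[OF E_fin _ _ s(1)]) (auto simp: B_def)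
      ultimately have "grade_coeff (E j \<inter> B True) (n + 1) * s ^ (n + 1) \<le> grade_coeff (E j \<inter> B False) (n + 1) * s ^ (n + 1)"
        by (simp only:)
      then show ?thesis using s(2) by simp
    qed
    then show "\<exists>N. \<forall>j\<ge>N. grade_coeff (E (r j) \<inter> B True) (n + 1) \<le> grade_coeff (E (r j) \<inter> B False) (n + 1)" by blast
  qed
  ultimately show ?thesis by (intro exI[of _ "a True"] exI[of _ "a False"]) auto
qed

end

text \<open>Only the products of \<open>U\<close> and \<open>V\<close> with the iterated integrals
  are known to be square integrable. The constant is therefore a limit of \<open>C\<close> times the
  means of truncations of \<open>U \<bullet> V\<close>, and not \<open>C\<close> times a mean of
  \<open>U \<bullet> V\<close>.\<close>

lemma (in iterated_integral_space) weighted_moment: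
  fixes U V :: "'a \<Rightarrow> 'b::euclidean_space"
  assumes u: "u \<in> lists A" and v: "v \<in> lists A" and T: "0 < T"
    and U: "U \<in> borel_measurable (F 0)" and V: "V \<in> borel_measurable (F 0)"
    and sqU: "\<And>t. t \<in> {0..<T} \<Longrightarrow> square_integrable M (\<lambda>\<omega>. I u t \<omega> *\<^sub>R U \<omega>)"
    and sqV: "\<And>t. t \<in> {0..<T} \<Longrightarrow> square_integrable M (\<lambda>\<omega>. I v t \<omega> *\<^sub>R V \<omega>)"
  shows "\<exists>\<gamma>. (nonzero_count u \<noteq> nonzero_count v \<longrightarrow> \<gamma> = 0) \<and>
    (\<forall>t\<in>{0..<T}. (\<integral>\<omega>. (I u t \<omega> *\<^sub>R U \<omega>) \<bullet> (I v t \<omega> *\<^sub>R V \<omega>) \<partial>M)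
      = \<gamma> * t ^ (zero_count u + zero_count v + nonzero_count u))"
proof -
  define k where "k = zero_count u + zero_count v + nonzero_count u"
  define L where "L t = (\<integral>\<omega>. (I u t \<omega> *\<^sub>R U \<omega>) \<bullet> (I v t \<omega> *\<^sub>R V \<omega>) \<partial>M)" for t
  obtain C where C: "moment u v C" using moment_exists[OF u v] by blast
  \<comment> \<open>Cutting off both norms at \<open>m\<close> makes the weight bounded, so that the
    moment formula for weights known at time 0 applies.\<close>
  define h where "h m \<omega> = (if norm (U \<omega>) \<le> real m \<and> norm (V \<omega>) \<le> real m then U \<omega> \<bullet> V \<omega> else 0)" for m \<omega>
  have h: "bounded_past 0 (h m)" for m
  proof -
    have "h m \<in> borel_measurable (F 0)" unfolding h_def using U V by measurable
    moreover have "\<bar>h m \<omega>\<bar> \<le> real m * real m" for \<omega>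
    proof (cases "norm (U \<omega>) \<le> real m \<and> norm (V \<omega>) \<le> real m")
      case True
      have "\<bar>U \<omega> \<bullet> V \<omega>\<bar> \<le> norm (U \<omega>) * norm (V \<omega>)" by (rule Cauchy_Schwarz_ineq2)
      also have "\<dots> \<le> real m * real m" using True by (intro mult_mono) auto
      finally show ?thesis using True by (simp add: h_def)
    qed (auto simp: h_def)
    ultimately show ?thesis by (auto simp: bounded_past_def)
  qed
  have lim: "(\<lambda>m. (C * (\<integral>\<omega>. h m \<omega> \<partial>M)) * t ^ k) \<longlonglongrightarrow> L t" if t: "t \<in> {0..<T}" for t
  proof -
    have int: "integrable M (\<lambda>\<omega>. (I u t \<omega> *\<^sub>R U \<omega>) \<bullet> (I v t \<omega> *\<^sub>R V \<omega>))"
      by (rule square_integrable_inner[OF sqU[OF t] sqV[OF t]])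
    have [measurable]: "I u t \<in> borel_measurable M" "I v t \<in> borel_measurable M"
      using cadlag_I[OF u] cadlag_I[OF v] t by (auto simp: cadlag_process_def)
    note [measurable] = bounded_past_measurable[OF h]
    have "(\<lambda>m. \<integral>\<omega>. h m \<omega> * (I u t \<omega> * I v t \<omega>) \<partial>M) \<longlonglongrightarrow> L t"
      unfolding L_def
    proof (rule integral_dominated_convergence)
      show "integrable M (\<lambda>\<omega>. \<bar>(I u t \<omega> *\<^sub>R U \<omega>) \<bullet> (I v t \<omega> *\<^sub>R V \<omega>)\<bar>)" using int by simp
      show "(\<lambda>\<omega>. (I u t \<omega> *\<^sub>R U \<omega>) \<bullet> (I v t \<omega> *\<^sub>R V \<omega>)) \<in> borel_measurable M" using int by auto
      show "(\<lambda>\<omega>. h m \<omega> * (I u t \<omega> * I v t \<omega>)) \<in> borel_measurable M" for m by measurable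
      show "AE \<omega> in M. norm (h m \<omega> * (I u t \<omega> * I v t \<omega>)) \<le> \<bar>(I u t \<omega> *\<^sub>R U \<omega>) \<bullet> (I v t \<omega> *\<^sub>R V \<omega>)\<bar>" for m
        by (intro AE_I2) (auto simp: h_def abs_mult mult_ac)
      show "AE \<omega> in M. (\<lambda>m. h m \<omega> * (I u t \<omega> * I v t \<omega>)) \<longlonglongrightarrow> (I u t \<omega> *\<^sub>R U \<omega>) \<bullet> (I v t \<omega> *\<^sub>R V \<omega>)"
      proof (intro AE_I2 tendsto_eventually)
        fix \<omega>
        obtain N where "max (norm (U \<omega>)) (norm (V \<omega>)) \<le> real N" using real_arch_simple by blast
        then have "norm (U \<omega>) \<le> real m \<and> norm (V \<omega>) \<le> real m" if "N \<le> m" for m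
          using that by (auto intro: order_trans)
        then show "\<forall>\<^sub>F m in sequentially. h m \<omega> * (I u t \<omega> * I v t \<omega>) = (I u t \<omega> *\<^sub>R U \<omega>) \<bullet> (I v t \<omega> *\<^sub>R V \<omega>)"
          unfolding eventually_sequentially by (intro exI[of _ N]) (auto simp: h_def mult_ac)
      qed
    qed
    then show ?thesis using momentD[OF C h, of t] t by (simp add: k_def)
  qed
  define s where "s = T / 2"
  have s: "s \<in> {0..<T}" "0 < s" using T by (auto simp: s_def)
  \<comment> \<open>Division by \<open>s ^ k\<close> at one positive time shows that the factors in
    front of the monomial converge; their limit then serves all times.\<close>
  define \<gamma> where "\<gamma> = L s / s ^ k"
  have "(\<lambda>m. C * (\<integral>\<omega>. h m \<omega> \<partial>M)) \<longlonglongrightarrow> \<gamma>"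
    using tendsto_divide[OF lim[OF s(1)] tendsto_const, of "s ^ k"] s(2) by (simp add: \<gamma>_def)
  note g = this
  have "L t = \<gamma> * t ^ k" if t: "t \<in> {0..<T}" for t
    by (rule LIMSEQ_unique[OF lim[OF t] tendsto_mult[OF g tendsto_const]])
  moreover have "\<gamma> = 0" if "nonzero_count u \<noteq> nonzero_count v"
    using g C that by (simp add: moment_def LIMSEQ_const_iff)
  ultimately show ?thesis unfolding L_def k_def by blast
qed

lemma countable_words: "countable (lists (A :: letter set))"
proof -
  have "A \<subseteq> range Base \<union> range (case_prod Power)"
  proof
    fix a :: letter
    show "a \<in> range Base \<union> range (case_prod Power)" by (cases a) (auto simp: image_iff)
  qed
  then have "countable A" by (rule countable_subset) auto
  then show ?thesis by (rule countable_lists)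
qed

text \<open>The comparison at leading order concerns true expansions: both squared norms are sums of
  convergent power series on an interval of positive length, so the coefficients are uniquely
  determined.\<close>

theorem theorem3:
  fixes M :: "'a measure" and F :: "real \<Rightarrow> 'a measure"
    and d l n :: nat and T :: real
    and W :: "nat \<Rightarrow> real \<Rightarrow> 'a \<Rightarrow> real"
    and \<rho> :: "nat \<Rightarrow> real measure"
    and Q :: "nat \<Rightarrow> 'a \<Rightarrow> (real \<times> real) measure"
    and J :: "nat \<Rightarrow> nat \<Rightarrow> real \<Rightarrow> 'a \<Rightarrow> real"
    and V :: "nat \<Rightarrow> real ^ 'n \<Rightarrow> real ^ 'n"
    and y0 :: "'a \<Rightarrow> real ^ 'n"
    and y R_wl R_ms :: "real \<Rightarrow> 'a \<Rightarrow> real ^ 'n"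
    and A :: "letter set"
    and I :: "letter list \<Rightarrow> real \<Rightarrow> 'a \<Rightarrow> real"
    and Vt :: "letter \<Rightarrow> (real ^ 'n \<Rightarrow> real ^ 'n) \<Rightarrow> (real ^ 'n \<Rightarrow> real ^ 'n)"
  assumes drivers: "levy_drivers M F d l W \<rho> Q J"
    and initial: "y0 \<in> borel_measurable (F 0)" "square_integrable M y0"
    and sde: "solves_sde M F d l W J V y0 y"
    and A_def: "A = alphabet M d l J"
    and integrals: "iterated_integrals M F A (driver d W J) I"
    and operators: "\<And>w. w \<in> lists A \<Longrightarrow> word_operator Vt w id \<in> borel_measurable borel"
    and T_pos: "0 < T"
    and expansion: "\<And>t. t \<in> {0..<T} \<Longrightarrow>
      L2_has_sum M (\<lambda>w \<omega>. I w t \<omega> *\<^sub>R word_operator Vt w id (y0 \<omega>)) (lists A) (y t)"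
    and remainder_wl: "\<And>t. t \<in> {0..<T} \<Longrightarrow>
      L2_has_sum M (\<lambda>w \<omega>. I w t \<omega> *\<^sub>R word_operator Vt w id (y0 \<omega>))
        {w \<in> lists A. n + 1 \<le> wl_grade w} (R_wl t)"
    and remainder_ms: "\<And>t. t \<in> {0..<T} \<Longrightarrow>
      L2_has_sum M (\<lambda>w \<omega>. I w t \<omega> *\<^sub>R word_operator Vt w id (y0 \<omega>))
        {w \<in> lists A. n + 1 \<le> ms_grade w} (R_ms t)"
  shows "\<exists>a b :: nat \<Rightarrow> real.
      (\<forall>t\<in>{0..<T}. (\<lambda>k. a k * t ^ k) sums (L2_norm M (R_wl t))\<^sup>2) \<and>
      (\<forall>t\<in>{0..<T}. (\<lambda>k. b k * t ^ k) sums (L2_norm M (R_ms t))\<^sup>2) \<and>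
      (\<forall>k\<le>n. a k = 0 \<and> b k = 0) \<and>
      a (n + 1) \<le> b (n + 1)"
proof -
  interpret levy_drivers M F d l W \<rho> Q J by (rule drivers)
  have "driven_space M F (A - {Base 0}) (driver d W J) driver_cov"
    unfolding A_def by (rule driven_space_drivers)
  then interpret iterated_integral_space M F A "driver d W J" driver_cov I
    using integrals by (intro iterated_integral_space.intro iterated_integral_space_axioms.intro)
  define X where "X t w \<omega> = I w t \<omega> *\<^sub>R word_operator Vt w id (y0 \<omega>)" for t w \<omega>
  \<comment> \<open>Square integrability of each term is part of \<open>L2_has_sum\<close>, here for
    the full expansion.\<close>
  have sq: "square_integrable M (X t w)" if "t \<in> {0..<T}" "w \<in> lists A" for t w
    using expansion[OF that(1)] that(2) by (auto simp: L2_has_sum_def X_def[abs_def])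
  \<comment> \<open>The operators are deterministic, so their values at the initial point are known
    at time 0 and can act as weights.\<close>
  have past: "(\<lambda>\<omega>. word_operator Vt w id (y0 \<omega>)) \<in> borel_measurable (F 0)" if "w \<in> lists A" for w
    using measurable_compose[OF initial(1) operators[OF that]] .
  define P where "P u v g \<longleftrightarrow> (nonzero_count u \<noteq> nonzero_count v \<longrightarrow> g = 0) \<and>
    (\<forall>t\<in>{0..<T}. (\<integral>\<omega>. X t u \<omega> \<bullet> X t v \<omega> \<partial>M) = g * t ^ (zero_count u + zero_count v + nonzero_count u))" for u v g
  have ex: "\<exists>g. P u v g" if "u \<in> lists A" "v \<in> lists A" for u v
    unfolding P_def X_def by (rule weighted_moment[OF that T_pos past[OF that(1)] past[OF that(2)]])
      (use sq that in \<open>simp_all add: X_def[abs_def]\<close>)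
  define \<gamma> where "\<gamma> u v = (SOME g. P u v g)" for u v
  have \<gamma>: "P u v (\<gamma> u v)" if "u \<in> lists A" "v \<in> lists A" for u v
    unfolding \<gamma>_def by (rule someI_ex[OF ex[OF that]])
  interpret G: graded_family M T "lists A" X zero_count nonzero_count \<gamma>
    proof
    show "0 < T" by (rule T_pos)
    show "square_integrable M (X t w)" if "t \<in> {0..<T}" "w \<in> lists A" for t w by (rule sq[OF that])
    show "(\<integral>\<omega>. X t u \<omega> \<bullet> X t v \<omega> \<partial>M) = \<gamma> u v * t ^ (zero_count u + zero_count v + nonzero_count u)"
      if "t \<in> {0..<T}" "u \<in> lists A" "v \<in> lists A" for t u v
      using \<gamma>[OF that(2,3)] that(1) by (simp add: P_def)
    show "\<gamma> u v = 0" if "u \<in> lists A" "v \<in> lists A" "nonzero_count u \<noteq> nonzero_count v" for u v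
      using \<gamma>[OF that(1,2)] that(3) by (simp add: P_def)
  qed
  have "lists A \<noteq> {}" by (metis empty_iff lists.Nil)
  from G.leading_order_comparison[OF countable_words this, of n R_wl R_ms]
  show ?thesis
    using remainder_wl remainder_ms by (simp add: wl_grade_def ms_grade_def X_def[abs_def])
qed

end
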